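(* Let $n,k,t$ be positive integers with $n\ge k$. In each of the following cases there exist two cyclic $k$-cycle decompositions $\mathcal{D},\mathcal{D}'$ of the complete multipartite graph $K_{\frac{2nk+t}{t}\times t}$ and a cellular biembedding of the pair $\mathcal{D},\mathcal{D}'$ into an orientable surface: (1) $k=3$, $t\in\{n,2n\}$ and $n$ is odd; (2) $k\in\{3,5,7,9\}$, $t=k$ and $n\equiv 3\pmod 4$.
   Context: $K_{q\times r}$ denotes the complete multipartite graph with $q$ parts each of size $r$. A $k$-cycle decomposition of a graph $K$ is a set $\mathcal{D}$ of subgraphs of $K$, each a cycle of length $k$, whose edge sets partition $E(K)$. It is cyclic if it is left invariant by a cyclic group of bijections of $V(K)$ acting sharply transitively on $V(K)$ (so $V(K)$ can be identified with $\mathbb{Z}_{v}$, $v=|V(K)|$, in such a way that $\mathcal{D}$ is invariant under all translations $x\mapsto x+g$). An embedding of a graph $\Gamma$ in a surface $\Sigma$ is a continuous injective map $\psi:\Gamma\to\Sigma$, with $\Gamma$ viewed as a $1$-dimensional simplicial complex; its faces are the connected components of $\Sigma\setminus\psi(\Gamma)$; it is cellular if each face is homeomorphic to an open disc. A biembedding of two cycle decompositions $\mathcal{D},\mathcal{D}'$ of a simple graph $\Gamma$ is a face $2$-colorable embedding of $\Gamma$ (faces sharing an edge get different colors) in which the boundaries of the faces of one color are exactly the cycles of $\mathcal{D}$ and the boundaries of the faces of the other color are exactly the cycles of $\mathcal{D}'$. *)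

theory Defs
  imports
    "HOL-Complex_Analysis.Complex_Analysis"
    "HOL-Algebra.Bij"
    "HOL-Algebra.Elementary_Groups"
begin

section \<open>Graphs and cycle decompositions\<close>

text \<open>A simple graph is a pair of a vertex set and a set of two-element sets of vertices.\<close>

type_synonym 'a graph = "'a set \<times> 'a set set"

abbreviation verts :: "'a graph \<Rightarrow> 'a set"
  where "verts \<equiv> fst"

abbreviation edges :: "'a graph \<Rightarrow> 'a set set"
  where "edges \<equiv> snd"

definition subgraph :: "'a graph \<Rightarrow> 'a graph \<Rightarrow> bool"
  where "subgraph H G \<longleftrightarrow> verts H \<subseteq> verts G \<and> edges H \<subseteq> edges G"

definition map_graph :: "('a \<Rightarrow> 'b) \<Rightarrow> 'a graph \<Rightarrow> 'b graph"
  where "map_graph f G = (f ` verts G, (\<lambda>e. f ` e) ` edges G)"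

definition cycle_of_list :: "'a list \<Rightarrow> 'a graph"
  where "cycle_of_list xs =
    (set xs, {{xs ! i, xs ! (Suc i mod length xs)} | i. i < length xs})"

definition is_cycle :: "nat \<Rightarrow> 'a graph \<Rightarrow> bool"
  where "is_cycle k C \<longleftrightarrow>
    3 \<le> k \<and> (\<exists>xs. length xs = k \<and> distinct xs \<and> C = cycle_of_list xs)"

definition complete_multipartite :: "nat \<Rightarrow> nat \<Rightarrow> (nat \<times> nat) graph"
  where "complete_multipartite q r =
    (let V = {..<q} \<times> {..<r} in (V, {{x, y} | x y. x \<in> V \<and> y \<in> V \<and> fst x \<noteq> fst y}))"

definition cycle_decomposition :: "nat \<Rightarrow> 'a graph \<Rightarrow> 'a graph set \<Rightarrow> bool"
  where "cycle_decomposition k G D \<longleftrightarrow>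
    (\<forall>C\<in>D. subgraph C G \<and> is_cycle k C) \<and>
    disjoint_family_on edges D \<and> (\<Union>C\<in>D. edges C) = edges G"

definition sharply_transitive_on :: "('a \<Rightarrow> 'a) set \<Rightarrow> 'a set \<Rightarrow> bool"
  where "sharply_transitive_on H V \<longleftrightarrow> (\<forall>x\<in>V. \<forall>y\<in>V. \<exists>!h. h \<in> H \<and> h x = y)"

definition cyclic_cycle_decomposition :: "nat \<Rightarrow> 'a graph \<Rightarrow> 'a graph set \<Rightarrow> bool"
  where "cyclic_cycle_decomposition k G D \<longleftrightarrow>
    cycle_decomposition k G D \<and>
    (\<exists>H. subgroup H (BijGroup (verts G)) \<and>
         cyclic_group (BijGroup (verts G) \<lparr>carrier := H\<rparr>) \<and>
         sharply_transitive_on H (verts G) \<and>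
         (\<forall>h\<in>H. map_graph h ` D = D))"

section \<open>Orientable surfaces\<close>

definition chart :: "'s topology \<Rightarrow> 's set \<Rightarrow> ('s \<Rightarrow> complex) \<Rightarrow> bool"
  where "chart X U \<phi> \<longleftrightarrow>
    openin X U \<and> open (\<phi> ` U) \<and> homeomorphic_map (subtopology X U) (top_of_set (\<phi> ` U)) \<phi>"

text \<open>Surfaces are closed: compact connected two-dimensional topological manifolds
  without boundary. Such a space has at most the cardinality of the continuum, so up to
  homeomorphism every surface is a topology on a subset of any type of that cardinality, such
  as \<open>nat \<times> complex\<close>; existence of a surface may be stated over that type.\<close>

definition surface :: "'s topology \<Rightarrow> bool"
  where "surface X \<longleftrightarrow>
    Hausdorff_space X \<and> second_countable X \<and> compact_space X \<and> connected_space X \<and>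
    (\<forall>x\<in>topspace X. \<exists>U \<phi>. x \<in> U \<and> chart X U \<phi>)"

text \<open>A homeomorphism \<open>f\<close> between open subsets of the plane preserves orientation if it
  has local degree 1 at each point, that is, if it sends small positively oriented circles
  around \<open>z\<close> to loops that wind once, positively, around \<open>f z\<close>.\<close>

definition orientation_preserving_on :: "complex set \<Rightarrow> (complex \<Rightarrow> complex) \<Rightarrow> bool"
  where "orientation_preserving_on S f \<longleftrightarrow>
    (\<forall>z\<in>S. \<forall>\<^sub>F r in at_right 0. winding_number (f \<circ> circlepath z r) (f z) = 1)"

text \<open>A surface is orientable if it has an atlas all of whose transition maps preserve
  orientation.\<close>

definition orientable :: "'s topology \<Rightarrow> bool"
  where "orientable X \<longleftrightarrow>
    (\<exists>A. (\<forall>(U, \<phi>)\<in>A. chart X U \<phi>) \<and> (\<Union>(U, \<phi>)\<in>A. U) = topspace X \<and>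
         (\<forall>(U, \<phi>)\<in>A. \<forall>(V, \<psi>)\<in>A.
            orientation_preserving_on (\<phi> ` (U \<inter> V)) (\<psi> \<circ> inv_into U \<phi>)))"

section \<open>Embeddings of graphs\<close>

text \<open>The geometric realization of a graph as a one-dimensional simplicial complex, in
  barycentric coordinates. As a subspace of the function space with the product topology it
  has the usual topology when the graph is finite. The realization of a
  subgraph is a subset of the realization of the graph.\<close>

definition simplices :: "'a graph \<Rightarrow> 'a set set"
  where "simplices G = (\<lambda>v. {v}) ` verts G \<union> edges G"

definition realization :: "'a graph \<Rightarrow> ('a \<Rightarrow> real) set"
  where "realization G =
    {a. (\<forall>x. 0 \<le> a x) \<and> (\<exists>s\<in>simplices G. (\<forall>x. x \<notin> s \<longrightarrow> a x = 0) \<and> sum a s = 1)}"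

definition embedding :: "'a graph \<Rightarrow> 's topology \<Rightarrow> (('a \<Rightarrow> real) \<Rightarrow> 's) \<Rightarrow> bool"
  where "embedding G X \<psi> \<longleftrightarrow>
    continuous_map (top_of_set (realization G)) X \<psi> \<and> inj_on \<psi> (realization G)"

definition faces :: "'a graph \<Rightarrow> 's topology \<Rightarrow> (('a \<Rightarrow> real) \<Rightarrow> 's) \<Rightarrow> 's set set"
  where "faces G X \<psi> =
    connected_components_of (subtopology X (topspace X - \<psi> ` realization G))"

definition cellular :: "'a graph \<Rightarrow> 's topology \<Rightarrow> (('a \<Rightarrow> real) \<Rightarrow> 's) \<Rightarrow> bool"
  where "cellular G X \<psi> \<longleftrightarrow>
    (\<forall>F\<in>faces G X \<psi>. subtopology X F homeomorphic_space top_of_set (ball (0::complex) 1))"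

definition face_share_edge ::
  "'a graph \<Rightarrow> 's topology \<Rightarrow> (('a \<Rightarrow> real) \<Rightarrow> 's) \<Rightarrow> 's set \<Rightarrow> 's set \<Rightarrow> bool"
  where "face_share_edge G X \<psi> F F' \<longleftrightarrow>
    (\<exists>e\<in>edges G. \<psi> ` realization (e, {e}) \<subseteq> X frontier_of F \<inter> X frontier_of F')"

definition proper_face_coloring ::
  "'a graph \<Rightarrow> 's topology \<Rightarrow> (('a \<Rightarrow> real) \<Rightarrow> 's) \<Rightarrow> ('s set \<Rightarrow> bool) \<Rightarrow> bool"
  where "proper_face_coloring G X \<psi> col \<longleftrightarrow>
    (\<forall>F\<in>faces G X \<psi>. \<forall>F'\<in>faces G X \<psi>.
       F \<noteq> F' \<and> face_share_edge G X \<psi> F F' \<longrightarrow> col F \<noteq> col F')"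

text \<open>Boundaries are compared as subsets of the surface. This loses nothing: the decompositions
  put each edge on the boundary of a face of either color, so no face meets an edge from both
  sides, and by properness distinct faces of one color have distinct boundaries.\<close>

definition biembedding ::
  "'a graph \<Rightarrow> 'a graph set \<Rightarrow> 'a graph set \<Rightarrow> 's topology \<Rightarrow> (('a \<Rightarrow> real) \<Rightarrow> 's) \<Rightarrow> bool"
  where "biembedding G D D' X \<psi> \<longleftrightarrow>
    embedding G X \<psi> \<and>
    (\<exists>col. proper_face_coloring G X \<psi> col \<and>
       (\<lambda>F. X frontier_of F) ` {F \<in> faces G X \<psi>. col F} = (\<lambda>C. \<psi> ` realization C) ` D \<and>
       (\<lambda>F. X frontier_of F) ` {F \<in> faces G X \<psi>. \<not> col F} = (\<lambda>C. \<psi> ` realization C) ` D')"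

end

(*
  Regard Z_v, v = 2nk + t, as the vertex set, two elements being adjacent when their difference
  is not a multiple of v / t. Let A be a set of nk differences containing exactly one of each
  pair d, -d, and partition A in two ways ("rows" and "columns") into n blocks of size k. If each
  block sums to zero and can be ordered so that no proper consecutive partial sum vanishes, then
  the translates of the partial sums of the rows form a cyclic k-cycle decomposition, and so do
  those of the columns. Compose the map "predecessor in the row" with the map "predecessor in the
  column". When this composition permutes A in one single cycle e_0, e_1, ..., inserting the
  negatives gives a cyclic order of all differences, and this order, used as rotation at every
  vertex, has exactly the row cycles and the column cycles as faces. Reversing the order of one
  column turns the k orbits of the composition into one.

  The surface is glued from triangles joining each face centre to the sides of its face; its
  charts map the open star of a vertex into the plane linearly on each triangle, the j-th
  neighbour going to the j-th root of unity.
*)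

theory Submission
  imports Defs "HOL-Number_Theory.Cong"
begin

section \<open>Winding numbers and sectors of the plane\<close>

text \<open>Without the reversal the composition fixes each of the \<open>k\<close> diagonals and
  moves the column by \<open>stride\<close>, which is 1, 2 or -2 modulo \<open>n\<close>; as
  \<open>n\<close> is odd, each diagonal is one orbit. At the reversed column the diagonal index
  drops by 2 instead, and \<open>k\<close> odd makes these drops reach every diagonal. Blocks use
  only the neighbouring indices \<open>i\<close> and \<open>i + 1\<close>. So for
  \<open>t = k\<close> every partial sum is an integer combination of four quantities, and zero sums
  and simplicity become a finite check on coefficients, the same for all \<open>n\<close>. The price
  is a cyclic sequence \<open>w\<close> that, like its negated adjacent sums \<open>d\<close>, is a
  signed arrangement of 1, ..., n. Since the \<open>d\<close> add up to an even number, n (n + 1) /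
  2 must be even, which for odd \<open>n\<close> means n mod 4 = 3. For t = n and t = 2 n the three
  diagonals are instead full residue classes modulo 7 or 8. Orientability is a statement about
  winding numbers. The transition between the charts of two adjacent vertices preserves the sides of
  lines parallel to their edge, which is enough for a straight-line homotopy to a circle.\<close>

lemma winding_number_eq_1_if_same_side:
  fixes f :: "complex \<Rightarrow> complex"
  assumes r: "r > 0" and ce: "c \<noteq> 0" "e \<noteq> 0"
    and cont: "continuous_on (sphere z r) f"
    and im: "\<And>w. w \<in> sphere z r \<Longrightarrow> sgn (Im ((f w - f z) / c)) = sgn (Im ((w - z) / e))"
    and re: "\<And>w. w \<in> sphere z r \<Longrightarrow> Im ((w - z) / e) = 0 \<Longrightarrow>
               sgn (Re ((f w - f z) / c)) = sgn (Re ((w - z) / e))"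
  shows "winding_number (f \<circ> circlepath z r) (f z) = 1"
proof -
  define a where "a = c / e"
  \<comment> \<open>Image of the circle under the similarity w \<mapsto> f z + (c / e) (w - z); it
    starts at angle \<open>Arg a\<close> because \<open>circlepath\<close> starts at angle
    0.\<close>
  define g where "g = part_circlepath (f z) (norm a * r) (Arg a) (Arg a + 2 * pi)"
  have a0: "a \<noteq> 0" using ce by (simp add: a_def)
  have g: "g t = f z + c * ((circlepath z r t - z) / e)" for t
  proof -
    have "complex_of_real (norm a) * exp (\<i> * complex_of_real (Arg a)) = a"
      using Arg_eq[OF a0] by simp
    moreover have "linepath (Arg a) (Arg a + 2 * pi) t = Arg a + 2 * pi * t"
      by (simp add: linepath_def algebra_simps)
    ultimately show ?thesis
      using ce by (simp add: g_def circlepath part_circlepath_def exp_add distrib_left a_def field_simps)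
  qed
  have sph: "circlepath z r t \<in> sphere z r" for t
  proof -
    have "norm (exp (2 * of_real pi * \<i> * of_real t)) = 1"
      by (simp add: norm_exp_eq_Re)
    then have "dist z (circlepath z r t) = r"
      using r unfolding circlepath dist_norm by (simp add: norm_mult)
    then show ?thesis by (simp only: mem_sphere)
  qed
  have "winding_number (f \<circ> circlepath z r) (f z) = winding_number g (f z)"
  proof (rule winding_number_homotopic_loops, rule homotopic_loops_linear)
    show "path (f \<circ> circlepath z r)"
      using r by (intro path_continuous_image) (auto intro: continuous_on_subset[OF cont])
    show "path g" by (simp add: g_def)
    show "pathfinish (f \<circ> circlepath z r) = pathstart (f \<circ> circlepath z r)"
      by (simp add: pathfinish_compose pathstart_compose)
    show "pathfinish g = pathstart g"
      by (simp add: pathstart_def pathfinish_def g) (metis pathfinish_circlepath pathfinish_def pathstart_circlepath pathstart_def)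
    fix t :: real
    define w where "w = circlepath z r t"
    have ws: "w \<in> sphere z r" unfolding w_def by (rule sph)
    define p where "p = (f w - f z) / c"
    define q where "q = (w - z) / e"
    have q0: "q \<noteq> 0" using ws r ce by (auto simp: q_def)
    \<comment> \<open>After translation and division by \<open>c\<close> the segment joins
      \<open>p\<close> to \<open>q\<close>. Both lie strictly on the same side of the real axis, or
      both on it and on the same side of 0, so the segment avoids 0.\<close>
    have "closed_segment (f w) (f z + c * q) \<subseteq> - {f z}"
    proof
      fix x assume "x \<in> closed_segment (f w) (f z + c * q)"
      then obtain u where u: "0 \<le> u" "u \<le> 1" "x = (1 - u) *\<^sub>R f w + u *\<^sub>R (f z + c * q)"
        by (auto simp: closed_segment_def)
      have "x = f z + c * ((1 - u) *\<^sub>R p + u *\<^sub>R q)"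
        using ce by (simp add: u p_def scaleR_conv_of_real field_simps)
      moreover have "(1 - u) *\<^sub>R p + u *\<^sub>R q \<noteq> 0"
      proof
        assume eq: "(1 - u) *\<^sub>R p + u *\<^sub>R q = 0"
        have *: "b = 0" if ab: "sgn a = sgn b" "(1 - u) * a + u * b = 0" for a b :: real
        proof (rule ccontr)
          assume "b \<noteq> 0"
          then consider "a > 0" "b > 0" | "a < 0" "b < 0"
            using ab(1) by (auto simp: sgn_real_def split: if_splits)
          then show False
          proof cases
            case 1
            then have "(1 - u) * a + u * b > 0"
              using u by (cases "u = 0") (auto intro: add_nonneg_pos add_pos_nonneg)
            with ab show False by simp
          next
            case 2
            have "u * (-b) > 0 \<or> (1 - u) * (-a) > 0"
              using 2 u by (cases "u = 0") (auto intro!: mult_pos_neg)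
            moreover have "u * (-b) \<ge> 0" "(1 - u) * (-a) \<ge> 0"
              using 2 u by (intro mult_nonneg_nonneg; simp)+
            ultimately have "(1 - u) * (-a) + u * (-b) > 0" by linarith
            with ab show False by (simp add: algebra_simps)
          qed
        qed
        have I: "Im q = 0"
          by (rule *[of "Im p"]) (use im[OF ws] arg_cong[OF eq, of Im] in \<open>auto simp: p_def q_def\<close>)
        have "Re q = 0"
          by (rule *[of "Re p"]) (use re[OF ws] I arg_cong[OF eq, of Re] in \<open>auto simp: p_def q_def\<close>)
        with I q0 show False by (simp add: complex_eq_iff)
      qed
      ultimately show "x \<in> - {f z}" using ce by simp
    qed
    then show "closed_segment ((f \<circ> circlepath z r) t) (g t) \<subseteq> - {f z}"
      by (simp add: g w_def q_def)
  qed
  also have "\<dots> = 1"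
  proof -
    define R where "R = norm a * r"
    have R: "R > 0" using a0 r by (simp add: R_def)
    have "((\<lambda>w. 1 / (w - f z)) has_contour_integral 2 * pi * \<i>) g"
      using has_integral_const_real[of "\<i>" "Arg a" "Arg a + 2 * pi"] R
      unfolding g_def R_def[symmetric]
      by (simp add: has_contour_integral_part_circlepath_iff scaleR_conv_of_real)
    moreover have "valid_path g" by (simp add: g_def)
    moreover have "f z \<notin> path_image g"
      using R by (auto simp: g_def R_def[symmetric] path_image_def part_circlepath_def)
    ultimately show ?thesis
      by (simp add: winding_number_valid_path contour_integral_unique)
  qed
  finally show ?thesis .
qed

section \<open>Roots of unity and the sectors between them\<close>

definition unit_root :: "nat \<Rightarrow> nat \<Rightarrow> complex"
  where "unit_root m j = cis (2 * pi * j / m)"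

lemma norm_unit_root [simp]: "norm (unit_root m j) = 1"
  by (simp add: unit_root_def)

lemma unit_root_nonzero [simp]: "unit_root m j \<noteq> 0"
  by (simp add: unit_root_def)

lemma unit_root_add: "unit_root m (i + j) = unit_root m i * unit_root m j"
  by (simp add: unit_root_def cis_mult add_divide_distrib distrib_left)

lemma unit_root_self: "m > 0 \<Longrightarrow> unit_root m m = 1"
  by (simp add: unit_root_def)

lemma unit_root_mod: "m > 0 \<Longrightarrow> unit_root m (j mod m) = unit_root m j"
proof -
  assume m: "m > 0"
  have "unit_root m (m * i) = 1" for i
    by (induction i) (use m in \<open>simp_all add: unit_root_add unit_root_self unit_root_def[of m 0]\<close>)
  then show ?thesis
    by (metis mult.right_neutral mult_div_mod_eq add.commute unit_root_add)
qed

lemma Im_unit_root_1_pos: "m \<ge> 3 \<Longrightarrow> Im (unit_root m 1) > 0"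
  by (auto simp: unit_root_def intro!: sin_gt_zero simp: field_simps)

text \<open>The last two equations are the imaginary parts of the point rotated by
  \<open>- \<delta>\<close> (up to sign) and of the point itself. They make \<open>s\<close> and
  \<open>t\<close> functions of modulus and angle, so comparing angles settles the uniqueness of
  sector coordinates.\<close>

lemma cone_polar:
  fixes \<delta> s t :: real
  assumes "0 < \<delta>" "\<delta> < pi" "0 \<le> s" "0 \<le> t" "s + t > 0"
  obtains \<rho> \<alpha> where "\<rho> > 0" "0 \<le> \<alpha>" "\<alpha> \<le> \<delta>" "of_real s + of_real t * cis \<delta> = \<rho> * cis \<alpha>"
    "s * sin \<delta> = \<rho> * sin (\<delta> - \<alpha>)" "t * sin \<delta> = \<rho> * sin \<alpha>"
proof -
  define z where "z = of_real s + of_real t * cis \<delta>"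
  have sd: "sin \<delta> > 0" using assms by (simp add: sin_gt_zero)
  have Im: "Im z = t * sin \<delta>" by (simp add: z_def)
  have z0: "z \<noteq> 0"
  proof
    assume "z = 0"
    then have "Im z = 0" "Re z = 0" by auto
    then show False using Im sd assms by (auto simp: z_def)
  qed
  define \<alpha> where "\<alpha> = Arg z"
  have z: "z = norm z * cis \<alpha>"
    using z0 by (metis \<alpha>_def rcis_def rcis_cmod_Arg)
  have t: "t * sin \<delta> = norm z * sin \<alpha>"
    using arg_cong[OF z, of Im] Im by simp
  have a: "0 \<le> \<alpha>" "\<alpha> \<le> pi"
  proof -
    show "\<alpha> \<le> pi" by (simp add: \<alpha>_def Arg_le_pi)
    show "0 \<le> \<alpha>"
    proof (rule ccontr)
      assume "\<not> 0 \<le> \<alpha>"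
      moreover have "- pi < \<alpha>" by (simp add: \<alpha>_def mpi_less_Arg)
      ultimately have "sin (- \<alpha>) > 0" by (intro sin_gt_zero) auto
      then have "norm z * sin \<alpha> < 0" using z0 by (simp add: mult_pos_neg)
      moreover have "t * sin \<delta> \<ge> 0" using sd assms by simp
      ultimately show False using t by simp
    qed
  qed
  have "of_real s * cis (-\<delta>) + of_real t = z * cis (-\<delta>)"
    by (simp add: z_def distrib_right mult.assoc cis_mult)
  also have "\<dots> = norm z * cis (\<alpha> - \<delta>)"
    by (subst z) (simp add: mult.assoc cis_mult)
  finally have "Im (of_real s * cis (-\<delta>) + of_real t) = Im (norm z * cis (\<alpha> - \<delta>))"
    by simp
  then have "- (s * sin \<delta>) = norm z * sin (\<alpha> - \<delta>)" by simp
  then have s: "s * sin \<delta> = norm z * sin (\<delta> - \<alpha>)"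
    by (metis minus_diff_eq minus_minus mult_minus_right sin_minus)
  have "\<alpha> \<le> \<delta>"
  proof (rule ccontr)
    assume "\<not> \<alpha> \<le> \<delta>"
    then have "sin (\<alpha> - \<delta>) > 0" using a assms by (intro sin_gt_zero) auto
    then have "norm z * sin (\<delta> - \<alpha>) < 0"
      using z0 by (metis minus_diff_eq mult_minus_right mult_pos_pos neg_less_0_iff_less sin_minus zero_less_norm_iff)
    with s sd assms show False by (metis mult_nonneg_nonneg not_less less_imp_le)
  qed
  show ?thesis
  proof (rule that)
    show "norm z > 0" using z0 by simp
    show "of_real s + of_real t * cis \<delta> = norm z * cis \<alpha>" using z by (simp only: z_def[symmetric])
  qed fact+
qed


lemma sector_exists:
  assumes "m \<ge> 3"
  obtains j s t where "j < m" "0 \<le> s" "0 \<le> t"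
    "z = of_real s * unit_root m j + of_real t * unit_root m (Suc j)"
proof -
  define \<delta> where "\<delta> = 2 * pi / m"
  have \<delta>: "0 < \<delta>" "\<delta> < pi" "m * \<delta> = 2 * pi" using assms by (auto simp: \<delta>_def field_simps)
  define \<theta> where "\<theta> = Arg2pi z"
  have z: "z = of_real (norm z) * cis \<theta>"
    using Arg2pi_eq by (simp add: \<theta>_def cis_conv_exp)
  have \<theta>: "0 \<le> \<theta>" "\<theta> < 2 * pi" by (simp_all add: \<theta>_def Arg2pi_ge_0 Arg2pi_lt_2pi)
  define j where "j = nat \<lfloor>\<theta> / \<delta>\<rfloor>"
  define \<alpha> where "\<alpha> = \<theta> - j * \<delta>"
  have jf: "real j = of_int \<lfloor>\<theta> / \<delta>\<rfloor>" using \<theta> \<delta> by (simp add: j_def)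
  have j1: "j * \<delta> \<le> \<theta>" "\<theta> < (j + 1) * \<delta>"
    using floor_divide_lower[OF \<delta>(1), of \<theta>] floor_divide_upper[OF \<delta>(1), of \<theta>] by (auto simp: jf add.commute)
  have "j * \<delta> < m * \<delta>" using j1 \<theta> \<delta> by linarith
  then have jm: "j < m" using \<delta>(1) by (simp only: mult_less_cancel_right_pos of_nat_less_iff)
  have \<alpha>: "0 \<le> \<alpha>" "\<alpha> \<le> \<delta>" using j1 by (auto simp: \<alpha>_def algebra_simps)
  have sd: "sin \<delta> > 0" using \<delta> by (simp add: sin_gt_zero)
  define s where "s = norm z * sin (\<delta> - \<alpha>) / sin \<delta>"
  define t where "t = norm z * sin \<alpha> / sin \<delta>"
  have st: "s \<ge> 0" "t \<ge> 0" using \<alpha> \<delta> sd by (auto simp: s_def t_def intro!: mult_nonneg_nonneg divide_nonneg_nonneg sin_ge_zero)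
  have "of_real s + of_real t * cis \<delta> = norm z * cis \<alpha>"
    using sd by (simp add: complex_eq_iff s_def t_def sin_diff field_simps)
  then have "cis (j * \<delta>) * (of_real s + of_real t * cis \<delta>) = norm z * cis \<theta>"
    by (simp add: \<alpha>_def cis_mult)
  then have "z = of_real s * cis (j * \<delta>) + of_real t * (cis (j * \<delta>) * cis \<delta>)"
    using z by (simp add: algebra_simps)
  then have "z = of_real s * unit_root m j + of_real t * unit_root m (Suc j)"
    by (simp add: unit_root_def cis_mult \<delta>_def add_divide_distrib algebra_simps)
  with that jm st show ?thesis by blast
qed

text \<open>A point on a ray belongs to two sectors, with different triples \<open>j\<close>,
  \<open>s\<close>, \<open>t\<close>. Recording the coefficient of every ray instead makes the
  representation unique.\<close>

definition sector_coeff :: "nat \<Rightarrow> nat \<Rightarrow> real \<Rightarrow> real \<Rightarrow> nat \<Rightarrow> real"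
  where "sector_coeff m j s t i = (if i = j then s else if i = Suc j mod m then t else 0)"

lemma sum_sector_coeff:
  assumes "m \<ge> 3" "j < m"
  shows "(\<Sum>i<m. sector_coeff m j s t i) = s + t"
proof -
  have j': "Suc j mod m < m" "Suc j mod m \<noteq> j" using assms by (auto simp: mod_Suc split: if_splits)
  have "(\<Sum>i<m. sector_coeff m j s t i) = (\<Sum>i\<in>{j, Suc j mod m}. sector_coeff m j s t i)"
    by (rule sum.mono_neutral_right) (use assms j' in \<open>auto simp: sector_coeff_def\<close>)
  then show ?thesis using j' by (simp add: sector_coeff_def)
qed

text \<open>Away from the origin, the angles of equal points differ by a multiple of 2 pi, so the
  sector numbers differ modulo \<open>m\<close> by some \<open>D\<close> of absolute value at most
  1. The cases 1 and -1 are the common ray of neighbouring sectors.\<close>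

lemma sector_unique:
  assumes m: "m \<ge> 3" and j: "j < m" "j' < m" and nn: "0 \<le> s" "0 \<le> t" "0 \<le> s'" "0 \<le> t'"
    and eq: "of_real s * unit_root m j + of_real t * unit_root m (Suc j) =
             of_real s' * unit_root m j' + of_real t' * unit_root m (Suc j')"
  shows "sector_coeff m j s t = sector_coeff m j' s' t'"
proof -
  define \<delta> where "\<delta> = 2 * pi / m"
  have \<delta>: "0 < \<delta>" "\<delta> < pi" "m * \<delta> = 2 * pi" using m by (auto simp: \<delta>_def field_simps)
  have sd: "sin \<delta> > 0" using \<delta> by (simp add: sin_gt_zero)
  have u: "of_real s * unit_root m j + of_real t * unit_root m (Suc j) = 
       cis (j * \<delta>) * (of_real s + of_real t * cis \<delta>)" for s t j
    by (simp add: unit_root_def cis_mult \<delta>_def add_divide_distrib algebra_simps)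
  have zero: "of_real s + of_real t * cis \<delta> = 0 \<longleftrightarrow> s + t = 0" if nn0: "0 \<le> s" "0 \<le> t" for s t :: real
  proof
    assume z: "of_real s + of_real t * cis \<delta> = 0"
    have "t * sin \<delta> = 0" using arg_cong[OF z, of Im] by simp
    then have "t = 0" using sd by simp
    then show "s + t = 0" using z by simp
  next
    assume "s + t = 0"
    then have "s = 0" "t = 0" using nn0 by auto
    then show "of_real s + of_real t * cis \<delta> = 0" by simp
  qed
  note eq' = eq[unfolded u]
  have ne: "Suc i mod m \<noteq> i" if "i < m" for i
    using that m by (auto simp: mod_Suc split: if_splits)
  show ?thesis
  proof (cases "s + t = 0")
    case True
    then have "s' + t' = 0" using eq' zero nn by (metis mult_eq_0_iff cis_neq_zero)
    then show ?thesis using True nn by (auto simp: sector_coeff_def fun_eq_iff)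
  next
    case False
    then have False': "s' + t' \<noteq> 0" using eq' zero nn by (metis mult_eq_0_iff cis_neq_zero)
    have st: "s + t > 0" and st': "s' + t' > 0" using False False' nn by auto
    obtain \<rho> \<alpha> where a: "\<rho> > 0" "0 \<le> \<alpha>" "\<alpha> \<le> \<delta>" "of_real s + of_real t * cis \<delta> = \<rho> * cis \<alpha>"
        "s * sin \<delta> = \<rho> * sin (\<delta> - \<alpha>)" "t * sin \<delta> = \<rho> * sin \<alpha>"
      by (rule cone_polar[OF \<delta>(1,2) nn(1,2) st])
    obtain \<rho>' \<alpha>' where b: "\<rho>' > 0" "0 \<le> \<alpha>'" "\<alpha>' \<le> \<delta>" "of_real s' + of_real t' * cis \<delta> = \<rho>' * cis \<alpha>'"
        "s' * sin \<delta> = \<rho>' * sin (\<delta> - \<alpha>')" "t' * sin \<delta> = \<rho>' * sin \<alpha>'"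
      by (rule cone_polar[OF \<delta>(1,2) nn(3,4) st'])
    have e: "\<rho> * cis (j * \<delta> + \<alpha>) = \<rho>' * cis (j' * \<delta> + \<alpha>')"
      using eq' a(4) b(4) by (simp add: cis_mult[symmetric] mult_ac)
    have \<rho>: "\<rho> = \<rho>'" using arg_cong[OF e, of norm] a b by (simp add: norm_mult)
    then have "cis (j * \<delta> + \<alpha>) = cis (j' * \<delta> + \<alpha>')" using e a by simp
    then obtain i :: int where i: "j * \<delta> + \<alpha> = j' * \<delta> + \<alpha>' + 2 * pi * i"
      using sin_cos_eq_iff[of "j * \<delta> + \<alpha>" "j' * \<delta> + \<alpha>'"]
      by (metis cis.sel)
    define D :: int where "D = int j - int j' - i * int m"
    have D: "D * \<delta> = \<alpha>' - \<alpha>"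
      using i \<delta>(3) by (simp add: D_def algebra_simps)
    have "\<bar>D * \<delta>\<bar> \<le> 1 * \<delta>" using D a b by linarith
    then have "\<bar>real_of_int D\<bar> \<le> 1" using \<delta> by (simp add: abs_mult)
    then consider "D = 0" | "D = 1" | "D = -1" by linarith
    then show ?thesis
    proof cases
      case 1
      then have "int j mod int m = int j' mod int m" by (simp add: D_def algebra_simps mod_mult_self1)
      then have "j = j'" using j by simp
      moreover have \<alpha>: "\<alpha> = \<alpha>'" using D 1 by simp
      have "s * sin \<delta> = s' * sin \<delta>" "t * sin \<delta> = t' * sin \<delta>"
        unfolding a(5,6) b(5,6) \<rho> \<alpha> by (rule refl)+
      then have "s = s'" "t = t'" using sd by simp_all
      ultimately show ?thesis by simp
    next
      case 2
      then have "int j = int j' + 1 + i * int m" by (simp add: D_def)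
      then have "int j mod int m = (int j' + 1) mod int m" by simp
      then have "j = Suc j' mod m" using j
        by (metis add.commute mod_less of_nat_Suc of_nat_eq_iff of_nat_mod)
      moreover have \<alpha>: "\<alpha>' = \<delta>" "\<alpha> = 0" using D 2 a(2,3) b(2,3) by auto
      have "s * sin \<delta> = t' * sin \<delta>" "t * sin \<delta> = 0" "s' * sin \<delta> = 0"
        unfolding a(5,6) b(5,6) \<rho> \<alpha> by simp_all
      then have "s = t'" "t = 0" "s' = 0" using sd by simp_all
      ultimately show ?thesis using ne[of j] ne[of j'] j
        by (auto simp: sector_coeff_def fun_eq_iff)
    next
      case 3
      then have "int j' = int j + 1 + (-i) * int m" by (simp add: D_def)
      then have "int j' mod int m = (int j + 1) mod int m" by (simp del: mult_minus_left)
      then have "j' = Suc j mod m" using j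
        by (metis add.commute mod_less of_nat_Suc of_nat_eq_iff of_nat_mod)
      moreover have \<alpha>: "\<alpha> = \<delta>" "\<alpha>' = 0" using D 3 a(2,3) b(2,3) by auto
      have "s' * sin \<delta> = t * sin \<delta>" "t' * sin \<delta> = 0" "s * sin \<delta> = 0"
        unfolding a(5,6) b(5,6) \<rho> \<alpha> by simp_all
      then have "s' = t" "t' = 0" "s = 0" using sd by simp_all
      ultimately show ?thesis using ne[of j] ne[of j'] j
        by (auto simp: sector_coeff_def fun_eq_iff)
    qed
  qed
qed

section \<open>Surfaces triangulated by vertex links\<close>

text \<open>The link of \<open>u\<close> is the cycle \<open>l u 0, \<dots>, l u (m u - 1)\<close>; the index is read modulo
  \<open>m u\<close>. Assumption \<open>link_rotate\<close> makes every triangle a triangle of all its three vertices, with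
  the same orientation.\<close>

locale triangulated_surface =
  fixes W :: "'w::countable set" and m :: "'w \<Rightarrow> nat" and l :: "'w \<Rightarrow> nat \<Rightarrow> 'w"
  assumes finite_W: "finite W" and W_nonempty: "W \<noteq> {}"
    and m_ge_3: "u \<in> W \<Longrightarrow> 3 \<le> m u"
    and link_in_W: "u \<in> W \<Longrightarrow> l u j \<in> W"
    and link_neq: "u \<in> W \<Longrightarrow> l u j \<noteq> u"
    and link_mod: "u \<in> W \<Longrightarrow> l u (j mod m u) = l u j"
    and link_inj: "u \<in> W \<Longrightarrow> inj_on (l u) {..<m u}"
    and link_rotate: "u \<in> W \<Longrightarrow> \<exists>i. l (l u j) i = l u (Suc j) \<and> l (l u j) (Suc i) = u"
    and links_connected: "u \<in> W \<Longrightarrow> v \<in> W \<Longrightarrow> (u, v) \<in> {(x, l x j) |x j. x \<in> W}\<^sup>*"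
begin

definition triangle :: "'w \<Rightarrow> nat \<Rightarrow> 'w set"
  where "triangle u j = {u, l u j, l u (Suc j)}"

definition closed_star :: "'w \<Rightarrow> ('w \<Rightarrow> real) set"
  where "closed_star u = {a. (\<forall>x. 0 \<le> a x) \<and>
    (\<exists>j. (\<forall>x. x \<notin> triangle u j \<longrightarrow> a x = 0) \<and> sum a (triangle u j) = 1)}"

definition points :: "('w \<Rightarrow> real) set"
  where "points = (\<Union>u\<in>W. closed_star u)"

definition star :: "'w \<Rightarrow> ('w \<Rightarrow> real) set"
  where "star u = {a \<in> points. a u > 0}"

text \<open>On a triangle only the coordinates of two consecutive neighbours can be nonzero, so this
  one formula is linear on every triangle and automatically agrees on common edges.\<close>

definition star_chart :: "'w \<Rightarrow> ('w \<Rightarrow> real) \<Rightarrow> complex"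
  where "star_chart u a = (\<Sum>j<m u. of_real (a (l u j)) * unit_root (m u) j)"

definition corner_point :: "'w \<Rightarrow> nat \<Rightarrow> real \<Rightarrow> real \<Rightarrow> 'w \<Rightarrow> real"
  where "corner_point u j s t x = (if x = u then 1 - s - t else if x = l u j then s
     else if x = l u (Suc j) then t else 0)"

lemma link_eq_iff: "u \<in> W \<Longrightarrow> l u i = l u j \<longleftrightarrow> i mod m u = j mod m u"
proof -
  assume u: "u \<in> W"
  then have "m u > 0" using m_ge_3[of u] by simp
  then have "l u (i mod m u) = l u (j mod m u) \<longleftrightarrow> i mod m u = j mod m u"
    using inj_on_eq_iff[OF link_inj[OF u]] by simp
  with u show ?thesis by (simp add: link_mod)
qed

lemma link_Suc_neq: "u \<in> W \<Longrightarrow> l u (Suc j) \<noteq> l u j"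
  using m_ge_3[of u] by (auto simp: link_eq_iff mod_Suc split: if_splits)

lemma link_Suc_cong: "u \<in> W \<Longrightarrow> l u i = l u j \<Longrightarrow> l u (Suc i) = l u (Suc j)"
  by (metis link_eq_iff mod_Suc_eq)

lemma triangle_rotate: "u \<in> W \<Longrightarrow> \<exists>i. triangle (l u j) i = triangle u j"
  using link_rotate[of u j] by (auto simp: triangle_def)

text \<open>One rotation moves the base to \<open>l u j\<close>, a second one to
  \<open>l u (Suc j)\<close>.\<close>

lemma triangle_rebase:
  assumes u: "u \<in> W" and v: "v \<in> triangle u j"
  shows "\<exists>i. triangle v i = triangle u j"
proof -
  obtain i where i: "l (l u j) i = l u (Suc j)" "l (l u j) (Suc i) = u"
    using link_rotate[OF u] by blast
  have "triangle (l u j) i = triangle u j" using i by (auto simp: triangle_def)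
  moreover have "\<exists>i'. triangle (l u (Suc j)) i' = triangle (l u j) i"
    using triangle_rotate[OF link_in_W[OF u], of j i] i by simp
  ultimately show ?thesis using v by (auto simp: triangle_def[of u])
qed

lemma points_iff_closed_star: "a \<in> points \<Longrightarrow> a u > 0 \<Longrightarrow> u \<in> W \<and> a \<in> closed_star u"
proof -
  assume "a \<in> points" and pos: "a u > 0"
  then obtain v j where v: "v \<in> W" and a: "\<forall>x. 0 \<le> a x" "\<forall>x. x \<notin> triangle v j \<longrightarrow> a x = 0"
      "sum a (triangle v j) = 1"
    unfolding points_def closed_star_def by blast
  then have u: "u \<in> triangle v j" using pos by force
  then obtain i where i: "triangle u i = triangle v j" using triangle_rebase v by blast
  have "u \<in> W" using u v link_in_W by (auto simp: triangle_def)
  moreover have "a \<in> closed_star u"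
    unfolding closed_star_def using a i by (intro CollectI conjI exI[of _ i]) auto
  ultimately show ?thesis by blast
qed

lemma corner_point_simps:
  assumes "u \<in> W"
  shows "corner_point u j s t u = 1 - s - t" "corner_point u j s t (l u j) = s"
    "corner_point u j s t (l u (Suc j)) = t"
    "x \<noteq> u \<Longrightarrow> x \<noteq> l u j \<Longrightarrow> x \<noteq> l u (Suc j) \<Longrightarrow> corner_point u j s t x = 0"
  using link_neq[OF assms] link_Suc_neq[OF assms] by (auto simp: corner_point_def)

lemma closed_star_eq:
  assumes u: "u \<in> W"
  shows "closed_star u = {corner_point u j s t |j s t. j < m u \<and> 0 \<le> s \<and> 0 \<le> t \<and> s + t \<le> 1}"
    (is "_ = ?R")
proof (intro equalityI subsetI)
  note ne = link_neq[OF u] link_neq[OF u, symmetric] link_Suc_neq[OF u] link_Suc_neq[OF u, symmetric]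
  fix a
  {
    assume "a \<in> closed_star u"
    then obtain j where a: "\<forall>x. 0 \<le> a x" "\<forall>x. x \<notin> triangle u j \<longrightarrow> a x = 0" "sum a (triangle u j) = 1"
      unfolding closed_star_def by blast
    define i where "i = j mod m u"
    have i: "l u j = l u i" "l u (Suc j) = l u (Suc i)" "i < m u"
      using u m_ge_3[OF u] by (auto simp: i_def link_mod link_eq_iff mod_Suc_eq)
    have s: "a u + a (l u i) + a (l u (Suc i)) = 1"
      using a(3) ne by (simp add: triangle_def i add.assoc)
    have "a = corner_point u i (a (l u i)) (a (l u (Suc i)))"
      using a(2) s by (auto simp: fun_eq_iff corner_point_def triangle_def i)
    moreover have "a (l u i) + a (l u (Suc i)) \<le> 1" using s a(1) by (smt (verit))
    ultimately show "a \<in> ?R" using i a(1) by blast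
  next
    assume "a \<in> ?R"
    then obtain j s t where *: "a = corner_point u j s t" "0 \<le> s" "0 \<le> t" "s + t \<le> 1" by blast
    have "\<forall>x. 0 \<le> a x" using * by (auto simp: corner_point_def)
    moreover have "\<forall>x. x \<notin> triangle u j \<longrightarrow> a x = 0" using * by (auto simp: corner_point_def triangle_def)
    moreover have "sum a (triangle u j) = 1" using * ne by (simp add: triangle_def corner_point_simps[OF u])
    ultimately show "a \<in> closed_star u" by (auto simp: closed_star_def)
  }
qed

lemma closed_star_cases:
  assumes "u \<in> W" "a \<in> closed_star u"
  obtains j s t where "j < m u" "0 \<le> s" "0 \<le> t" "s + t \<le> 1" "a = corner_point u j s t"
  using assms closed_star_eq by blast

lemma corner_point_link:
  assumes u: "u \<in> W" and "i < m u" "j < m u"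
  shows "corner_point u j s t (l u i) = sector_coeff (m u) j s t i"
proof -
  have "l u i = l u j \<longleftrightarrow> i = j" "l u i = l u (Suc j) \<longleftrightarrow> i = Suc j mod m u"
    using assms by (auto simp: link_eq_iff)
  then show ?thesis
    using link_neq[OF u] by (auto simp: corner_point_def sector_coeff_def)
qed

lemma star_chart_corner_point:
  assumes u: "u \<in> W" and j: "j < m u"
  shows "star_chart u (corner_point u j s t) =
    of_real s * unit_root (m u) j + of_real t * unit_root (m u) (Suc j)"
proof -
  have m: "m u \<ge> 3" using m_ge_3 u by simp
  define j' where "j' = Suc j mod m u"
  have j': "j' < m u" "j' \<noteq> j" using m j by (auto simp: j'_def mod_Suc split: if_splits)
  have "star_chart u (corner_point u j s t) =
    (\<Sum>i<m u. of_real (sector_coeff (m u) j s t i) * unit_root (m u) i)"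
    unfolding star_chart_def by (intro sum.cong refl) (simp add: corner_point_link u j)
  also have "\<dots> = (\<Sum>i\<in>{j, j'}. of_real (sector_coeff (m u) j s t i) * unit_root (m u) i)"
    by (rule sum.mono_neutral_right) (use j j' in \<open>auto simp: sector_coeff_def j'_def\<close>)
  also have "\<dots> = of_real s * unit_root (m u) j + of_real t * unit_root (m u) j'"
    using j' by (simp add: sector_coeff_def j'_def[symmetric])
  finally show ?thesis using m by (simp add: j'_def unit_root_mod)
qed

lemma inj_on_star_chart: "u \<in> W \<Longrightarrow> inj_on (star_chart u) (closed_star u)"
proof (rule inj_onI)
  fix a b assume u: "u \<in> W" and a: "a \<in> closed_star u" and b: "b \<in> closed_star u"
    and eq: "star_chart u a = star_chart u b"
  obtain j s t where j: "j < m u" "0 \<le> s" "0 \<le> t" and aj: "a = corner_point u j s t"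
    using closed_star_cases[OF u a] by blast
  obtain j' s' t' where j': "j' < m u" "0 \<le> s'" "0 \<le> t'" and bj: "b = corner_point u j' s' t'"
    using closed_star_cases[OF u b] by blast
  have coeff: "sector_coeff (m u) j s t = sector_coeff (m u) j' s' t'"
    using sector_unique[OF m_ge_3[OF u] j(1) j'(1) j(2,3) j'(2,3)] eq
    by (simp add: aj bj star_chart_corner_point u j j')
  then have link: "a (l u i) = b (l u i)" if "i < m u" for i
    using that by (simp add: aj bj corner_point_link u j j' coeff)
  have link': "a (l u i) = b (l u i)" for i
    using link[of "i mod m u"] m_ge_3[OF u] by (simp add: link_mod u)
  have out: "a x = b x" if "x \<noteq> u" for x
  proof (cases "x \<in> range (l u)")
    case True with link' show ?thesis by auto
  next
    case False
    then have "x \<noteq> l u i" for i by auto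
    with that show ?thesis by (simp add: aj bj corner_point_def)
  qed
  \<comment> \<open>The chart does not see the coordinate at \<open>u\<close>; it is recovered from
    the total 1.\<close>
  have "s + t = s' + t'"
    using coeff sum_sector_coeff[OF m_ge_3[OF u] j(1), of s t] sum_sector_coeff[OF m_ge_3[OF u] j'(1), of s' t']
    by simp
  then have "a u = b u" by (simp add: aj bj corner_point_simps u)
  then show "a = b" using out by (metis ext)
qed

lemma star_subset: "star u \<subseteq> points" "star u \<subseteq> closed_star u"
  using points_iff_closed_star by (auto simp: star_def)

lemma closed_star_subset: "u \<in> W \<Longrightarrow> closed_star u \<subseteq> points"
  by (auto simp: points_def)

lemma star_eq: "u \<in> W \<Longrightarrow> star u = {a \<in> closed_star u. a u > 0}"
  using star_subset closed_star_subset by (auto simp: star_def)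

lemma corner_point_in_star:
  assumes "u \<in> W" "j < m u" "0 \<le> s" "0 \<le> t" "s + t < 1"
  shows "corner_point u j s t \<in> star u"
proof -
  have "corner_point u j s t \<in> closed_star u"
    unfolding closed_star_eq[OF assms(1)]
    by (intro CollectI exI[of _ j] exI[of _ s] exI[of _ t]) (use assms in auto)
  then show ?thesis using assms by (simp add: star_eq corner_point_simps)
qed

lemma star_cases:
  assumes u: "u \<in> W" and a: "a \<in> star u"
  obtains j s t where "j < m u" "0 \<le> s" "0 \<le> t" "s + t < 1" "a = corner_point u j s t"
proof -
  have "a \<in> closed_star u" using a star_subset by blast
  then obtain j s t where j: "j < m u" "0 \<le> s" "0 \<le> t" "a = corner_point u j s t"
    by (rule closed_star_cases[OF u])
  moreover have "s + t < 1" using a j by (simp add: star_def corner_point_simps u)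
  ultimately show ?thesis using that by blast
qed

lemma points_eq_stars: "points = (\<Union>u\<in>W. star u)"
proof -
  have "\<exists>u\<in>W. a \<in> star u" if a: "a \<in> points" for a
  proof -
    obtain v j where *: "v \<in> W" "\<forall>x. 0 \<le> a x" "sum a (triangle v j) = 1"
      using a unfolding points_def closed_star_def by blast
    then have "\<exists>x. a x > 0"
      by (metis less_eq_real_def sum.not_neutral_contains_not_neutral zero_neq_one)
    then show ?thesis using a points_iff_closed_star[OF a] by (auto simp: star_def)
  qed
  then show ?thesis using star_subset by blast
qed

section \<open>Topology of stars and their charts\<close>

lemma points_nonneg: "a \<in> points \<Longrightarrow> 0 \<le> a x"
  by (auto simp: points_def closed_star_def)

lemma continuous_on_coordinate: "continuous_on A (\<lambda>a :: 'w \<Rightarrow> real. a x)"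
  by (rule continuous_on_product_then_coordinatewise[OF continuous_on_id])

lemma continuous_on_star_chart: "continuous_on A (star_chart u)"
  unfolding star_chart_def by (intro continuous_intros continuous_on_coordinate)

lemma compact_closed_star: "u \<in> W \<Longrightarrow> compact (closed_star u)"
proof -
  assume u: "u \<in> W"
  define T where "T = {p :: real \<times> real. 0 \<le> fst p \<and> 0 \<le> snd p \<and> fst p + snd p \<le> 1}"
  have "closed T" unfolding T_def
    by (intro closed_Collect_conj closed_Collect_le continuous_intros)
  moreover have "T \<subseteq> cbox (0, 0) (1, 1)"
    by (auto simp: T_def cbox_Pair_eq)
  ultimately have T: "compact T"
    by (metis bounded_cbox bounded_subset compact_eq_bounded_closed)
  have "continuous_on T (\<lambda>p. corner_point u j (fst p) (snd p))" for j
  proof (intro continuous_on_coordinatewise_then_product)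
    fix x
    consider "x = u" | "x \<noteq> u" "x = l u j" | "x \<noteq> u" "x \<noteq> l u j" "x = l u (Suc j)"
      | "x \<noteq> u" "x \<noteq> l u j" "x \<noteq> l u (Suc j)" by blast
    then show "continuous_on T (\<lambda>p. corner_point u j (fst p) (snd p) x)"
      by cases (simp_all add: corner_point_def continuous_intros)
  qed
  then have "compact (\<Union>j\<in>{..<m u}. (\<lambda>p. corner_point u j (fst p) (snd p)) ` T)"
    using T by (intro compact_UN compact_continuous_image) auto
  also have "(\<Union>j\<in>{..<m u}. (\<lambda>p. corner_point u j (fst p) (snd p)) ` T) = closed_star u"
  proof (intro equalityI subsetI)
    fix a assume "a \<in> closed_star u"
    then obtain j s t where "j < m u" "0 \<le> s" "0 \<le> t" "s + t \<le> 1" "a = corner_point u j s t"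
      using closed_star_cases[OF u] by blast
    then show "a \<in> (\<Union>j\<in>{..<m u}. (\<lambda>p. corner_point u j (fst p) (snd p)) ` T)"
      by (intro UN_I[of j] image_eqI[of _ _ "(s, t)"]) (auto simp: T_def)
  next
    fix a assume "a \<in> (\<Union>j\<in>{..<m u}. (\<lambda>p. corner_point u j (fst p) (snd p)) ` T)"
    then obtain j p where "j < m u" "p \<in> T" "a = corner_point u j (fst p) (snd p)" by blast
    then show "a \<in> closed_star u" unfolding closed_star_eq[OF u] T_def by blast
  qed
  finally show ?thesis .
qed

lemma compact_points: "compact points"
  unfolding points_def using finite_W compact_closed_star by (intro compact_UN) auto

lemma openin_star: "openin (top_of_set points) (star u)"
proof -
  have "open {a :: 'w \<Rightarrow> real. 0 < a u}"
    by (intro open_Collect_less continuous_intros continuous_on_coordinate)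
  moreover have "star u = points \<inter> {a. 0 < a u}" by (auto simp: star_def)
  ultimately show ?thesis by (auto simp: openin_open)
qed

text \<open>The sector beyond the triangle, including the side opposite to \<open>u\<close>. The
  chart image of the open star is the complement of these finitely many closed sets, hence
  open.\<close>

definition outer_cone :: "'w \<Rightarrow> nat \<Rightarrow> complex set"
  where "outer_cone u j = (\<lambda>p. of_real (fst p) * unit_root (m u) j + of_real (snd p) * unit_root (m u) (Suc j)) `
    {p :: real \<times> real. 0 \<le> fst p \<and> 0 \<le> snd p \<and> 1 \<le> fst p + snd p}"

lemma closed_outer_cone:
  assumes u: "u \<in> W"
  shows "closed (outer_cone u j)"
  unfolding outer_cone_def
proof (rule closed_injective_linear_image)
  show "closed {p :: real \<times> real. 0 \<le> fst p \<and> 0 \<le> snd p \<and> 1 \<le> fst p + snd p}"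
    by (intro closed_Collect_conj closed_Collect_le continuous_intros)
  let ?f = "\<lambda>p :: real \<times> real. of_real (fst p) * unit_root (m u) j + of_real (snd p) * unit_root (m u) (Suc j)"
  show lin: "linear ?f"
    by (rule linearI) (auto simp: algebra_simps scaleR_conv_of_real)
  show "inj ?f"
    unfolding linear_injective_0[OF lin]
  proof (intro allI impI)
    fix p :: "real \<times> real" assume 0: "?f p = 0"
    have "?f p = unit_root (m u) j * (of_real (fst p) + of_real (snd p) * unit_root (m u) 1)"
      using unit_root_add[of "m u" j 1] by (simp add: algebra_simps)
    then have z: "of_real (fst p) + of_real (snd p) * unit_root (m u) 1 = 0" using 0 by simp
    have "snd p * Im (unit_root (m u) 1) = 0"
      using arg_cong[OF z, of Im] by simp
    then have s: "snd p = 0" using Im_unit_root_1_pos[OF m_ge_3[OF u]] by simp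
    then have "fst p = 0" using z by simp
    with s show "p = 0" by (simp add: prod_eq_iff)
  qed
qed

lemma star_chart_image_star:
  assumes u: "u \<in> W"
  shows "star_chart u ` star u = - (\<Union>j<m u. outer_cone u j)"
proof (intro equalityI subsetI)
  fix z assume "z \<in> star_chart u ` star u"
  then obtain a where a: "a \<in> star u" "z = star_chart u a" by blast
  obtain j s t where j: "j < m u" "0 \<le> s" "0 \<le> t" and st: "s + t < 1" and aj: "a = corner_point u j s t"
    by (rule star_cases[OF u a(1)])
  show "z \<in> - (\<Union>j<m u. outer_cone u j)"
  proof
    assume "z \<in> (\<Union>j<m u. outer_cone u j)"
    then obtain j' s' t' where j': "j' < m u" "0 \<le> s'" "0 \<le> t'" "1 \<le> s' + t'"
      "z = of_real s' * unit_root (m u) j' + of_real t' * unit_root (m u) (Suc j')"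
      unfolding outer_cone_def by auto
    then have "sector_coeff (m u) j s t = sector_coeff (m u) j' s' t'"
      using sector_unique[OF m_ge_3[OF u] j(1) j'(1) j(2,3) j'(2,3)] a j aj j'
      by (simp add: star_chart_corner_point u)
    then have "s + t = s' + t'"
      using sum_sector_coeff[OF m_ge_3[OF u] j(1), of s t] sum_sector_coeff[OF m_ge_3[OF u] j'(1), of s' t']
      by simp
    with st j' show False by simp
  qed
next
  fix z assume z: "z \<in> - (\<Union>j<m u. outer_cone u j)"
  obtain j s t where j: "j < m u" "0 \<le> s" "0 \<le> t"
    "z = of_real s * unit_root (m u) j + of_real t * unit_root (m u) (Suc j)"
    using sector_exists[OF m_ge_3[OF u]] by metis
  have "s + t < 1"
  proof (rule ccontr)
    assume "\<not> s + t < 1"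
    then have "z \<in> outer_cone u j" unfolding outer_cone_def
      by (intro image_eqI[of _ _ "(s, t)"]) (use j in auto)
    with z j show False by auto
  qed
  then have "corner_point u j s t \<in> star u"
    using j by (simp add: corner_point_in_star u)
  then show "z \<in> star_chart u ` star u"
    using j by (intro image_eqI[of _ _ "corner_point u j s t"]) (simp_all add: star_chart_corner_point u)
qed

lemma open_star_chart_star: "u \<in> W \<Longrightarrow> open (star_chart u ` star u)"
  unfolding star_chart_image_star by (intro open_Compl closed_UN) (auto simp: closed_outer_cone)

text \<open>A continuous injection of the compact closed star into the plane is a homeomorphism onto
  its image; restricting it to the open star avoids an explicit inverse.\<close>

lemma homeomorphic_map_star_chart:
  assumes u: "u \<in> W"
  shows "homeomorphic_map (top_of_set (star u)) (top_of_set (star_chart u ` star u)) (star_chart u)"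
proof -
  have "homeomorphic_map (top_of_set (closed_star u)) (top_of_set (star_chart u ` closed_star u)) (star_chart u)"
    by (rule continuous_imp_homeomorphic_map)
       (use u compact_closed_star inj_on_star_chart in \<open>auto simp: continuous_on_star_chart compact_space_subtopology Hausdorff_space_subtopology\<close>)
  from homeomorphic_map_subtopologies[OF this, of "star u" "star_chart u ` star u"]
  show ?thesis using star_subset(2)[of u]
    by (simp add: subtopology_subtopology inf.absorb2 image_mono)
qed

lemma chart_star: "u \<in> W \<Longrightarrow> chart (top_of_set points) (star u) (star_chart u)"
  unfolding chart_def
  using openin_star open_star_chart_star homeomorphic_map_star_chart star_subset(1)[of u]
  by (simp add: subtopology_subtopology inf.absorb2)

text \<open>The chart image is open and starlike about 0, hence simply connected, hence homeomorphic
  to a disc by the Riemann mapping theorem.\<close>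

lemma star_homeomorphic_disc:
  assumes u: "u \<in> W"
  shows "top_of_set (star u) homeomorphic_space top_of_set (ball (0::complex) 1)"
proof -
  let ?Z = "star_chart u ` star u"
  have "corner_point u 0 0 0 \<in> star u"
    using m_ge_3[OF u] by (simp add: corner_point_in_star u)
  then have ne: "star_chart u (corner_point u 0 0 0) \<in> ?Z" by (rule imageI)
  moreover have "star_chart u (corner_point u 0 0 0) = 0"
    using m_ge_3[OF u] by (simp add: star_chart_corner_point u)
  ultimately have 0: "0 \<in> ?Z" by simp
  have "starlike ?Z"
    unfolding starlike_def
  proof (intro bexI[OF _ 0] ballI subsetI)
    fix z y assume "z \<in> ?Z" and y: "y \<in> closed_segment 0 z"
    then obtain a where a: "a \<in> star u" "z = star_chart u a" by blast
    obtain j s t where j: "j < m u" "0 \<le> s" "0 \<le> t" and st: "s + t < 1" and aj: "a = corner_point u j s t"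
      by (rule star_cases[OF u a(1)])
    obtain r where r: "0 \<le> r" "r \<le> 1" "y = r *\<^sub>R z" using y by (auto simp: closed_segment_def)
    have "r * s + r * t < 1"
      using mult_left_le_one_le[of "s + t" r] r j st by (simp add: distrib_left[symmetric])
    then have "corner_point u j (r * s) (r * t) \<in> star u"
      using j r by (simp add: corner_point_in_star u)
    moreover have "star_chart u (corner_point u j (r * s) (r * t)) = y"
      using j r a aj by (simp add: star_chart_corner_point u scaleR_conv_of_real algebra_simps)
    ultimately show "y \<in> ?Z" by blast
  qed
  then have "simply_connected ?Z" by (rule starlike_imp_simply_connected)
  then have "?Z homeomorphic ball (0::complex) 1"
    using 0 simply_connected_eq_homeomorphic_to_disc[OF open_star_chart_star[OF u]] by blast
  then obtain f g where "homeomorphism ?Z (ball (0::complex) 1) f g"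
    unfolding homeomorphic_def by blast
  then have "homeomorphic_maps (top_of_set ?Z) (top_of_set (ball (0::complex) 1)) f g"
    by (auto simp: homeomorphism_def homeomorphic_maps_def)
  then have "top_of_set ?Z homeomorphic_space top_of_set (ball (0::complex) 1)"
    by (rule homeomorphic_maps_imp_homeomorphic_space)
  then show ?thesis
    using homeomorphic_map_star_chart[OF u] homeomorphic_map_imp_homeomorphic_space homeomorphic_space_trans by blast
qed

section \<open>Transition maps between stars\<close>

lemma link_Suc_Suc_neq: "u \<in> W \<Longrightarrow> l u (Suc (Suc j)) \<noteq> l u j"
  using m_ge_3[of u] by (auto simp: link_eq_iff mod_Suc split: if_splits)

lemma unit_root_link_cong:
  "u \<in> W \<Longrightarrow> l u i = l u j \<Longrightarrow> unit_root (m u) i = unit_root (m u) j"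
  using m_ge_3[of u] unit_root_mod[of "m u"] by (metis link_eq_iff not_numeral_le_zero not_gr_zero)

text \<open>\<open>w1\<close> and \<open>w2\<close> are the apexes of the two triangles at the edge
  from \<open>u\<close> to \<open>v\<close>, and a point of both stars lies in one of these
  triangles. Factoring out the direction of \<open>v\<close> puts \<open>v\<close> at 1 and the
  apexes at conjugate positions, so that the formula can be compared from both ends of the
  edge.\<close>

lemma star_chart_edge:
  assumes u: "u \<in> W" and j: "l u (Suc j) = v" and a: "a \<in> star u" "a \<in> star v"
    and w: "w1 = l u (Suc (Suc j))" "w2 = l u j"
  shows "star_chart u a = unit_root (m u) (Suc j) *
      (of_real (a v) + of_real (a w1) * unit_root (m u) 1 + of_real (a w2) * cnj (unit_root (m u) 1))"
    "a w1 = 0 \<or> a w2 = 0" "a u + a v + a w1 + a w2 = 1"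
proof -
  let ?r = "unit_root (m u)"
  have r: "?r (Suc i) = ?r i * ?r 1" "?r i = ?r (Suc i) * cnj (?r 1)" for i
  proof -
    show *: "?r (Suc i) = ?r i * ?r 1" using unit_root_add[of "m u" i 1] by simp
    have "?r 1 * cnj (?r 1) = 1" by (simp add: complex_norm_square[symmetric])
    then show "?r i = ?r (Suc i) * cnj (?r 1)" unfolding * by (simp add: mult.assoc)
  qed
  obtain i s t where i: "i < m u" "0 \<le> s" "0 \<le> t" "s + t < 1" "a = corner_point u i s t"
    by (rule star_cases[OF u a(1)])
  have chart: "star_chart u a = of_real s * ?r i + of_real t * ?r (Suc i)"
    using i by (simp add: star_chart_corner_point u)
  have ne: "u \<noteq> l u k" "l u (Suc k) \<noteq> l u k" "l u (Suc (Suc k)) \<noteq> l u k" "l u k \<noteq> u"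
      "l u k \<noteq> l u (Suc k)" "l u k \<noteq> l u (Suc (Suc k))" for k
    using link_neq[OF u] link_Suc_neq[OF u] link_Suc_Suc_neq[OF u] by metis+
  have "a v > 0" using a by (simp add: star_def)
  moreover have "v \<noteq> u" using link_neq[OF u] j by metis
  ultimately consider "v = l u i" | "v = l u (Suc i)"
    unfolding i(5) corner_point_def by (auto split: if_splits)
  then have "star_chart u a = ?r (Suc j) *
      (of_real (a v) + of_real (a w1) * ?r 1 + of_real (a w2) * cnj (?r 1)) \<and>
    (a w1 = 0 \<or> a w2 = 0) \<and> a u + a v + a w1 + a w2 = 1"
  proof cases
    case 1
    then have e: "l u i = l u (Suc j)" "?r i = ?r (Suc j)" using unit_root_link_cong[OF u] j by metis+
    then have e': "l u (Suc i) = l u (Suc (Suc j))" using link_Suc_cong[OF u] by metis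
    have "a v = s" "a w1 = t" "a w2 = 0" "a u = 1 - s - t"
      using ne by (auto simp: i(5) w j[symmetric] corner_point_def e e')
    moreover have "star_chart u a = of_real s * ?r (Suc j) + of_real t * (?r (Suc j) * ?r 1)"
      using chart unfolding r(1)[of i] e(2) .
    ultimately show ?thesis by (simp add: algebra_simps)
  next
    case 2
    then have eq: "l u (Suc i) = l u (Suc j)" using j by simp
    then have e: "l u i = l u j" using m_ge_3[OF u]
      by (auto simp: link_eq_iff[OF u] mod_Suc split: if_splits)
    then have e': "?r i = ?r j" using unit_root_link_cong[OF u] by metis
    have "a v = t" "a w1 = 0" "a w2 = s" "a u = 1 - s - t"
      using ne by (auto simp: i(5) w j[symmetric] corner_point_def e eq)
    moreover have "star_chart u a = of_real s * (?r (Suc j) * cnj (?r 1)) + of_real t * ?r (Suc j)"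
      using chart unfolding unit_root_link_cong[OF u eq] e' by (subst (asm) r(2)) simp
    ultimately show ?thesis by (simp add: algebra_simps)
  qed
  then show "star_chart u a = ?r (Suc j) *
      (of_real (a v) + of_real (a w1) * ?r 1 + of_real (a w2) * cnj (?r 1))"
    "a w1 = 0 \<or> a w2 = 0" "a u + a v + a w1 + a w2 = 1" by auto
qed

lemma star_overlap_edge:
  assumes u: "u \<in> W" and a: "a \<in> star u" "a \<in> star v" and uv: "u \<noteq> v"
  obtains j where "l u (Suc j) = v"
proof -
  obtain i s t where i: "i < m u" "0 \<le> s" "0 \<le> t" "s + t < 1" "a = corner_point u i s t"
    by (rule star_cases[OF u a(1)])
  have "a v > 0" using a by (simp add: star_def)
  then have "v = l u i \<or> v = l u (Suc i)"
    using uv unfolding i(5) corner_point_def by (auto split: if_splits)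
  \<comment> \<open>Writes \<open>l u i\<close> as a successor, so that the neighbour preceding
    \<open>v\<close> has an index too.\<close>
  moreover have "l u (Suc (i + (m u - 1))) = l u i"
    using m_ge_3[OF u] by (simp add: link_eq_iff[OF u])
  ultimately show ?thesis using that by metis
qed

text \<open>Seen from \<open>u\<close> and from \<open>v\<close>, the height over the edge is the
  same difference of apex coordinates up to a positive factor. On a line parallel to the edge the
  gain at \<open>v\<close> is the loss at \<open>u\<close>; as the edge points in opposite
  directions from its two ends, the factor \<open>c\<close> of the criterion carries a minus
  sign.\<close>

lemma winding_number_transition:
  assumes u: "u \<in> W" and v: "v \<in> W" and a: "a \<in> star u" "a \<in> star v"
    and r: "r > 0" and sph: "sphere (star_chart u a) r \<subseteq> star_chart u ` (star u \<inter> star v)"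
  shows "winding_number ((star_chart v \<circ> inv_into (star u) (star_chart u)) \<circ> circlepath (star_chart u a) r)
     ((star_chart v \<circ> inv_into (star u) (star_chart u)) (star_chart u a)) = 1"
proof -
  define f where "f = star_chart v \<circ> inv_into (star u) (star_chart u)"
  define z where "z = star_chart u a"
  have inj: "inj_on (star_chart u) (star u)"
    by (rule inj_on_subset[OF inj_on_star_chart[OF u] star_subset(2)])
  have f: "f (star_chart u b) = star_chart v b" if "b \<in> star u" for b
    using that inj by (simp add: f_def)
  have cont: "continuous_on (sphere z r) f"
  proof -
    obtain g where g: "homeomorphic_maps (top_of_set (star u)) (top_of_set (star_chart u ` star u)) (star_chart u) g"
      using homeomorphic_map_star_chart[OF u] homeomorphic_map_maps by blast
    then have "continuous_on (star_chart u ` star u) g" "g ` (star_chart u ` star u) \<subseteq> star u"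
        "\<And>b. b \<in> star u \<Longrightarrow> g (star_chart u b) = b"
      by (auto simp: homeomorphic_maps_def)
    then have "continuous_on (star_chart u ` star u) (star_chart v \<circ> g)"
      by (intro continuous_on_compose continuous_on_star_chart)
    moreover have "(star_chart v \<circ> g) w = f w" if "w \<in> star_chart u ` star u" for w
      using that f \<open>\<And>b. b \<in> star u \<Longrightarrow> g (star_chart u b) = b\<close> by auto
    ultimately have "continuous_on (star_chart u ` star u) f"
      by (simp cong: continuous_on_cong)
    then show ?thesis by (rule continuous_on_subset) (use sph in \<open>auto simp: z_def\<close>)
  qed
  have "winding_number (f \<circ> circlepath z r) (f z) = 1"
  proof (cases "u = v")
    case True
    show ?thesis
    proof (rule winding_number_eq_1_if_same_side[OF r, of 1 1])
      fix w assume "w \<in> sphere z r"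
      then obtain b where "b \<in> star u" "w = star_chart u b" using sph unfolding z_def by blast
      then have e: "f w = w" "f z = z" using f True a by (auto simp: z_def)
      show "sgn (Im ((f w - f z) / 1)) = sgn (Im ((w - z) / 1))"
        and "sgn (Re ((f w - f z) / 1)) = sgn (Re ((w - z) / 1))" using e by auto
    qed (use cont in auto)
  next
    case False
    obtain j where j: "l u (Suc j) = v" using star_overlap_edge[OF u a False] .
    define w1 where "w1 = l u (Suc (Suc j))"
    define w2 where "w2 = l u j"
    obtain i where i: "l v i = w1" "l v (Suc i) = u"
      using link_rotate[OF u, of "Suc j"] j w1_def by metis
    \<comment> \<open>Two more rotations show that the link of \<open>v\<close> runs through
      \<open>w1\<close>, \<open>u\<close>, \<open>w2\<close> in this order, so the apexes swap their
      roles.\<close>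
    have i2: "l v (Suc (Suc i)) = w2"
    proof -
      obtain k where k: "l w2 k = v" "l w2 (Suc k) = u"
        using link_rotate[OF u, of j] j w2_def by metis
      have "w2 \<in> W" using link_in_W u by (simp add: w2_def)
      then obtain k' where "l v k' = u" "l v (Suc k') = w2"
        using link_rotate[of w2 k] k by metis
      then show ?thesis using link_Suc_cong[OF v] i by metis
    qed
    let ?A = "unit_root (m u)" and ?B = "unit_root (m v)"
    note U = star_chart_edge[OF u j _ _ w1_def w2_def]
    note V = star_chart_edge[OF v i(2) _ _ i2[symmetric] i(1)[symmetric]]
    have IA: "Im (?A 1) > 0" using Im_unit_root_1_pos[OF m_ge_3[OF u]] .
    have IB: "Im (?B 1) > 0" using Im_unit_root_1_pos[OF m_ge_3[OF v]] .
    have key: "\<exists>b. (w - z) / ?A (Suc j) = of_real (b v - a v) + of_real (b w1 - a w1) * ?A 1 + of_real (b w2 - a w2) * cnj (?A 1)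
        \<and> (f w - f z) / (- ?B (Suc i)) = - (of_real (b u - a u) + of_real (b w2 - a w2) * ?B 1 + of_real (b w1 - a w1) * cnj (?B 1))
        \<and> (b w1 = 0 \<or> b w2 = 0) \<and> b u + b v + b w1 + b w2 = 1 \<and> (a w1 = 0 \<or> a w2 = 0) \<and> a u + a v + a w1 + a w2 = 1
        \<and> 0 \<le> b w1 \<and> 0 \<le> b w2 \<and> 0 \<le> a w1 \<and> 0 \<le> a w2"
      if wz: "w \<in> sphere z r" for w
    proof -
      obtain b where b: "b \<in> star u" "b \<in> star v" "w = star_chart u b"
        using wz sph unfolding z_def by blast
      have w: "w - z = ?A (Suc j) * (of_real (b v - a v) + of_real (b w1 - a w1) * ?A 1 + of_real (b w2 - a w2) * cnj (?A 1))"
        unfolding b(3) z_def U(1)[OF b(1,2)] U(1)[OF a] by (simp add: algebra_simps)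
      have fw: "f w - f z = ?B (Suc i) * (of_real (b u - a u) + of_real (b w2 - a w2) * ?B 1 + of_real (b w1 - a w1) * cnj (?B 1))"
        unfolding b(3) z_def f[OF b(1)] f[OF a(1)] V(1)[OF b(2,1)] V(1)[OF a(2,1)] by (simp add: algebra_simps)
      have nn: "0 \<le> b x" "0 \<le> a x" for x
        using subsetD[OF star_subset(1) b(1)] subsetD[OF star_subset(1) a(1)] by (simp_all add: points_nonneg)
      show ?thesis
        using U(2,3)[OF b(1,2)] U(2,3)[OF a] nn by (intro exI[of _ b] conjI) (simp_all add: w fw)
    qed
    show ?thesis
    proof (rule winding_number_eq_1_if_same_side[OF r, of "- ?B (Suc i)" "?A (Suc j)"])
      fix w assume w: "w \<in> sphere z r"
      obtain b where b: "(w - z) / ?A (Suc j) = of_real (b v - a v) + of_real (b w1 - a w1) * ?A 1 + of_real (b w2 - a w2) * cnj (?A 1)"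
        "(f w - f z) / (- ?B (Suc i)) = - (of_real (b u - a u) + of_real (b w2 - a w2) * ?B 1 + of_real (b w1 - a w1) * cnj (?B 1))"
        "b w1 = 0 \<or> b w2 = 0" "b u + b v + b w1 + b w2 = 1" "a w1 = 0 \<or> a w2 = 0" "a u + a v + a w1 + a w2 = 1"
        "0 \<le> b w1" "0 \<le> b w2" "0 \<le> a w1" "0 \<le> a w2"
        using key[OF w] by blast
      define d where "d = (b w1 - a w1) - (b w2 - a w2)"
      have I: "Im ((w - z) / ?A (Suc j)) = d * Im (?A 1)"
        "Im ((f w - f z) / (- ?B (Suc i))) = d * Im (?B 1)"
        unfolding b(1,2) by (simp_all add: d_def algebra_simps)
      then show "sgn (Im ((f w - f z) / (- ?B (Suc i)))) = sgn (Im ((w - z) / ?A (Suc j)))"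
        using IA IB by (simp only: sgn_mult) simp
      assume "Im ((w - z) / ?A (Suc j)) = 0"
      then have "d = 0" using I IA by simp
      \<comment> \<open>Of the two nonnegative apex coordinates of a point at most one is nonzero,
        so their difference determines both.\<close>
      then have e: "b w1 = a w1" "b w2 = a w2" using b(3,5,7-10) unfolding d_def by linarith+
      then have "b v - a v = - (b u - a u)" using b(4,6) by linarith
      then show "sgn (Re ((f w - f z) / (- ?B (Suc i)))) = sgn (Re ((w - z) / ?A (Suc j)))"
        unfolding b(1,2) by (simp add: e)
    qed (use cont in auto)
  qed
  then show ?thesis by (simp add: f_def z_def)
qed

lemma orientable_points: "orientable (top_of_set points)"
proof -
  have "orientation_preserving_on (star_chart u ` (star u \<inter> star v))
     (star_chart v \<circ> inv_into (star u) (star_chart u))" if u: "u \<in> W" and v: "v \<in> W" for u v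
    unfolding orientation_preserving_on_def
  proof
    fix z assume z: "z \<in> star_chart u ` (star u \<inter> star v)"
    then obtain a where a: "a \<in> star u" "a \<in> star v" "z = star_chart u a" by blast
    obtain T where "open T" "star v = points \<inter> T"
      using openin_star[of v] unfolding openin_open by blast
    then have "openin (top_of_set (star u)) (star u \<inter> star v)"
      unfolding openin_open using star_subset(1)[of u] by (intro exI[of _ T]) auto
    then have "openin (top_of_set (star_chart u ` star u)) (star_chart u ` (star u \<inter> star v))"
      using homeomorphic_map_openness_eq[OF homeomorphic_map_star_chart[OF u]] by blast
    then have "open (star_chart u ` (star u \<inter> star v))"
      by (rule openin_open_trans) (rule open_star_chart_star[OF u])
    then obtain e where e: "e > 0" "ball z e \<subseteq> star_chart u ` (star u \<inter> star v)"
      using z by (rule openE)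
    have "\<forall>\<^sub>F r in at_right 0. r < e \<and> (0::real) < r"
      using e(1) by (auto simp: eventually_at_right_field intro!: exI[of _ e])
    then show "\<forall>\<^sub>F r in at_right 0. winding_number ((star_chart v \<circ> inv_into (star u) (star_chart u)) \<circ> circlepath z r)
            ((star_chart v \<circ> inv_into (star u) (star_chart u)) z) = 1"
    proof eventually_elim
      case (elim r)
      then have "sphere z r \<subseteq> star_chart u ` (star u \<inter> star v)" using e(2) by auto
      then show ?case
        using winding_number_transition[OF u v a(1,2), of r] elim unfolding a(3) by simp
    qed
  qed
  then show ?thesis
    unfolding orientable_def
    by (intro exI[of _ "(\<lambda>u. (star u, star_chart u)) ` W"]) (use chart_star points_eq_stars in auto)
qed

section \<open>Connectedness of the surface and frontiers of stars\<close>

lemma vertex_in_closed_star: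
  assumes u: "u \<in> W" and x: "x \<in> triangle u j"
  shows "(\<lambda>y. if y = x then 1 else 0) \<in> closed_star u"
  unfolding closed_star_def
proof (intro CollectI conjI exI[of _ j])
  show "sum (\<lambda>y. if y = x then 1 else 0) (triangle u j) = (1 :: real)"
    using x by (simp add: triangle_def sum.delta)
qed (use x in auto)

lemma continuous_on_corner_ray: "continuous_on A (\<lambda>r. corner_point u j (r * s) (r * t))"
proof (rule continuous_on_coordinatewise_then_product)
  fix x
  consider "x = u" | "x \<noteq> u" "x = l u j" | "x \<noteq> u" "x \<noteq> l u j" "x = l u (Suc j)"
    | "x \<noteq> u" "x \<noteq> l u j" "x \<noteq> l u (Suc j)" by blast
  then show "continuous_on A (\<lambda>r. corner_point u j (r * s) (r * t) x)"
    by cases (simp_all add: corner_point_def continuous_intros)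
qed

lemma connected_closed_star:
  assumes u: "u \<in> W"
  shows "connected (closed_star u)"
proof -
  define ray where "ray = (\<lambda>(j, s, t). (\<lambda>r. corner_point u j (r * s) (r * t)) ` {0..1})"
  define P :: "(nat \<times> real \<times> real) set" where "P = {(j, s, t). j < m u \<and> 0 \<le> s \<and> 0 \<le> t \<and> s + t \<le> 1}"
  have 0: "corner_point u j 0 0 = corner_point u 0 0 0" for j
    by (auto simp: corner_point_def)
  have "connected (\<Union>(ray ` P))"
  proof (rule connected_Union)
    fix S assume "S \<in> ray ` P"
    then obtain j s t where S: "S = (\<lambda>r. corner_point u j (r * s) (r * t)) ` {0..1}"
      by (auto simp: ray_def)
    have "continuous_on {0..1} (\<lambda>r. corner_point u j (r * s) (r * t))"
      by (rule continuous_on_corner_ray)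
    then show "connected S" unfolding S by (rule connected_continuous_image) simp
  next
    have "corner_point u 0 0 0 \<in> ray p" for p
    proof -
      obtain j s t where p: "p = (j, s, t)" by (cases p)
      show ?thesis unfolding p ray_def prod.case
        by (rule image_eqI[of _ _ 0], simp only: mult_zero_left, rule 0[symmetric]) simp
    qed
    then have "corner_point u 0 0 0 \<in> \<Inter>(ray ` P)" by blast
    then show "\<Inter>(ray ` P) \<noteq> {}" by blast
  qed
  moreover have "\<Union>(ray ` P) = closed_star u"
  proof (intro equalityI subsetI)
    fix a assume "a \<in> \<Union>(ray ` P)"
    then obtain j s t r where j: "j < m u" "0 \<le> s" "0 \<le> t" "s + t \<le> 1" and r: "0 \<le> r" "r \<le> 1"
      and a: "a = corner_point u j (r * s) (r * t)"
      by (auto simp: ray_def P_def)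
    have "r * s + r * t \<le> 1"
      using mult_le_one[of r "s + t"] j r by (simp add: distrib_left)
    with j r show "a \<in> closed_star u"
      unfolding closed_star_eq[OF u] a
      by (intro CollectI exI[of _ j] exI[of _ "r * s"] exI[of _ "r * t"]) auto
  next
    fix a assume "a \<in> closed_star u"
    then obtain j s t where j: "j < m u" "0 \<le> s" "0 \<le> t" "s + t \<le> 1" and a: "a = corner_point u j s t"
      by (rule closed_star_cases[OF u])
    have "(j, s, t) \<in> P" using j by (simp add: P_def)
    moreover have "a \<in> ray (j, s, t)"
      unfolding ray_def prod.case a by (rule image_eqI[of _ _ 1]) auto
    ultimately show "a \<in> \<Union>(ray ` P)" by blast
  qed
  ultimately show ?thesis by simp
qed

lemma connected_points: "connected points"
proof -
  define e :: "'w \<Rightarrow> 'w \<Rightarrow> real" where "e u = (\<lambda>y. if y = u then 1 else 0)" for u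
  have star: "connected_component points a b" if "u \<in> W" "a \<in> closed_star u" "b \<in> closed_star u" for a b u
    unfolding connected_component_def
    using that connected_closed_star closed_star_subset by (intro exI[of _ "closed_star u"]) auto
  have e: "e u \<in> closed_star u" "e (l u j) \<in> closed_star u" if "u \<in> W" for u j
    using that vertex_in_closed_star[of u _ j] by (auto simp: e_def triangle_def)
  have W: "(u, v) \<in> {(x, l x j) |x j. x \<in> W}\<^sup>* \<Longrightarrow> u \<in> W \<Longrightarrow> connected_component points (e u) (e v)" for u v
  proof (induction rule: rtrancl_induct)
    case base
    then show ?case using star e by blast
  next
    case (step y z)
    then show ?case using star[of y "e y" "e z"] e connected_component_trans by blast
  qed
  show ?thesis
    unfolding connected_iff_connected_component
  proof (intro ballI)
    fix a b assume "a \<in> points" "b \<in> points"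
    then obtain u v where uv: "u \<in> W" "a \<in> closed_star u" "v \<in> W" "b \<in> closed_star v"
      by (auto simp: points_def)
    have "connected_component points a (e u)" "connected_component points (e v) b"
      using star uv e by blast+
    with W[OF links_connected[OF uv(1,3)] uv(1)] show "connected_component points a b"
      by (meson connected_component_trans)
  qed
qed

lemma surface_points: "surface (top_of_set points)"
  unfolding surface_def
proof (intro conjI ballI)
  show "Hausdorff_space (top_of_set points)"
    by (simp add: Hausdorff_space_subtopology)
  show "second_countable (top_of_set points)"
  proof (rule second_countable_subtopology)
    obtain B :: "('w \<Rightarrow> real) set set" where B: "countable B" "topological_basis B"
      using ex_countable_basis by blast
    then show "second_countable (euclidean :: ('w \<Rightarrow> real) topology)"
      unfolding second_countable_def
      by (intro exI[of _ B]) (metis open_openin topological_basis_open topological_basisE)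
  qed
  show "compact_space (top_of_set points)"
    using compact_points by (simp add: compact_space_subtopology)
  show "connected_space (top_of_set points)"
    using connected_points by (simp add: connected_space_subtopology)
  fix a assume "a \<in> topspace (top_of_set points)"
  then obtain u where "u \<in> W" "a \<in> star u" using points_eq_stars by auto
  then show "\<exists>U \<phi>. a \<in> U \<and> chart (top_of_set points) U \<phi>"
    using chart_star by blast
qed

lemma frontier_of_star:
  assumes u: "u \<in> W"
  shows "top_of_set points frontier_of star u = {a \<in> closed_star u. a u = 0}"
proof -
  have sub: "star u \<subseteq> points" by (rule star_subset)
  have "points \<inter> closure (star u) = closed_star u"
  proof (intro equalityI subsetI)
    fix a assume "a \<in> points \<inter> closure (star u)"
    moreover have "closure (star u) \<subseteq> closed_star u"
      using star_subset(2) compact_imp_closed[OF compact_closed_star[OF u]] by (rule closure_minimal)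
    ultimately show "a \<in> closed_star u" by blast
  next
    fix a assume a: "a \<in> closed_star u"
    then obtain j s t where j: "j < m u" "0 \<le> s" "0 \<le> t" "s + t \<le> 1" and aj: "a = corner_point u j s t"
      by (rule closed_star_cases[OF u])
    \<comment> \<open>Shrinking towards \<open>u\<close> exhibits \<open>a\<close> as a limit of
      points of the open star.\<close>
    let ?f = "\<lambda>r. corner_point u j (r * s) (r * t)"
    have "?f ` closure {0..<1} \<subseteq> closure (star u)"
    proof (rule image_closure_subset)
      show "continuous_on (closure {0..<1}) ?f" by (rule continuous_on_corner_ray)
      show "?f ` {0..<1} \<subseteq> closure (star u)"
      proof
        fix b assume "b \<in> ?f ` {0..<1}"
        then obtain r where r: "0 \<le> r" "r < 1" "b = ?f r" by auto
        have "r * (s + t) \<le> r * 1" using r j by (intro mult_left_mono) auto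
        then have "r * s + r * t < 1" using r by (simp add: distrib_left)
        then have "b \<in> star u" unfolding r(3) using r j by (intro corner_point_in_star[OF u]) auto
        then show "b \<in> closure (star u)" using closure_subset by blast
      qed
    qed simp
    moreover have "a = ?f 1" by (simp add: aj)
    moreover have "?f 1 \<in> ?f ` closure {0..<1}" by (rule imageI) simp
    ultimately have "a \<in> closure (star u)" by (simp only: subset_iff)
    with a closed_star_subset[OF u] show "a \<in> points \<inter> closure (star u)" by blast
  qed
  then have "top_of_set points closure_of star u = closed_star u"
    using sub by (simp add: closure_of_subtopology inf.absorb2)
  moreover have "top_of_set points interior_of star u = star u"
    by (rule interior_of_openin[OF openin_star])
  moreover have "0 \<le> a u" if "a \<in> closed_star u" for a
    using that by (simp add: closed_star_def)
  ultimately show ?thesis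
    unfolding frontier_of_def star_eq[OF u] by (auto simp: order.order_iff_strict)
qed

text \<open>Moves the surface into the type \<open>nat \<times> complex\<close>.\<close>

definition code_point :: "('w \<Rightarrow> real) \<Rightarrow> nat \<times> complex"
  where "code_point a = (let u = SOME u. a u > 0 in (to_nat u, star_chart u a))"

text \<open>The first component names a chart, and that chart is injective on the closed star
  containing the point.\<close>

lemma inj_on_code_point: "inj_on code_point points"
proof (rule inj_onI)
  fix a b assume a: "a \<in> points" and b: "b \<in> points" and eq: "code_point a = code_point b"
  have ex: "\<exists>u. c u > 0" if "c \<in> points" for c
  proof -
    obtain u where "c \<in> star u" using \<open>c \<in> points\<close>[unfolded points_eq_stars] by blast
    then show ?thesis unfolding star_def by blast
  qed
  define u where "u = (SOME u. a u > 0)"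
  have ua: "a u > 0" using someI_ex[OF ex[OF a]] by (simp add: u_def)
  have "(SOME u. b u > 0) = u" using eq by (simp add: code_point_def Let_def u_def)
  then have ub: "b u > 0" and eq': "star_chart u a = star_chart u b"
    using someI_ex[OF ex[OF b]] eq by (simp_all add: code_point_def Let_def u_def[symmetric])
  from points_iff_closed_star[OF a ua] points_iff_closed_star[OF b ub] show "a = b"
    using inj_on_star_chart eq' by (auto dest: inj_onD)
qed

end

section \<open>Transport along homeomorphisms\<close>

text \<open>The topology is pulled back along the inverse of the injection. This places the surface
  in the type over which existence is stated.\<close>

lemma ex_homeomorphic_map_image:
  assumes "inj_on e (topspace Y)"
  obtains X where "homeomorphic_map Y X e"
proof -
  define g where "g = inv_into (topspace Y) e"
  define X where "X = pullback_topology (e ` topspace Y) g Y"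
  have g: "g (e y) = y" if "y \<in> topspace Y" for y
    using assms that by (simp add: g_def)
  have top: "topspace X = e ` topspace Y"
    unfolding X_def topspace_pullback_topology using g by auto
  have "homeomorphic_maps Y X e g"
    unfolding homeomorphic_maps_def
  proof (intro conjI ballI)
    show "continuous_map X Y g"
      unfolding X_def using continuous_map_id[of Y] continuous_map_pullback[of Y Y id] by (simp add: id_def o_def)
    show "continuous_map Y X e"
      unfolding continuous_map_def
    proof (intro conjI allI impI)
      show "e \<in> topspace Y \<rightarrow> topspace X" using top by auto
      fix S assume "openin X S"
      then obtain U where U: "openin Y U" "S = g -` U \<inter> e ` topspace Y"
        by (auto simp: X_def openin_pullback_topology)
      have "e y \<in> S \<longleftrightarrow> y \<in> U" if "y \<in> topspace Y" for y
        using g[OF that] imageI[OF that, of e] by (simp add: U(2))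
      then have "{y \<in> topspace Y. e y \<in> S} = U"
        using openin_subset[OF U(1)] by auto
      then show "openin Y {y \<in> topspace Y. e y \<in> S}" using U by simp
    qed
  qed (use g top in auto)
  then have "homeomorphic_map Y X e" using homeomorphic_map_maps by blast
  then show ?thesis by (rule that)
qed

lemma chart_homeomorphic:
  assumes hom: "homeomorphic_maps Y X e g" and U: "chart Y U \<phi>"
  shows "chart X (e ` U) (\<phi> \<circ> g)"
proof -
  have UY: "U \<subseteq> topspace Y" using U by (simp add: chart_def openin_subset)
  have gX: "homeomorphic_map X Y g" and eY: "homeomorphic_map Y X e"
    using hom homeomorphic_maps_map by blast+
  have g: "g ` e ` U = U" using hom UY by (force simp: homeomorphic_maps_def image_iff)
  have eU: "e ` U \<subseteq> topspace X"
    using UY homeomorphic_imp_surjective_map[OF eY] by blast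
  have "g ` (topspace X \<inter> e ` U) = topspace Y \<inter> U"
    using eU UY g by (simp add: Int_absorb1)
  from homeomorphic_map_subtopologies[OF gX this]
  have "homeomorphic_map (subtopology X (e ` U)) (top_of_set (\<phi> ` U)) (\<phi> \<circ> g)"
    using U homeomorphic_map_compose unfolding chart_def by blast
  moreover have "(\<phi> \<circ> g) ` e ` U = \<phi> ` U"
    using g by (metis image_comp)
  moreover have "openin X (e ` U)"
    using U UY homeomorphic_map_openness[OF eY] by (simp add: chart_def)
  ultimately show ?thesis using U by (simp add: chart_def)
qed

lemma surface_homeomorphic:
  assumes hom: "homeomorphic_map Y X e" and Y: "surface Y"
  shows "surface X"
proof -
  have sp: "Y homeomorphic_space X" using hom homeomorphic_map_imp_homeomorphic_space by blast
  obtain g where g: "homeomorphic_maps Y X e g" using hom homeomorphic_map_maps by blast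
  have "\<exists>U \<phi>. x \<in> U \<and> chart X U \<phi>" if x: "x \<in> topspace X" for x
  proof -
    have "g x \<in> topspace Y" "e (g x) = x"
      using g x by (auto simp: homeomorphic_maps_def continuous_map_def)
    moreover obtain U \<phi> where "g x \<in> U" "chart Y U \<phi>"
      using Y calculation by (auto simp: surface_def)
    ultimately show ?thesis using chart_homeomorphic[OF g] by (metis imageI)
  qed
  then show ?thesis
    using Y sp homeomorphic_Hausdorff_space homeomorphic_space_second_countability
      homeomorphic_compact_space homeomorphic_connected_space
    unfolding surface_def by blast
qed

lemma orientable_homeomorphic:
  assumes hom: "homeomorphic_map Y X e" and Y: "orientable Y"
  shows "orientable X"
proof -
  obtain g where g: "homeomorphic_maps Y X e g" using hom homeomorphic_map_maps by blast
  obtain A where A': "\<forall>(U, \<phi>)\<in>A. chart Y U \<phi>" "(\<Union>(U, \<phi>)\<in>A. U) = topspace Y"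
    and or': "\<forall>(U, \<phi>)\<in>A. \<forall>(V, \<psi>)\<in>A.
            orientation_preserving_on (\<phi> ` (U \<inter> V)) (\<psi> \<circ> inv_into U \<phi>)"
    using Y unfolding orientable_def by (elim exE conjE)
  have A: "chart Y U \<phi>" if "(U, \<phi>) \<in> A" for U \<phi>
    using bspec[OF A'(1) that] by simp
  have or: "orientation_preserving_on (\<phi> ` (U \<inter> V)) (\<psi> \<circ> inv_into U \<phi>)"
    if "(U, \<phi>) \<in> A" "(V, \<psi>) \<in> A" for U \<phi> V \<psi>
    using bspec[OF bspec[OF or' that(1), unfolded prod.case] that(2)] by simp
  define B where "B = (\<lambda>(U, \<phi>). (e ` U, \<phi> \<circ> g)) ` A"
  have ge: "g (e y) = y" if "y \<in> topspace Y" for y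
    using g that by (simp add: homeomorphic_maps_def)
  have inj: "inj_on e (topspace Y)" using ge by (metis inj_onI)
  have sub: "U \<subseteq> topspace Y" if "(U, \<phi>) \<in> A" for U \<phi>
    using A[OF that] by (simp add: chart_def openin_subset)
  have "orientation_preserving_on ((\<phi> \<circ> g) ` (e ` U \<inter> e ` V)) ((\<psi> \<circ> g) \<circ> inv_into (e ` U) (\<phi> \<circ> g))"
    if U: "(U, \<phi>) \<in> A" and V: "(V, \<psi>) \<in> A" for U \<phi> V \<psi>
    unfolding orientation_preserving_on_def
  proof
    have UV: "e ` U \<inter> e ` V = e ` (U \<inter> V)"
      using inj_on_image_Int[OF inj sub[OF U] sub[OF V]] by simp
    have injU: "inj_on \<phi> U" and opU: "open (\<phi> ` U)"
      using A[OF U] sub[OF U] unfolding chart_def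
      by (auto simp: homeomorphic_map_def inf.absorb2 dest: homeomorphic_imp_injective_map)
    have inj': "inj_on (\<phi> \<circ> g) (e ` U)"
      using injU ge sub[OF U] by (auto simp: inj_on_def subset_iff)
    have f: "((\<psi> \<circ> g) \<circ> inv_into (e ` U) (\<phi> \<circ> g)) w = (\<psi> \<circ> inv_into U \<phi>) w" if w: "w \<in> \<phi> ` U" for w
    proof -
      obtain x where x: "x \<in> U" "w = \<phi> x" using w by blast
      then have "w = (\<phi> \<circ> g) (e x)" using ge sub[OF U] by auto
      then have "inv_into (e ` U) (\<phi> \<circ> g) w = e x" using inv_into_f_f[OF inj'] x by simp
      then show ?thesis using x injU ge sub[OF U] by auto
    qed
    fix z assume "z \<in> (\<phi> \<circ> g) ` (e ` U \<inter> e ` V)"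
    moreover have "(\<phi> \<circ> g) ` e ` (U \<inter> V) = \<phi> ` (U \<inter> V)"
      unfolding image_image by (rule image_cong) (use ge sub[OF U] in auto)
    ultimately have z: "z \<in> \<phi> ` (U \<inter> V)" unfolding UV by simp
    then have zU: "z \<in> \<phi> ` U" by blast
    \<comment> \<open>Off the chart image the two \<open>inv_into\<close> terms may differ. Circles
      that stay inside it suffice, because the condition concerns small radii only.\<close>
    then obtain d where d: "d > 0" "ball z d \<subseteq> \<phi> ` U" using opU openE by blast
    have "\<forall>\<^sub>F r in at_right 0. winding_number ((\<psi> \<circ> inv_into U \<phi>) \<circ> circlepath z r) ((\<psi> \<circ> inv_into U \<phi>) z) = 1"
      using or[OF U V] z unfolding orientation_preserving_on_def by blast
    moreover have "\<forall>\<^sub>F r in at_right 0. r < d \<and> (0::real) < r"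
      using d(1) by (auto simp: eventually_at_right_field intro!: exI[of _ d])
    ultimately show "\<forall>\<^sub>F r in at_right 0.
        winding_number (((\<psi> \<circ> g) \<circ> inv_into (e ` U) (\<phi> \<circ> g)) \<circ> circlepath z r)
          (((\<psi> \<circ> g) \<circ> inv_into (e ` U) (\<phi> \<circ> g)) z) = 1"
    proof eventually_elim
      case (elim r)
      have "circlepath z r t \<in> \<phi> ` U" for t
      proof -
        have "norm (exp (2 * of_real pi * \<i> * of_real t)) = 1" by (simp add: norm_exp_eq_Re)
        then have "dist z (circlepath z r t) < d"
          using elim unfolding circlepath dist_norm by (simp add: norm_mult)
        then show ?thesis using d(2) by auto
      qed
      then have "((\<psi> \<circ> g) \<circ> inv_into (e ` U) (\<phi> \<circ> g)) \<circ> circlepath z r = (\<psi> \<circ> inv_into U \<phi>) \<circ> circlepath z r"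
        using f by (auto simp only: fun_eq_iff o_apply)
      then show ?case using elim f[OF zU] by simp
    qed
  qed
  moreover have "chart X (e ` U) (\<phi> \<circ> g)" if "(U, \<phi>) \<in> A" for U \<phi>
    using chart_homeomorphic[OF g A[OF that]] .
  moreover have "(\<Union>(U, \<phi>)\<in>B. U) = topspace X"
  proof -
    have "(\<Union>(U, \<phi>)\<in>B. U) = e ` (\<Union>(U, \<phi>)\<in>A. U)" by (auto simp: B_def)
    then show ?thesis using A'(2) homeomorphic_imp_surjective_map[OF hom] by simp
  qed
  ultimately show ?thesis
    unfolding orientable_def by (intro exI[of _ B]) (auto simp: B_def)
qed


lemma faces_homeomorphic:
  assumes hom: "homeomorphic_map Y X e" and sub: "\<psi> ` realization G \<subseteq> topspace Y"
  shows "faces G X (e \<circ> \<psi>) = image e ` faces G Y \<psi>"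
proof -
  have inj: "inj_on e (topspace Y)" using hom by (rule homeomorphic_imp_injective_map)
  have img: "e ` topspace Y = topspace X" using hom by (rule homeomorphic_imp_surjective_map)
  have "e ` (topspace Y - \<psi> ` realization G) = topspace X - (e \<circ> \<psi>) ` realization G"
    using inj_on_image_set_diff[OF inj _ sub, of "topspace Y"] img by (simp add: image_comp)
  then have "homeomorphic_map (subtopology Y (topspace Y - \<psi> ` realization G))
      (subtopology X (topspace X - (e \<circ> \<psi>) ` realization G)) e"
    by (intro homeomorphic_map_subtopologies[OF hom]) (simp add: inf.absorb2)
  then show ?thesis unfolding faces_def by (rule homeomorphic_map_connected_components_of)
qed

lemma cellular_homeomorphic:
  assumes hom: "homeomorphic_map Y X e" and sub: "\<psi> ` realization G \<subseteq> topspace Y"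
    and cell: "cellular G Y \<psi>"
  shows "cellular G X (e \<circ> \<psi>)"
  unfolding cellular_def faces_homeomorphic[OF hom sub]
proof
  fix F' assume "F' \<in> image e ` faces G Y \<psi>"
  then obtain F where F: "F \<in> faces G Y \<psi>" "F' = e ` F" by blast
  have "F \<subseteq> topspace Y" using F connected_components_of_subset unfolding faces_def by fastforce
  then have "e ` (topspace Y \<inter> F) = topspace X \<inter> F'"
    using F homeomorphic_imp_surjective_map[OF hom] by (auto simp: Int_absorb1)
  from homeomorphic_map_subtopologies[OF hom this]
  have "subtopology X F' homeomorphic_space subtopology Y F"
    using homeomorphic_map_imp_homeomorphic_space homeomorphic_space_sym by blast
  moreover have "subtopology Y F homeomorphic_space top_of_set (ball (0::complex) 1)"
    using cell F(1) unfolding cellular_def by blast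
  ultimately show "subtopology X F' homeomorphic_space top_of_set (ball (0::complex) 1)"
    by (rule homeomorphic_space_trans)
qed

lemma biembedding_homeomorphic:
  assumes hom: "homeomorphic_map Y X e" and G: "\<And>d. d \<in> edges G \<Longrightarrow> d \<subseteq> verts G"
    and bi: "biembedding G D D' Y \<psi>"
  shows "biembedding G D D' X (e \<circ> \<psi>)"
proof -
  have inj: "inj_on e (topspace Y)" using hom by (rule homeomorphic_imp_injective_map)
  have emb: "continuous_map (top_of_set (realization G)) Y \<psi>" "inj_on \<psi> (realization G)"
    using bi by (auto simp: biembedding_def embedding_def)
  then have sub: "\<psi> ` realization G \<subseteq> topspace Y"
    using continuous_map_image_subset_topspace by fastforce
  obtain col where col: "proper_face_coloring G Y \<psi> col"
    "(\<lambda>F. Y frontier_of F) ` {F \<in> faces G Y \<psi>. col F} = (\<lambda>C. \<psi> ` realization C) ` D"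
    "(\<lambda>F. Y frontier_of F) ` {F \<in> faces G Y \<psi>. \<not> col F} = (\<lambda>C. \<psi> ` realization C) ` D'"
    using bi unfolding biembedding_def by (elim exE conjE)
  note faces = faces_homeomorphic[OF hom sub]
  have fsub: "F \<subseteq> topspace Y" if "F \<in> faces G Y \<psi>" for F
    using that connected_components_of_subset unfolding faces_def by fastforce
  note frontier = homeomorphic_map_frontier_of[OF hom fsub]
  define col' where "col' F' = col {y \<in> topspace Y. e y \<in> F'}" for F'
  have col': "col' (e ` F) = col F" if "F \<in> faces G Y \<psi>" for F
  proof -
    have "{y \<in> topspace Y. e y \<in> e ` F} = F"
      using fsub[OF that] inj by (auto dest: inj_onD)
    then show ?thesis by (simp add: col'_def)
  qed
  have "embedding G X (e \<circ> \<psi>)"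
    unfolding embedding_def
    using emb hom homeomorphic_imp_continuous_map continuous_map_compose
      comp_inj_on[OF emb(2) inj_on_subset[OF inj sub]] by blast
  moreover have "proper_face_coloring G X (e \<circ> \<psi>) col'"
    unfolding proper_face_coloring_def
  proof (intro ballI impI)
    fix F1' F2' assume "F1' \<in> faces G X (e \<circ> \<psi>)" "F2' \<in> faces G X (e \<circ> \<psi>)"
      and *: "F1' \<noteq> F2' \<and> face_share_edge G X (e \<circ> \<psi>) F1' F2'"
    then obtain F1 F2 where F: "F1 \<in> faces G Y \<psi>" "F1' = e ` F1" "F2 \<in> faces G Y \<psi>" "F2' = e ` F2"
      unfolding faces by blast
    obtain d where d: "d \<in> edges G" and
      fr: "(e \<circ> \<psi>) ` realization (d, {d}) \<subseteq> X frontier_of F1' \<inter> X frontier_of F2'"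
      using * unfolding face_share_edge_def by blast
    have "realization (d, {d}) \<subseteq> realization G"
    proof -
      have "simplices (d, {d}) \<subseteq> simplices G"
        using G[OF d] d by (auto simp: simplices_def)
      then show ?thesis unfolding realization_def by blast
    qed
    \<comment> \<open>The next inclusion cancels \<open>e\<close>, which is injective on the space
      only; the drawn edge lies there because edges consist of vertices.\<close>
    then have dY: "\<psi> ` realization (d, {d}) \<subseteq> topspace Y" using sub by blast
    have "\<psi> ` realization (d, {d}) \<subseteq> Y frontier_of F1 \<inter> Y frontier_of F2"
    proof
      fix y assume y: "y \<in> \<psi> ` realization (d, {d})"
      then have "e y \<in> e ` (Y frontier_of F1)" "e y \<in> e ` (Y frontier_of F2)"
        using fr unfolding F(2,4) frontier[OF F(1)] frontier[OF F(3)] by (auto simp: image_comp[symmetric])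
      then show "y \<in> Y frontier_of F1 \<inter> Y frontier_of F2"
        using inj dY y frontier_of_subset_topspace[of Y] by (meson IntI inj_on_image_mem_iff subsetD)
    qed
    then have "face_share_edge G Y \<psi> F1 F2" using d unfolding face_share_edge_def by blast
    then have "col F1 \<noteq> col F2"
      using col(1) F * unfolding proper_face_coloring_def by blast
    then show "col' F1' \<noteq> col' F2'" using col' F by simp
  qed
  moreover have "(\<lambda>F. X frontier_of F) ` {F \<in> faces G X (e \<circ> \<psi>). P (col' F)} =
      image e ` (\<lambda>F. Y frontier_of F) ` {F \<in> faces G Y \<psi>. P (col F)}" for P
  proof -
    have "{F \<in> faces G X (e \<circ> \<psi>). P (col' F)} = image e ` {F \<in> faces G Y \<psi>. P (col F)}"
      unfolding faces using col' by auto
    then show ?thesis unfolding image_image by (auto simp: frontier image_image intro!: image_cong)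
  qed
  from this[of "\<lambda>b. b"] this[of Not]
  have "(\<lambda>F. X frontier_of F) ` {F \<in> faces G X (e \<circ> \<psi>). col' F} = (\<lambda>C. (e \<circ> \<psi>) ` realization C) ` D"
    "(\<lambda>F. X frontier_of F) ` {F \<in> faces G X (e \<circ> \<psi>). \<not> col' F} = (\<lambda>C. (e \<circ> \<psi>) ` realization C) ` D'"
    unfolding col(2,3) by (simp_all add: image_image)
  ultimately show ?thesis unfolding biembedding_def by blast
qed

section \<open>Oriented maps with two-coloured faces\<close>

lemma simplices_mono: "verts H \<subseteq> verts G \<Longrightarrow> edges H \<subseteq> edges G \<Longrightarrow> simplices H \<subseteq> simplices G"
  by (auto simp: simplices_def)

lemma realization_mono: "simplices H \<subseteq> simplices G \<Longrightarrow> realization H \<subseteq> realization G"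
  unfolding realization_def by blast

text \<open>\<open>N x\<close> is the rotation at \<open>x\<close>, and \<open>c x j\<close> is the face with the corner
  \<open>N x (j + 1), x, N x j\<close>. The map \<open>p f\<close> traverses the boundary of the face \<open>f\<close>.\<close>

locale oriented_map =
  fixes V :: "'a::countable set" and d :: "'a \<Rightarrow> nat" and N :: "'a \<Rightarrow> nat \<Rightarrow> 'a"
    and F :: "'f::countable set" and k :: nat and p :: "'f \<Rightarrow> nat \<Rightarrow> 'a"
    and c :: "'a \<Rightarrow> nat \<Rightarrow> 'f" and black :: "'f \<Rightarrow> bool"
  assumes finite_V: "finite V" and V_nonempty: "V \<noteq> {}" and finite_F: "finite F"
    and k_ge_3: "3 \<le> k" and d_ge_3: "x \<in> V \<Longrightarrow> 3 \<le> d x"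
    and N_in: "x \<in> V \<Longrightarrow> N x j \<in> V" and N_neq: "x \<in> V \<Longrightarrow> N x j \<noteq> x"
    and N_mod: "x \<in> V \<Longrightarrow> N x (j mod d x) = N x j" and N_inj: "x \<in> V \<Longrightarrow> inj_on (N x) {..<d x}"
    and p_in: "f \<in> F \<Longrightarrow> p f i \<in> V"
    and p_mod: "f \<in> F \<Longrightarrow> p f (i mod k) = p f i" and p_inj: "f \<in> F \<Longrightarrow> inj_on (p f) {..<k}"
    and c_in: "x \<in> V \<Longrightarrow> c x j \<in> F" and c_mod: "x \<in> V \<Longrightarrow> c x (j mod d x) = c x j"
    and corner_at: "x \<in> V \<Longrightarrow>
      \<exists>i. p (c x j) i = N x (Suc j) \<and> p (c x j) (Suc i) = x \<and> p (c x j) (Suc (Suc i)) = N x j"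
    and corner_of: "f \<in> F \<Longrightarrow> \<exists>j. c (p f (Suc i)) j = f \<and>
      N (p f (Suc i)) j = p f (Suc (Suc i)) \<and> N (p f (Suc i)) (Suc j) = p f i"
    and black_alternates: "x \<in> V \<Longrightarrow> black (c x (Suc j)) \<longleftrightarrow> \<not> black (c x j)"
    and N_connected: "x \<in> V \<Longrightarrow> y \<in> V \<Longrightarrow> (x, y) \<in> {(z, N z j) |z j. z \<in> V}\<^sup>*"
begin

section \<open>Arcs, corners and colours of faces\<close>

lemma p_eq_iff: "f \<in> F \<Longrightarrow> p f i = p f j \<longleftrightarrow> i mod k = j mod k"
proof -
  assume f: "f \<in> F"
  have "p f (i mod k) = p f (j mod k) \<longleftrightarrow> i mod k = j mod k"
    using inj_on_eq_iff[OF p_inj[OF f]] k_ge_3 by simp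
  with f show ?thesis by (simp add: p_mod)
qed

lemma N_eq_iff: "x \<in> V \<Longrightarrow> N x i = N x j \<longleftrightarrow> i mod d x = j mod d x"
proof -
  assume x: "x \<in> V"
  have "N x (i mod d x) = N x (j mod d x) \<longleftrightarrow> i mod d x = j mod d x"
    using inj_on_eq_iff[OF N_inj[OF x]] d_ge_3[OF x] by simp
  with x show ?thesis by (simp add: N_mod)
qed

lemma p_Suc_cong: "f \<in> F \<Longrightarrow> p f i = p f j \<Longrightarrow> p f (Suc i) = p f (Suc j)"
  by (metis p_eq_iff mod_Suc_eq)

lemma N_Suc_inj: "x \<in> V \<Longrightarrow> N x (Suc i) = N x (Suc j) \<Longrightarrow> i mod d x = j mod d x"
  using d_ge_3[of x] by (auto simp: N_eq_iff mod_Suc split: if_splits)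

lemma p_Suc_neq: "f \<in> F \<Longrightarrow> p f (Suc i) \<noteq> p f i"
  using k_ge_3 by (auto simp: p_eq_iff mod_Suc split: if_splits)

lemma c_cong: "x \<in> V \<Longrightarrow> i mod d x = j mod d x \<Longrightarrow> c x i = c x j"
  by (metis c_mod)

lemma c_eq_iff: "x \<in> V \<Longrightarrow> c x i = c x j \<longleftrightarrow> i mod d x = j mod d x"
proof
  assume x: "x \<in> V" and eq: "c x i = c x j"
  obtain a where a: "p (c x i) (Suc a) = x" "p (c x i) (Suc (Suc a)) = N x i"
    using corner_at[OF x] by blast
  obtain b where b: "p (c x j) (Suc b) = x" "p (c x j) (Suc (Suc b)) = N x j"
    using corner_at[OF x] by blast
  have "N x i = N x j" using a b eq p_Suc_cong[OF c_in[OF x]] by metis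
  then show "i mod d x = j mod d x" using N_eq_iff[OF x] by simp
qed (rule c_cong)

text \<open>At the head of the arc, its tail is neighbour number \<open>Suc a\<close>, which fixes
  the corner \<open>a\<close> and with it the face.\<close>

lemma same_arc_same_face:
  assumes f: "f \<in> F" and g: "g \<in> F" and eq: "p f i = p g j" "p f (Suc i) = p g (Suc j)"
  shows "f = g"
proof -
  obtain a where a: "c (p f (Suc i)) a = f" "N (p f (Suc i)) (Suc a) = p f i"
    using corner_of[OF f] by blast
  obtain b where b: "c (p g (Suc j)) b = g" "N (p g (Suc j)) (Suc b) = p g j"
    using corner_of[OF g] by blast
  have "a mod d (p f (Suc i)) = b mod d (p f (Suc i))"
    by (rule N_Suc_inj[OF p_in[OF f]]) (use a b eq in simp)
  from c_cong[OF p_in[OF f] this] show ?thesis using a(1) b(1) eq(2) by simp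
qed

text \<open>At \<open>x\<close> the face arriving along the edge has corner \<open>a\<close> and the
  face leaving along it has corner \<open>Suc a\<close>; consecutive corners differ in
  colour.\<close>

lemma opposite_arc_other_color:
  assumes f: "f \<in> F" and g: "g \<in> F" and eq: "p f i = p g (Suc j)" "p f (Suc i) = p g j"
  shows "black f \<longleftrightarrow> \<not> black g"
proof -
  define x where "x = p f (Suc i)"
  have x: "x \<in> V" using p_in f by (simp add: x_def)
  obtain a where a: "c x a = f" "N x (Suc a) = p f i"
    using corner_of[OF f] unfolding x_def by blast
  \<comment> \<open>Adding \<open>k - 1\<close> makes \<open>x\<close> the middle vertex of a corner
    of \<open>g\<close>.\<close>
  have j: "p g (Suc (j + (k - 1))) = p g j" using k_ge_3 g by (simp add: p_eq_iff)
  obtain b where b: "c x b = g" "N x b = p g (Suc (Suc (j + (k - 1))))"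
    using corner_of[OF g, of "j + (k - 1)"] unfolding j eq(2)[symmetric] x_def by blast
  have "N x b = N x (Suc a)"
    using a b p_Suc_cong[OF g j] eq by simp
  then have "c x b = c x (Suc a)" using N_eq_iff[OF x] c_cong[OF x] by blast
  then show ?thesis using black_alternates[OF x, of a] by (simp add: a b)
qed

definition face_cycle :: "'f \<Rightarrow> 'a graph"
  where "face_cycle f = cycle_of_list (map (p f) [0..<k])"

definition map_graph_of :: "'a graph"
  where "map_graph_of = (V, {{x, N x j} |x j. x \<in> V})"

lemma verts_face_cycle: "f \<in> F \<Longrightarrow> verts (face_cycle f) = range (p f)"
proof -
  assume f: "f \<in> F"
  have "p f i \<in> p f ` {0..<k}" for i
    using f k_ge_3 by (intro image_eqI[of _ _ "i mod k"]) (auto simp: p_mod)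
  then show ?thesis by (auto simp: face_cycle_def cycle_of_list_def)
qed

lemma edges_face_cycle: "f \<in> F \<Longrightarrow> edges (face_cycle f) = {{p f i, p f (Suc i)} |i. True}"
proof -
  assume f: "f \<in> F"
  have k: "0 < k" using k_ge_3 by simp
  have "edges (face_cycle f) = {{p f i, p f (Suc i)} |i. i < k}"
  proof -
    have "edges (face_cycle f) =
      (\<lambda>i. {map (p f) [0..<k] ! i, map (p f) [0..<k] ! (Suc i mod k)}) ` {..<k}"
      by (simp add: face_cycle_def cycle_of_list_def setcompr_eq_image lessThan_def)
    also have "\<dots> = (\<lambda>i. {p f i, p f (Suc i)}) ` {..<k}"
      by (intro image_cong refl) (use k in \<open>simp add: p_mod[OF f]\<close>)
    finally show ?thesis by (simp add: setcompr_eq_image lessThan_def)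
  qed
  also have "\<dots> = {{p f i, p f (Suc i)} |i. True}"
  proof -
    have "\<exists>j<k. {p f i, p f (Suc i)} = {p f j, p f (Suc j)}" for i
    proof (intro exI conjI)
      show "i mod k < k" using k by simp
      have "p f (i mod k) = p f i" using f by (rule p_mod)
      with p_Suc_cong[OF f this] show "{p f i, p f (Suc i)} = {p f (i mod k), p f (Suc (i mod k))}" by simp
    qed
    then show ?thesis by blast
  qed
  finally show ?thesis .
qed

lemma is_cycle_face_cycle: "f \<in> F \<Longrightarrow> is_cycle k (face_cycle f)"
  unfolding is_cycle_def face_cycle_def
  using k_ge_3 p_inj[of f] by (intro conjI exI[of _ "map (p f) [0..<k]"])
    (auto simp: distinct_map lessThan_atLeast0)

lemma subgraph_face_cycle: "f \<in> F \<Longrightarrow> subgraph (face_cycle f) map_graph_of"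
proof -
  assume f: "f \<in> F"
  have "{p f i, p f (Suc i)} \<in> edges map_graph_of" for i
  proof -
    obtain a where "N (p f (Suc i)) (Suc a) = p f i" using corner_of[OF f] by blast
    then have "{p f i, p f (Suc i)} = {p f (Suc i), N (p f (Suc i)) (Suc a)}" by auto
    then show ?thesis using p_in[OF f] by (auto simp: map_graph_of_def)
  qed
  then show ?thesis
    using f p_in[OF f] by (auto simp: subgraph_def verts_face_cycle edges_face_cycle map_graph_of_def)
qed

text \<open>The edge to \<open>N x j\<close> separates the corner \<open>j\<close> at
  \<open>x\<close> from its cyclic predecessor, and the faces of these two corners differ in
  colour.\<close>

lemma face_with_arc:
  assumes x: "x \<in> V"
  shows "\<exists>f\<in>F. (black f \<longleftrightarrow> b) \<and> {x, N x j} \<in> edges (face_cycle f)"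
proof -
  obtain i where i: "p (c x j) (Suc i) = x" "p (c x j) (Suc (Suc i)) = N x j"
    using corner_at[OF x] by blast
  define j' where "j' = j + (d x - 1)"
  have j': "Suc j' mod d x = j mod d x" using d_ge_3[OF x] by (simp add: j'_def)
  obtain i' where i': "p (c x j') i' = N x (Suc j')" "p (c x j') (Suc i') = x"
    using corner_at[OF x] by blast
  have "{x, N x j} \<in> edges (face_cycle (c x j))"
    using i c_in[OF x] by (auto simp: edges_face_cycle intro!: exI[of _ "Suc i"])
  moreover have "{x, N x j} \<in> edges (face_cycle (c x j'))"
  proof -
    have "N x (Suc j') = N x j" using N_eq_iff[OF x] j' by simp
    then show ?thesis
      using i' c_in[OF x] by (auto simp: edges_face_cycle intro!: exI[of _ i'])
  qed
  moreover have "black (c x j) \<longleftrightarrow> \<not> black (c x j')"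
    using black_alternates[OF x, of j'] by (simp add: c_cong[OF x j'])
  ultimately show ?thesis using c_in[OF x] by (cases "black (c x j) \<longleftrightarrow> b") blast+
qed

text \<open>Two faces traverse a common edge either in the same direction, and then coincide, or in
  opposite directions, and then differ in colour.\<close>

lemma common_edge_same_color:
  assumes "f \<in> F" "g \<in> F" "black f = black g" "e \<in> edges (face_cycle f)" "e \<in> edges (face_cycle g)"
  shows "f = g"
proof -
  obtain i j where "e = {p f i, p f (Suc i)}" "e = {p g j, p g (Suc j)}"
    using assms by (auto simp: edges_face_cycle)
  then have "p f i = p g j \<and> p f (Suc i) = p g (Suc j) \<or> p f i = p g (Suc j) \<and> p f (Suc i) = p g j"
    by (auto simp: doubleton_eq_iff)
  then show ?thesis
    using same_arc_same_face opposite_arc_other_color assms by blast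
qed

theorem cycle_decomposition_face_cycles:
  "cycle_decomposition k map_graph_of (face_cycle ` {f \<in> F. black f \<longleftrightarrow> b})"
  unfolding cycle_decomposition_def
proof (intro conjI ballI)
  show "disjoint_family_on edges (face_cycle ` {f \<in> F. black f = b})"
    unfolding disjoint_family_on_def using common_edge_same_color by blast
  have "e \<in> (\<Union>C\<in>face_cycle ` {f \<in> F. black f = b}. edges C)" if e: "e \<in> edges map_graph_of" for e
  proof -
    obtain x j where "x \<in> V" "e = {x, N x j}" using e by (auto simp: map_graph_of_def)
    then show ?thesis using face_with_arc[of x b j] by blast
  qed
  moreover have "edges (face_cycle f) \<subseteq> edges map_graph_of" if "f \<in> F" for f
    using subgraph_face_cycle[OF that] by (simp add: subgraph_def)
  ultimately show "(\<Union>C\<in>face_cycle ` {f \<in> F. black f = b}. edges C) = edges map_graph_of"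
    by blast
qed (use subgraph_face_cycle is_cycle_face_cycle in auto)

text \<open>A white face with the cycle of a black one would traverse it backwards. At a common
  vertex each of the two corners would then follow the other in the rotation, so the degree would
  divide 2, while it is at least 3.\<close>

theorem black_cycles_neq_white_cycles:
  "face_cycle ` {f \<in> F. black f} \<noteq> face_cycle ` {f \<in> F. \<not> black f}"
proof
  assume eq: "face_cycle ` {f \<in> F. black f} = face_cycle ` {f \<in> F. \<not> black f}"
  obtain x where x: "x \<in> V" using V_nonempty by blast
  obtain j where j: "black (c x j)" using black_alternates[OF x, of 0] by blast
  define f where "f = c x j"
  have f: "f \<in> F" using c_in[OF x] by (simp add: f_def)
  have bf: "black f" using j by (simp add: f_def)
  have "face_cycle f \<in> face_cycle ` {f \<in> F. \<not> black f}"
    unfolding eq[symmetric] using f bf by blast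
  then obtain g where g: "g \<in> F" "\<not> black g" "face_cycle g = face_cycle f" by auto
  obtain i where i: "p f i = N x (Suc j)" "p f (Suc i) = x" "p f (Suc (Suc i)) = N x j"
    using corner_at[OF x] unfolding f_def by blast
  have rev: "\<exists>l. p g l = p f (Suc i) \<and> p g (Suc l) = p f i" for i
  proof -
    have "{p f i, p f (Suc i)} \<in> edges (face_cycle g)"
      unfolding g(3) edges_face_cycle[OF f] by blast
    then obtain l where "{p f i, p f (Suc i)} = {p g l, p g (Suc l)}"
      unfolding edges_face_cycle[OF g(1)] by blast
    moreover have "\<not> (p f i = p g l \<and> p f (Suc i) = p g (Suc l))"
      using same_arc_same_face[OF f g(1)] g(2) bf by blast
    ultimately show ?thesis by (auto simp: doubleton_eq_iff)
  qed
  obtain l where l: "p g l = N x j" "p g (Suc l) = x" using rev[of "Suc i"] i by auto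
  obtain l' where l': "p g l' = x" "p g (Suc l') = N x (Suc j)" using rev[of i] i by auto
  obtain a where a: "c x a = g" "N x a = p g (Suc (Suc l))" "N x (Suc a) = p g l"
    using corner_of[OF g(1), of l] l by auto
  have "p g (Suc (Suc l)) = p g (Suc l')" using p_Suc_cong[OF g(1)] l l' by metis
  then have 1: "a mod d x = Suc j mod d x" using a l' N_eq_iff[OF x] by simp
  have "Suc a mod d x = j mod d x" using a l N_eq_iff[OF x] by simp
  then have "Suc (Suc j) mod d x = j mod d x" using 1 by (metis mod_Suc_eq)
  then show False using d_ge_3[OF x] by (auto simp: mod_Suc split: if_splits)
qed

end

lemma connected_components_of_open_partition:
  assumes op: "\<And>U. U \<in> P \<Longrightarrow> openin X U" and con: "\<And>U. U \<in> P \<Longrightarrow> connectedin X U"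
    and ne: "{} \<notin> P" and un: "\<Union>P = topspace X" and dj: "disjoint P"
  shows "connected_components_of X = P"
proof -
  have comp: "connected_component_of_set X x = U" if U: "U \<in> P" and x: "x \<in> U" for x U
  proof
    show "U \<subseteq> connected_component_of_set X x"
      by (rule connected_component_of_maximal[OF con[OF U] x])
    have sub: "U \<subseteq> topspace X" using op[OF U] openin_subset by blast
    have "topspace X - U = \<Union>(P - {U})"
      using un dj U unfolding disjoint_def by (auto; blast)
    then have "openin X (topspace X - U)"
      using op by (metis DiffD1 openin_Union)
    then have cl: "closedin X U" using sub by (simp add: closedin_def)
    have "connected_component_of_set X x \<subseteq> U \<or> disjnt (connected_component_of_set X x) U"
      by (rule connectedin_clopen_cases[OF connectedin_connected_component_of cl op[OF U]])
    moreover have "x \<in> connected_component_of_set X x"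
      using x sub by (simp add: connected_component_of_refl subset_iff)
    ultimately show "connected_component_of_set X x \<subseteq> U"
      using x by (auto simp: disjnt_def)
  qed
  show ?thesis
  proof (intro equalityI subsetI)
    fix C assume "C \<in> connected_components_of X"
    then obtain x where "x \<in> topspace X" "C = connected_component_of_set X x"
      by (auto simp: connected_components_of_def)
    then show "C \<in> P" using comp un by (metis UnionE)
  next
    fix U assume U: "U \<in> P"
    then obtain x where "x \<in> U" using ne by (metis ex_in_conv)
    then show "U \<in> connected_components_of X"
      using comp[OF U, of x] U un unfolding connected_components_of_def by (intro image_eqI[of _ _ x]) auto
  qed
qed

section \<open>Triangulation by face centres\<close>

context oriented_map begin

definition link_length :: "'a + 'f \<Rightarrow> nat"
  where "link_length = case_sum (\<lambda>x. 2 * d x) (\<lambda>f. k)"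

definition link :: "'a + 'f \<Rightarrow> nat \<Rightarrow> 'a + 'f"
  where "link = case_sum (\<lambda>x j. if even j then Inl (N x (j div 2)) else Inr (c x (j div 2)))
    (\<lambda>f j. Inl (p f j))"

lemma link_simps:
  "link (Inl x) (2 * j) = Inl (N x j)" "link (Inl x) (Suc (2 * j)) = Inr (c x j)"
  "link (Inl x) (Suc (Suc (2 * j))) = Inl (N x (Suc j))"
  "link (Inr f) i = Inl (p f i)" "link_length (Inl x) = 2 * d x" "link_length (Inr f) = k"
  by (simp_all add: link_def link_length_def)

lemma link_mod:
  assumes u: "u \<in> Inl ` V \<union> Inr ` F"
  shows "link u (j mod link_length u) = link u j"
proof (cases u)
  case (Inl x)
  then have x: "x \<in> V" using u by auto
  have "j mod (2 * d x) div 2 = j div 2 mod d x" by (simp add: mod_mult2_eq)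
  moreover have "even (j mod (2 * d x)) \<longleftrightarrow> even j" by (simp add: dvd_mod_iff)
  ultimately show ?thesis using N_mod[OF x] c_mod[OF x]
    by (simp add: Inl link_def link_length_def)
next
  case (Inr f)
  then show ?thesis using u p_mod by (auto simp: link_def link_length_def)
qed

end

text \<open>A triangle consists of the two ends of an edge and the centre of a face at it;
  \<open>corner_at\<close> and \<open>corner_of\<close> read it from each of its corners, which is
  what \<open>link_rotate\<close> asks. For connectedness the centres are linked to vertices, and
  vertices to centres, in one step.\<close>

sublocale oriented_map \<subseteq> triangulated_surface "Inl ` V \<union> Inr ` F" link_length link
proof
  show "finite (Inl ` V \<union> Inr ` F)" using finite_V finite_F by simp
  show "Inl ` V \<union> Inr ` F \<noteq> {}" using V_nonempty by simp
  fix u :: "'a + 'f" assume u: "u \<in> Inl ` V \<union> Inr ` F"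
  show "3 \<le> link_length u"
    using u k_ge_3 d_ge_3 by (fastforce simp: link_simps)
  show "link u (j mod link_length u) = link u j" for j
    using u by (rule link_mod)
  show "link u j \<in> Inl ` V \<union> Inr ` F" for j
    using u N_in c_in p_in by (auto simp: link_def)
  show "link u j \<noteq> u" for j
    using u N_neq by (auto simp: link_def split: if_splits)
  show "inj_on (link u) {..<link_length u}"
  proof (cases u)
    case (Inl x)
    then have x: "x \<in> V" using u by auto
    show ?thesis
    proof (rule inj_onI)
      fix i j assume ij: "i \<in> {..<link_length u}" "j \<in> {..<link_length u}" "link u i = link u j"
      have "i div 2 < d x" "j div 2 < d x" using ij by (auto simp: Inl link_simps)
      moreover have "even i \<longleftrightarrow> even j" using ij(3) by (auto simp: Inl link_def split: if_splits)
      moreover have "i div 2 mod d x = j div 2 mod d x"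
        using ij(3) N_eq_iff[OF x] c_eq_iff[OF x] by (auto simp: Inl link_def split: if_splits)
      ultimately show "i = j" by (metis dvd_mult_div_cancel mod_less odd_two_times_div_two_succ)
    qed
  next
    case (Inr f)
    then have "f \<in> F" using u by auto
    then show ?thesis using p_inj[of f] by (auto simp: Inr link_def link_length_def inj_on_def)
  qed
  show "\<exists>i. link (link u j) i = link u (Suc j) \<and> link (link u j) (Suc i) = u" for j
  proof (cases u)
    case (Inl x)
    then have x: "x \<in> V" using u by auto
    obtain h where h: "j = 2 * h \<or> j = Suc (2 * h)"
      by (metis evenE oddE Suc_eq_plus1)
    obtain i where i: "p (c x h) i = N x (Suc h)" "p (c x h) (Suc i) = x" "p (c x h) (Suc (Suc i)) = N x h"
      using corner_at[OF x] by blast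
    show ?thesis
    proof (cases "j = 2 * h")
      case True
      obtain a where a: "c (N x h) a = c x h" "N (N x h) (Suc a) = x"
        using corner_of[OF c_in[OF x], of h "Suc i"] i by metis
      show ?thesis unfolding Inl True
        by (rule exI[of _ "Suc (2 * a)"]) (simp add: link_simps a)
    next
      case False
      then have j: "j = Suc (2 * h)" using h by simp
      show ?thesis unfolding Inl j
        by (rule exI[of _ i]) (simp add: link_simps i)
    qed
  next
    case (Inr f)
    then have f: "f \<in> F" using u by auto
    obtain a where a: "c (p f (Suc (j + (k - 1)))) a = f" "N (p f (Suc (j + (k - 1)))) a = p f (Suc (Suc (j + (k - 1))))"
      using corner_of[OF f] by blast
    have "p f (Suc (j + (k - 1))) = p f j" using k_ge_3 f by (simp add: p_eq_iff)
    moreover have "p f (Suc (Suc (j + (k - 1)))) = p f (Suc j)" by (rule p_Suc_cong[OF f calculation])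
    ultimately show ?thesis unfolding Inr
      using a by (intro exI[of _ "2 * a"]) (simp add: link_simps)
  qed
  let ?R = "{(x, link x j) |x j. x \<in> Inl ` V \<union> Inr ` F}"
  have VV: "(Inl x, Inl y) \<in> ?R\<^sup>*" if "x \<in> V" "y \<in> V" for x y
  proof -
    have "(x, y) \<in> {(z, N z j) |z j. z \<in> V}\<^sup>*" using that by (rule N_connected)
    then show ?thesis
    proof induction
      case (step y z)
      then obtain j where "y \<in> V" "z = N y j" by blast
      then have "(Inl y, Inl z) \<in> ?R"
        by (intro CollectI exI[of _ "Inl y"] exI[of _ "2 * j"]) (auto simp: link_simps)
      with step.IH show ?case by (rule rtrancl_into_rtrancl)
    qed simp
  qed
  fix v :: "'a + 'f" assume v: "v \<in> Inl ` V \<union> Inr ` F"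
  have 1: "\<exists>x\<in>V. (u, Inl x) \<in> ?R\<^sup>*"
  proof (cases u)
    case (Inl x)
    then show ?thesis using u by auto
  next
    case (Inr f)
    then have "(u, Inl (p f 0)) \<in> ?R"
      using u by (intro CollectI exI[of _ u] exI[of _ 0]) (auto simp: link_simps)
    moreover have "p f 0 \<in> V" using Inr u p_in by auto
    ultimately show ?thesis by blast
  qed
  have 2: "\<exists>x\<in>V. (Inl x, v) \<in> ?R\<^sup>*"
  proof (cases v)
    case (Inl x)
    then show ?thesis using v by auto
  next
    case (Inr f)
    then have f: "f \<in> F" using v by auto
    obtain j where j: "c (p f (Suc 0)) j = f" using corner_of[OF f] by blast
    have "(Inl (p f (Suc 0)), v) \<in> ?R"
      using p_in[OF f] j
      by (intro CollectI exI[of _ "Inl (p f (Suc 0))"] exI[of _ "Suc (2 * j)"]) (auto simp: link_simps Inr)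
    then show ?thesis using p_in[OF f] by blast
  qed
  from 1 2 VV show "(u, v) \<in> ?R\<^sup>*" by (meson rtrancl_trans)
qed

context oriented_map begin

text \<open>Graph and surface share barycentric coordinates: the graph becomes the part of the
  surface with weight 0 at every face centre.\<close>

definition drawing :: "('a \<Rightarrow> real) \<Rightarrow> 'a + 'f \<Rightarrow> real"
  where "drawing a = case_sum a (\<lambda>_. 0)"

lemma drawing_simps [simp]: "drawing a (Inl x) = a x" "drawing a (Inr f) = 0"
  by (simp_all add: drawing_def)

lemma triangle_face: "triangle (Inr f) i = {Inr f, Inl (p f i), Inl (p f (Suc i))}"
  by (simp add: triangle_def link_simps)

lemma closed_star_face:
  "b \<in> closed_star (Inr f) \<longleftrightarrow> (\<forall>x. 0 \<le> b x) \<and>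
    (\<exists>i. (\<forall>x. x \<notin> {Inr f, Inl (p f i), Inl (p f (Suc i))} \<longrightarrow> b x = 0) \<and>
      sum b {Inr f, Inl (p f i), Inl (p f (Suc i))} = 1)"
  by (simp add: closed_star_def triangle_face)

lemma realization_face_cycle:
  assumes f: "f \<in> F"
  shows "a \<in> realization (face_cycle f) \<longleftrightarrow> (\<forall>x. 0 \<le> a x) \<and>
    (\<exists>i. (\<forall>x. x \<notin> {p f i, p f (Suc i)} \<longrightarrow> a x = 0) \<and> a (p f i) + a (p f (Suc i)) = 1)"
    (is "_ \<longleftrightarrow> ?R")
proof
  assume "a \<in> realization (face_cycle f)"
  then obtain s where a: "\<forall>x. 0 \<le> a x" and s: "s \<in> simplices (face_cycle f)"
    "\<forall>x. x \<notin> s \<longrightarrow> a x = 0" "sum a s = 1"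
    unfolding realization_def by blast
  from s(1) consider i where "s = {p f i}" | i where "s = {p f i, p f (Suc i)}"
    unfolding simplices_def verts_face_cycle[OF f] edges_face_cycle[OF f] by blast
  then have "\<exists>i. (\<forall>x. x \<notin> {p f i, p f (Suc i)} \<longrightarrow> a x = 0) \<and> a (p f i) + a (p f (Suc i)) = 1"
  proof cases
    case (1 i)
    then show ?thesis using s p_Suc_neq[OF f, of i] by (intro exI[of _ i]) auto
  next
    case (2 i)
    then show ?thesis using s p_Suc_neq[OF f, of i] by (intro exI[of _ i]) auto
  qed
  with a show ?R by blast
next
  assume ?R
  then obtain i where i: "\<forall>x. x \<notin> {p f i, p f (Suc i)} \<longrightarrow> a x = 0" "a (p f i) + a (p f (Suc i)) = 1"
    and a: "\<forall>x. 0 \<le> a x" by blast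
  have "{p f i, p f (Suc i)} \<in> simplices (face_cycle f)"
    unfolding simplices_def edges_face_cycle[OF f] by blast
  moreover have "sum a {p f i, p f (Suc i)} = 1"
    using i(2) p_Suc_neq[OF f, of i, symmetric] by simp
  ultimately show "a \<in> realization (face_cycle f)"
    unfolding realization_def using a i(1) by blast
qed

lemma drawing_face_cycle:
  assumes f: "f \<in> F"
  shows "drawing ` realization (face_cycle f) = {b \<in> closed_star (Inr f). b (Inr f) = 0}"
proof (intro equalityI subsetI)
  fix b assume "b \<in> drawing ` realization (face_cycle f)"
  then obtain a where b: "b = drawing a" and "a \<in> realization (face_cycle f)" by blast
  then obtain i where a: "\<forall>x. 0 \<le> a x"
    and i: "\<forall>x. x \<notin> {p f i, p f (Suc i)} \<longrightarrow> a x = 0" "a (p f i) + a (p f (Suc i)) = 1"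
    using realization_face_cycle[OF f, of a] by blast
  have "0 \<le> b x" for x using a by (cases x) (simp_all add: b)
  moreover have "b x = 0" if "x \<notin> {Inr f, Inl (p f i), Inl (p f (Suc i))}" for x
    using that i(1) by (cases x) (simp_all add: b)
  moreover have "sum b {Inr f, Inl (p f i), Inl (p f (Suc i))} = 1"
    using i(2) p_Suc_neq[OF f, of i, symmetric] by (simp add: b)
  moreover have "b (Inr f) = 0" by (simp add: b)
  ultimately show "b \<in> {b \<in> closed_star (Inr f). b (Inr f) = 0}"
    unfolding mem_Collect_eq closed_star_face by (intro conjI allI impI exI[of _ i]) assumption+
next
  fix b assume "b \<in> {b \<in> closed_star (Inr f). b (Inr f) = 0}"
  then have "b \<in> closed_star (Inr f)" and 0: "b (Inr f) = 0" by auto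
  then obtain i where b: "\<forall>x. 0 \<le> b x" and i: "\<forall>x. x \<notin> {Inr f, Inl (p f i), Inl (p f (Suc i))} \<longrightarrow> b x = 0"
    "sum b {Inr f, Inl (p f i), Inl (p f (Suc i))} = 1"
    using closed_star_face[of b f] by blast
  have "b (Inr g) = 0" for g using i(1) 0 by (cases "g = f") auto
  then have "b = drawing (b \<circ> Inl)" by (auto simp: fun_eq_iff drawing_def split: sum.split)
  moreover have "b \<circ> Inl \<in> realization (face_cycle f)"
    unfolding realization_face_cycle[OF f]
    using b i 0 p_Suc_neq[OF f, of i, symmetric] by (intro conjI exI[of _ i]) auto
  ultimately show "b \<in> drawing ` realization (face_cycle f)" by (rule image_eqI)
qed

lemma realization_map_graph: "realization map_graph_of = (\<Union>f\<in>F. realization (face_cycle f))"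
proof (intro equalityI UN_least)
  show "realization (face_cycle f) \<subseteq> realization map_graph_of" if "f \<in> F" for f
    using subgraph_face_cycle[OF that] unfolding subgraph_def
    by (intro realization_mono simplices_mono) auto
  have "\<exists>f\<in>F. s \<in> simplices (face_cycle f)" if s: "s \<in> simplices map_graph_of" for s
  proof -
    from s consider x where "x \<in> V" "s = {x}" | x j where "x \<in> V" "s = {x, N x j}"
      by (auto simp: simplices_def map_graph_of_def)
    then show ?thesis
    proof cases
      case (1 x)
      obtain i where "p (c x 0) (Suc i) = x" using corner_at[OF 1(1)] by blast
      then have "x \<in> verts (face_cycle (c x 0))"
        unfolding verts_face_cycle[OF c_in[OF 1(1)]] by (metis rangeI)
      then show ?thesis using c_in[OF 1(1)] 1(2) by (auto simp: simplices_def)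
    next
      case (2 x j)
      then show ?thesis using face_with_arc[OF 2(1), of True j] unfolding simplices_def by blast
    qed
  qed
  then show "realization map_graph_of \<subseteq> (\<Union>f\<in>F. realization (face_cycle f))"
    unfolding realization_def by blast
qed

text \<open>Every triangle has a face centre among its corners and can be based there.\<close>

lemma points_eq_face_stars: "points = (\<Union>f\<in>F. closed_star (Inr f))"
proof (intro equalityI subsetI)
  fix a assume "a \<in> points"
  then obtain u j where u: "u \<in> Inl ` V \<union> Inr ` F" and a: "\<forall>x. 0 \<le> a x"
    "\<forall>x. x \<notin> triangle u j \<longrightarrow> a x = 0" "sum a (triangle u j) = 1"
    unfolding points_def closed_star_def by blast
  have "\<exists>f\<in>F. Inr f \<in> triangle u j"
  proof (cases u)
    case (Inl x)
    obtain h where h: "j = 2 * h \<or> j = Suc (2 * h)" by (metis evenE oddE Suc_eq_plus1)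
    then have "Inr (c x h) \<in> triangle u j"
      by (auto simp: Inl triangle_def link_simps)
    then show ?thesis using u Inl c_in by blast
  next
    case (Inr f)
    then show ?thesis using u by (auto simp: triangle_def)
  qed
  then obtain f where f: "f \<in> F" "Inr f \<in> triangle u j" by blast
  obtain i where i: "triangle (Inr f) i = triangle u j"
    using triangle_rebase[OF u f(2)] by blast
  have "a \<in> closed_star (Inr f)"
    unfolding closed_star_def by (intro CollectI conjI exI[of _ i]) (use a i in simp_all)
  with f show "a \<in> (\<Union>f\<in>F. closed_star (Inr f))" by blast
qed (auto simp: points_def)

lemma closed_star_other_face:
  "b \<in> closed_star (Inr f) \<Longrightarrow> g \<noteq> f \<Longrightarrow> b (Inr g) = 0"
  unfolding closed_star_face by auto

lemma drawing_complement: "points - drawing ` realization map_graph_of = (\<Union>f\<in>F. star (Inr f))"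
proof -
  have d: "drawing ` realization map_graph_of = (\<Union>f\<in>F. {b \<in> closed_star (Inr f). b (Inr f) = 0})"
    unfolding realization_map_graph image_UN using drawing_face_cycle by simp
  show ?thesis
  proof (intro equalityI subsetI)
    fix b assume b: "b \<in> points - drawing ` realization map_graph_of"
    then obtain f where f: "f \<in> F" "b \<in> closed_star (Inr f)" using points_eq_face_stars by blast
    then have "b (Inr f) \<noteq> 0" using b d by blast
    then have "b (Inr f) > 0" using f by (auto simp: closed_star_face order.order_iff_strict)
    then show "b \<in> (\<Union>f\<in>F. star (Inr f))" using b f by (auto simp: star_def)
  next
    fix b assume "b \<in> (\<Union>f\<in>F. star (Inr f))"
    then obtain f where f: "f \<in> F" "b \<in> points" "b (Inr f) > 0" by (auto simp: star_def)
    have "b \<notin> closed_star (Inr g) \<or> b (Inr g) \<noteq> 0" for g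
      using closed_star_other_face[of b g f] f(3) by (cases "g = f") auto
    then show "b \<in> points - drawing ` realization map_graph_of" using f(2) d by blast
  qed
qed

lemma star_nonempty: "u \<in> Inl ` V \<union> Inr ` F \<Longrightarrow> star u \<noteq> {}"
  using corner_point_in_star[of u 0 0 0] m_ge_3[of u] by force

lemma connected_star:
  assumes "u \<in> Inl ` V \<union> Inr ` F"
  shows "connected (star u)"
proof -
  have "connected_space (top_of_set (ball (0::complex) 1))"
    by (simp add: connected_space_subtopology)
  then have "connected_space (top_of_set (star u))"
    using homeomorphic_connected_space[OF star_homeomorphic_disc[OF assms]] by simp
  then have "connectedin euclidean (star u)" by (simp add: connectedin_def)
  then show ?thesis by simp
qed

lemma star_faces_disjoint:
  assumes "a \<in> star (Inr f)" "a \<in> star (Inr g)"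
  shows "f = g"
proof (rule ccontr)
  assume "f \<noteq> g"
  moreover have "a \<in> closed_star (Inr g)" using assms star_subset(2) by blast
  ultimately have "a (Inr f) = 0" by (intro closed_star_other_face)
  with assms show False by (simp add: star_def)
qed

text \<open>By \<open>drawing_complement\<close> these stars cover what the graph leaves; being
  open, connected and pairwise disjoint, they are the components.\<close>

lemma faces_drawing: "faces map_graph_of (top_of_set points) drawing = (\<lambda>f. star (Inr f)) ` F"
proof -
  let ?Q = "\<Union>f\<in>F. star (Inr f)"
  have Q: "?Q \<subseteq> points" using star_subset(1) by blast
  have "connected_components_of (top_of_set ?Q) = (\<lambda>f. star (Inr f)) ` F"
  proof (rule connected_components_of_open_partition)
    fix U assume "U \<in> (\<lambda>f. star (Inr f)) ` F"
    then obtain f where f: "f \<in> F" "U = star (Inr f)" by blast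
    show "openin (top_of_set ?Q) U"
      by (rule openin_subset_trans[OF openin_star[of "Inr f", folded f(2)] _ Q]) (use f in blast)
    show "connectedin (top_of_set ?Q) U"
      using connected_star f by (auto simp: connectedin_subtopology)
  next
    show "{} \<notin> (\<lambda>f. star (Inr f)) ` F" using star_nonempty by blast
    show "disjoint ((\<lambda>f. star (Inr f)) ` F)"
      unfolding disjoint_def using star_faces_disjoint by blast
  qed simp
  moreover have "subtopology (top_of_set points) (topspace (top_of_set points) - drawing ` realization map_graph_of)
     = top_of_set ?Q"
    using Q by (simp add: drawing_complement subtopology_subtopology inf.absorb2)
  ultimately show ?thesis by (simp add: faces_def)
qed

lemma frontier_star_face:
  "f \<in> F \<Longrightarrow> top_of_set points frontier_of star (Inr f) = drawing ` realization (face_cycle f)"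
  using frontier_of_star[of "Inr f"] drawing_face_cycle by auto

lemma drawing_subset_points: "drawing ` realization map_graph_of \<subseteq> points"
  unfolding realization_map_graph points_eq_face_stars image_UN using drawing_face_cycle by blast

lemma embedding_drawing: "embedding map_graph_of (top_of_set points) drawing"
  unfolding embedding_def
proof
  have "continuous_on A drawing" for A
  proof (rule continuous_on_coordinatewise_then_product)
    fix u :: "'a + 'f"
    show "continuous_on A (\<lambda>a. drawing a u)"
    proof (cases u)
      case (Inl x)
      then show ?thesis
        using continuous_on_product_then_coordinatewise[OF continuous_on_id] by auto
    qed simp
  qed
  then show "continuous_map (top_of_set (realization map_graph_of)) (top_of_set points) drawing"
    using drawing_subset_points by (auto simp: continuous_map_in_subtopology)
  show "inj_on drawing (realization map_graph_of)"
    by (rule inj_onI) (metis drawing_simps(1) ext)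
qed

lemma edge_in_closed_face_star:
  assumes f: "f \<in> F" and e: "e \<in> edges map_graph_of"
    and sub: "drawing ` realization (e, {e}) \<subseteq> closed_star (Inr f)"
  shows "e \<in> edges (face_cycle f)"
proof -
  obtain x y where xy: "e = {x, y}" "x \<noteq> y"
    using e N_neq by (auto simp: map_graph_of_def)
  \<comment> \<open>The midpoint of the edge has both ends in its support, which forces them to be
    consecutive on the boundary of the face.\<close>
  define a where "a z = (if z \<in> {x, y} then 1 / 2 else 0 :: real)" for z
  have "a \<in> realization (e, {e})"
    unfolding realization_def simplices_def
    using xy by (intro CollectI conjI bexI[of _ e]) (auto simp: a_def)
  then have "drawing a \<in> closed_star (Inr f)" using sub by blast
  then obtain i where i: "\<forall>u. u \<notin> {Inr f, Inl (p f i), Inl (p f (Suc i))} \<longrightarrow> drawing a u = 0"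
    unfolding closed_star_face by blast
  have "z \<in> {p f i, p f (Suc i)}" if "z \<in> {x, y}" for z
    using i[rule_format, of "Inl z"] that by (auto simp: a_def)
  then have "e = {p f i, p f (Suc i)}" using xy by blast
  then show ?thesis unfolding edges_face_cycle[OF f] by blast
qed

theorem biembedding_drawing:
  "biembedding map_graph_of (face_cycle ` {f \<in> F. black f}) (face_cycle ` {f \<in> F. \<not> black f})
     (top_of_set points) drawing"
proof -
  let ?X = "top_of_set points"
  define col where "col S \<longleftrightarrow> (\<exists>f\<in>F. S = star (Inr f) \<and> black f)" for S
  have star_inj: "f = g" if "f \<in> F" "star (Inr f) = star (Inr g)" for f g
    using that star_nonempty[of "Inr f"] star_faces_disjoint by blast
  have col: "col (star (Inr f)) \<longleftrightarrow> black f" if "f \<in> F" for f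
    unfolding col_def using that star_inj by blast
  have "proper_face_coloring map_graph_of ?X drawing col"
    unfolding proper_face_coloring_def faces_drawing
  proof (intro ballI impI)
    fix S T assume "S \<in> (\<lambda>f. star (Inr f)) ` F" "T \<in> (\<lambda>f. star (Inr f)) ` F"
      and *: "S \<noteq> T \<and> face_share_edge map_graph_of ?X drawing S T"
    then obtain f g where f: "f \<in> F" "S = star (Inr f)" and g: "g \<in> F" "T = star (Inr g)" by blast
    obtain e where e: "e \<in> edges map_graph_of"
      "drawing ` realization (e, {e}) \<subseteq> ?X frontier_of S \<inter> ?X frontier_of T"
      using * unfolding face_share_edge_def by blast
    have "?X frontier_of S \<subseteq> closed_star (Inr f)" "?X frontier_of T \<subseteq> closed_star (Inr g)"
      using f g frontier_star_face drawing_face_cycle by auto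
    then have "e \<in> edges (face_cycle f)" "e \<in> edges (face_cycle g)"
      using e edge_in_closed_face_star f g by blast+
    then show "col S \<noteq> col T"
      using common_edge_same_color[OF f(1) g(1)] * f g col by blast
  qed
  moreover have "(\<lambda>S. ?X frontier_of S) ` {S \<in> faces map_graph_of ?X drawing. P (col S)} =
    (\<lambda>C. drawing ` realization C) ` face_cycle ` {f \<in> F. P (black f)}" for P
  proof -
    have "{S \<in> faces map_graph_of ?X drawing. P (col S)} = (\<lambda>f. star (Inr f)) ` {f \<in> F. P (black f)}"
      unfolding faces_drawing using col by auto
    then show ?thesis using frontier_star_face by (auto simp: image_image intro!: image_cong)
  qed
  from this[of "\<lambda>b. b"] this[of Not]
  have "(\<lambda>S. ?X frontier_of S) ` {S \<in> faces map_graph_of ?X drawing. col S} =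
      (\<lambda>C. drawing ` realization C) ` face_cycle ` {f \<in> F. black f}"
    "(\<lambda>S. ?X frontier_of S) ` {S \<in> faces map_graph_of ?X drawing. \<not> col S} =
      (\<lambda>C. drawing ` realization C) ` face_cycle ` {f \<in> F. \<not> black f}" by simp_all
  ultimately show ?thesis
    unfolding biembedding_def using embedding_drawing by blast
qed

lemma cellular_drawing: "cellular map_graph_of (top_of_set points) drawing"
  unfolding cellular_def faces_drawing
proof
  fix S assume "S \<in> (\<lambda>f. star (Inr f)) ` F"
  then obtain f where f: "f \<in> F" "S = star (Inr f)" by blast
  then have "subtopology (top_of_set points) S = top_of_set S"
    using star_subset(1)[of "Inr f"] by (simp add: subtopology_subtopology inf.absorb2)
  then show "subtopology (top_of_set points) S homeomorphic_space top_of_set (ball (0::complex) 1)"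
    using star_homeomorphic_disc[of "Inr f"] f by simp
qed

theorem ex_surface_biembedding:
  "\<exists>(X :: (nat \<times> complex) topology) \<psi>. surface X \<and> orientable X \<and>
    biembedding map_graph_of (face_cycle ` {f \<in> F. black f}) (face_cycle ` {f \<in> F. \<not> black f}) X \<psi> \<and>
    cellular map_graph_of X \<psi>"
proof -
  have "inj_on code_point (topspace (top_of_set points))"
    using inj_on_code_point by simp
  then obtain X :: "(nat \<times> complex) topology"
    where hom: "homeomorphic_map (top_of_set points) X code_point"
    by (rule ex_homeomorphic_map_image)
  have "e \<subseteq> verts map_graph_of" if "e \<in> edges map_graph_of" for e
    using that N_in by (auto simp: map_graph_of_def)
  from biembedding_homeomorphic[OF hom this biembedding_drawing]
  have "biembedding map_graph_of (face_cycle ` {f \<in> F. black f}) (face_cycle ` {f \<in> F. \<not> black f})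
    X (code_point \<circ> drawing)" .
  moreover have "cellular map_graph_of X (code_point \<circ> drawing)"
    using cellular_homeomorphic[OF hom _ cellular_drawing] drawing_subset_points by simp
  moreover have "surface X" "orientable X"
    using surface_homeomorphic[OF hom surface_points] orientable_homeomorphic[OF hom orientable_points] .
  ultimately show ?thesis by blast
qed

end

section \<open>Maps invariant under translations\<close>

text \<open>The parts are the residue classes modulo \<open>q = v / t\<close>, so the residue has to
  be the first component; the quotient numbers the members of a class.\<close>

definition vertex_of_int :: "nat \<Rightarrow> nat \<Rightarrow> int \<Rightarrow> nat \<times> nat"
  where "vertex_of_int q t z = (nat (z mod int q), nat (z mod int (q * t) div int q))"

definition int_of_vertex :: "nat \<Rightarrow> nat \<times> nat \<Rightarrow> int"
  where "int_of_vertex q x = int (fst x) + int q * int (snd x)"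

text \<open>The face through the corner between the differences \<open>s (j + 1)\<close> and \<open>s j\<close> arrives with step
  \<open>- s (j + 1)\<close> and leaves with step \<open>s j\<close>. This corner is number \<open>pos j\<close> of a translate of the
  closed walk with steps \<open>st (ty j)\<close>.\<close>

locale cyclic_map =
  fixes q t k m :: nat and T :: "'t::countable set" and st :: "'t \<Rightarrow> nat \<Rightarrow> int"
    and s :: "nat \<Rightarrow> int" and ty :: "nat \<Rightarrow> 't" and pos :: "nat \<Rightarrow> nat" and blk :: "'t \<Rightarrow> bool"
  assumes q_ge_2: "2 \<le> q" and t_pos: "0 < t" and k_ge_3: "3 \<le> k" and m_ge_3: "3 \<le> m"
    and finite_T: "finite T"
    and s_mod: "s (j mod m) = s j"
    and s_inj: "i < m \<Longrightarrow> j < m \<Longrightarrow> [s i = s j] (mod int (q * t)) \<Longrightarrow> i = j"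
    and s_range: "(\<exists>j. [s j = z] (mod int (q * t))) \<longleftrightarrow> \<not> int q dvd z"
    and st_mod: "\<tau> \<in> T \<Longrightarrow> st \<tau> (i mod k) = st \<tau> i"
    and st_sum: "\<tau> \<in> T \<Longrightarrow> int (q * t) dvd (\<Sum>i<k. st \<tau> i)"
    and st_simple: "\<tau> \<in> T \<Longrightarrow> i < j \<Longrightarrow> j < k \<Longrightarrow> \<not> int (q * t) dvd (\<Sum>l\<in>{i..<j}. st \<tau> l)"
    and ty_in: "ty j \<in> T" and ty_mod: "ty (j mod m) = ty j" and pos_mod: "pos (j mod m) = pos j"
    and corner_in: "s (Suc j) = - st (ty j) (pos j)"
    and corner_out: "s j = st (ty j) (Suc (pos j))"
    and corner_ex: "\<tau> \<in> T \<Longrightarrow> i < k \<Longrightarrow> \<exists>j. ty j = \<tau> \<and> pos j = i"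
    and blk_alternates: "blk (ty (Suc j)) \<longleftrightarrow> \<not> blk (ty j)"
begin

abbreviation v :: int
  where "v \<equiv> int (q * t)"

abbreviation vertex :: "int \<Rightarrow> nat \<times> nat"
  where "vertex \<equiv> vertex_of_int q t"

abbreviation index :: "nat \<times> nat \<Rightarrow> int"
  where "index \<equiv> int_of_vertex q"

definition V :: "(nat \<times> nat) set"
  where "V = {..<q} \<times> {..<t}"

definition nbr :: "nat \<times> nat \<Rightarrow> nat \<Rightarrow> nat \<times> nat"
  where "nbr x j = vertex (index x + s j)"

definition F :: "('t \<times> int) set"
  where "F = T \<times> {0..<v}"

definition walk :: "'t \<times> int \<Rightarrow> nat \<Rightarrow> nat \<times> nat"
  where "walk f i = vertex (snd f + (\<Sum>l<i. st (fst f) l))"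

text \<open>The base point is chosen so that the walk stands at \<open>x\<close> after
  \<open>Suc (pos j)\<close> steps; reduction modulo \<open>v\<close> gives each translate one
  name.\<close>

definition corner :: "nat \<times> nat \<Rightarrow> nat \<Rightarrow> 't \<times> int"
  where "corner x j = (ty j, (index x - (\<Sum>l<Suc (pos j). st (ty j) l)) mod v)"

section \<open>Vertices as residues modulo v\<close>

lemma v_pos: "0 < v" using q_ge_2 t_pos by simp

lemma mod_mod_v: "z mod v mod int q = z mod int q"
  by (rule mod_mod_cancel) simp

lemma index_vertex: "index (vertex z) = z mod v"
proof -
  have "z mod v = z mod int q + int q * (z mod v div int q)"
    using mod_mult_div_eq[of "z mod v" "int q"] by (simp only: mod_mod_v)
  moreover have "0 \<le> z mod int q" "0 \<le> z mod v div int q"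
    using v_pos q_ge_2 by (simp_all add: pos_imp_zdiv_nonneg_iff del: of_nat_mult)
  ultimately show ?thesis by (simp add: int_of_vertex_def vertex_of_int_def)
qed

lemma vertex_cong: "[y = z] (mod v) \<Longrightarrow> vertex y = vertex z"
proof -
  assume "[y = z] (mod v)"
  then have "y mod v = z mod v" by (simp add: cong_def)
  moreover from this have "y mod int q = z mod int q"
    by (metis mod_mod_v)
  ultimately show ?thesis by (simp add: vertex_of_int_def)
qed

lemma vertex_eq_iff: "vertex y = vertex z \<longleftrightarrow> [y = z] (mod v)"
proof
  assume "vertex y = vertex z"
  then show "[y = z] (mod v)" using index_vertex[of y] index_vertex[of z] unfolding cong_def by metis
qed (rule vertex_cong)

lemma vertex_in: "vertex z \<in> V"
proof -
  have z: "z mod v < v" "0 \<le> z mod v" using v_pos by simp_all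
  have "int q * (z mod v div int q) = z mod v - z mod v mod int q"
    by (rule minus_mod_eq_mult_div[symmetric])
  moreover have "0 \<le> z mod v mod int q" using q_ge_2 by simp
  ultimately have "int q * (z mod v div int q) < int q * int t"
    using z(1) unfolding of_nat_mult by linarith
  then have "z mod v div int q < int t" using q_ge_2 by simp
  then show ?thesis
    using q_ge_2 t_pos by (auto simp: V_def vertex_of_int_def nat_less_iff)
qed

lemma vertex_index: "x \<in> V \<Longrightarrow> vertex (index x) = x"
proof -
  assume "x \<in> V"
  then obtain a b where x: "x = (a, b)" "a < q" "b < t" by (auto simp: V_def)
  have "a + q * b < q * t"
  proof -
    have "a + q * b < q * Suc b" using x by simp
    also have "\<dots> \<le> q * t" using x by (intro mult_le_mono2) simp
    finally show ?thesis .
  qed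
  then have "(int a + int q * int b) mod v = int a + int q * int b"
    by (intro mod_pos_pos_trivial) (auto simp flip: of_nat_mult of_nat_add)
  then show ?thesis using x q_ge_2
    by (simp add: vertex_of_int_def int_of_vertex_def del: of_nat_mult)
qed

lemma cong_index_vertex: "[index (vertex z) = z] (mod v)"
  by (simp add: index_vertex cong_def del: of_nat_mult)

lemma sum_st_mod:
  assumes "\<tau> \<in> T"
  shows "[(\<Sum>l<i. st \<tau> l) = (\<Sum>l<i mod k. st \<tau> l)] (mod v)"
proof -
  have st_add: "st \<tau> (l + k * a) = st \<tau> l" for l a
    using st_mod[OF assms, of "l + k * a"] st_mod[OF assms, of l] by simp
  have split: "(\<Sum>l<a + b. st \<tau> l) = (\<Sum>l<a. st \<tau> l) + (\<Sum>l<b. st \<tau> (l + a))" for a b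
    by (induction b) (simp_all add: add_ac)
  have "[(\<Sum>l<k * a + b. st \<tau> l) = (\<Sum>l<b. st \<tau> l)] (mod v)" for a b
  proof (induction a)
    case (Suc a)
    have "(\<Sum>l<k + (k * a + b). st \<tau> l) = (\<Sum>l<k. st \<tau> l) + (\<Sum>l<k * a + b. st \<tau> (l + k))"
      by (rule split)
    also have "(\<Sum>l<k * a + b. st \<tau> (l + k)) = (\<Sum>l<k * a + b. st \<tau> l)"
      using st_add[of _ 1] by simp
    finally have "(\<Sum>l<k * Suc a + b. st \<tau> l) = (\<Sum>l<k. st \<tau> l) + (\<Sum>l<k * a + b. st \<tau> l)"
      by (simp add: add_ac)
    moreover have "[(\<Sum>l<k. st \<tau> l) = 0] (mod v)"
      using st_sum[OF assms] by (simp add: cong_0_iff)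
    ultimately show ?case using cong_add[of _ 0 v, OF _ Suc.IH] by simp
  qed simp
  from this[of "i div k" "i mod k"] show ?thesis by (simp only: mult_div_mod_eq)
qed

lemma walk_mod: "f \<in> F \<Longrightarrow> walk f (i mod k) = walk f i"
  unfolding walk_def vertex_eq_iff cong_add_lcancel F_def
  by (rule cong_sym, rule sum_st_mod) auto

text \<open>Two visits to one vertex would make a consecutive sum of steps vanish modulo
  \<open>v\<close>, against \<open>st_simple\<close>.\<close>

lemma inj_on_walk: "f \<in> F \<Longrightarrow> inj_on (walk f) {..<k}"
proof (rule linorder_inj_onI')
  fix i j assume f: "f \<in> F" and ij: "i \<in> {..<k}" "j \<in> {..<k}" "i < j"
  have T: "fst f \<in> T" using f by (auto simp: F_def)
  have "(\<Sum>l<j. st (fst f) l) = (\<Sum>l<i. st (fst f) l) + (\<Sum>l\<in>{i..<j}. st (fst f) l)"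
    using ij by (simp add: lessThan_atLeast0 sum.atLeastLessThan_concat)
  then show "walk f i \<noteq> walk f j"
    unfolding walk_def vertex_eq_iff using st_simple[OF T ij(3)] ij(2)
    by (simp add: cong_iff_dvd_diff)
qed

lemma index_in_F: "\<tau> \<in> T \<Longrightarrow> (\<tau>, z mod v) \<in> F"
  using v_pos by (simp add: F_def del: of_nat_mult)

lemma nbr_ex:
  assumes "x \<in> V" "y \<in> V" "\<not> int q dvd index y - index x"
  shows "\<exists>j. nbr x j = y"
proof -
  obtain j where "[s j = index y - index x] (mod v)" using assms s_range by blast
  then have "[index x + s j = index x + (index y - index x)] (mod v)"
    by (intro cong_add cong_refl)
  then have "nbr x j = vertex (index y)" unfolding nbr_def by (simp add: vertex_eq_iff del: of_nat_mult)
  then show ?thesis using assms vertex_index by auto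
qed

lemma index_nbr_diff:
  shows "\<not> int q dvd index (nbr x j) - index x"
proof
  assume "int q dvd index (nbr x j) - index x"
  moreover have "[index (nbr x j) - index x = index x + s j - index x] (mod v)"
    unfolding nbr_def by (intro cong_diff cong_refl cong_index_vertex)
  then have "[s j = index (nbr x j) - index x] (mod v)" by (simp add: cong_sym del: of_nat_mult)
  ultimately show False using s_range by blast
qed

end

sublocale cyclic_map \<subseteq> oriented_map V "\<lambda>_. m" nbr F k walk corner "\<lambda>f. blk (fst f)"
proof
  show "finite V" "V \<noteq> {}" "finite F" "3 \<le> k" "3 \<le> m"
    using q_ge_2 t_pos k_ge_3 m_ge_3 finite_T by (auto simp: V_def F_def lessThan_empty_iff)
  fix x :: "nat \<times> nat" and j :: nat
  assume x: "x \<in> V"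
  show "nbr x j \<in> V" unfolding nbr_def by (rule vertex_in)
  show "nbr x j \<noteq> x" using index_nbr_diff[of x j] by auto
  show "nbr x (j mod m) = nbr x j" by (simp add: nbr_def s_mod)
  show "inj_on (nbr x) {..<m}"
    by (rule inj_onI) (auto simp: nbr_def vertex_eq_iff cong_add_lcancel intro: s_inj simp del: of_nat_mult)
  show "corner x j \<in> F" unfolding corner_def by (intro index_in_F ty_in)
  show "corner x (j mod m) = corner x j" by (simp add: corner_def ty_mod pos_mod)
  show "blk (fst (corner x (Suc j))) \<longleftrightarrow> \<not> blk (fst (corner x j))"
    by (simp add: corner_def blk_alternates)
  let ?S = "\<lambda>i. \<Sum>l<i. st (ty j) l"
  have w: "walk (corner x j) i = vertex (index x + (?S i - ?S (Suc (pos j))))" for i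
  proof -
    have "[(index x - ?S (Suc (pos j))) mod v + ?S i = index x - ?S (Suc (pos j)) + ?S i] (mod v)"
      by (intro cong_add cong_refl) (simp add: cong_def del: of_nat_mult)
    then show ?thesis unfolding walk_def corner_def vertex_eq_iff by (simp add: algebra_simps del: of_nat_mult)
  qed
  show "\<exists>i. walk (corner x j) i = nbr x (Suc j) \<and> walk (corner x j) (Suc i) = x \<and>
      walk (corner x j) (Suc (Suc i)) = nbr x j"
    by (rule exI[of _ "pos j"]) (simp add: w nbr_def vertex_index[OF x] corner_in corner_out[symmetric])
next
  fix f :: "'t \<times> int" and i :: nat
  assume f: "f \<in> F"
  show "walk f i \<in> V" unfolding walk_def by (rule vertex_in)
  show "walk f (i mod k) = walk f i" using f by (rule walk_mod)
  show "inj_on (walk f) {..<k}" using f by (rule inj_on_walk)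
  obtain \<tau> y where fy: "f = (\<tau>, y)" and T: "\<tau> \<in> T" and y: "y mod v = y"
    using f by (auto simp: F_def)
  let ?S = "\<lambda>i. \<Sum>l<i. st \<tau> l"
  have "i mod k < k" using k_ge_3 by simp
  \<comment> \<open>The corner number depends on type and position only; that the translate through
    \<open>x\<close> is \<open>f\<close> itself is then a comparison of base points.\<close>
  from corner_ex[OF T this] obtain j where j: "ty j = \<tau>" "pos j = i mod k" by blast
  define x where "x = walk f (Suc i)"
  have ix: "[index x = y + ?S (Suc i)] (mod v)"
    unfolding x_def walk_def fy by (simp add: cong_index_vertex del: sum.lessThan_Suc of_nat_mult)
  have st: "st \<tau> (i mod k) = st \<tau> i" "st \<tau> (Suc (i mod k)) = st \<tau> (Suc i)"
    using st_mod[OF T] by (metis, metis mod_Suc_eq)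
  have "[index x - ?S (Suc (i mod k)) = y + ?S (Suc i) - ?S (Suc i)] (mod v)"
    using sum_st_mod[OF T, of i]
    by (intro cong_diff ix) (simp add: st cong_sym cong_add_rcancel del: of_nat_mult)
  then have c: "corner x j = f"
    by (simp add: corner_def j fy cong_def y del: of_nat_mult sum.lessThan_Suc)
  have "[index x + s j = (y + ?S (Suc i)) + st \<tau> (Suc i)] (mod v)"
    using corner_out[of j] j st by (intro cong_add ix) simp
  then have "nbr x j = walk f (Suc (Suc i))"
    unfolding nbr_def walk_def fy vertex_eq_iff by (simp add: add_ac del: of_nat_mult)
  moreover have "[index x + s (Suc j) = (y + ?S (Suc i)) - st \<tau> i] (mod v)"
    unfolding diff_conv_add_uminus using corner_in[of j] j st by (intro cong_add ix) simp
  then have "nbr x (Suc j) = walk f i"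
    unfolding nbr_def walk_def fy vertex_eq_iff by (simp del: of_nat_mult)
  ultimately show "\<exists>j. corner (walk f (Suc i)) j = f \<and>
      nbr (walk f (Suc i)) j = walk f (Suc (Suc i)) \<and> nbr (walk f (Suc i)) (Suc j) = walk f i"
    using c unfolding x_def by blast
next
  fix x y assume x: "x \<in> V" and y: "y \<in> V"
  let ?R = "{(z, nbr z j) |z j. z \<in> V}"
  have step: "(x, y) \<in> ?R" if "x \<in> V" "y \<in> V" "\<not> int q dvd index y - index x" for x y
    using nbr_ex[OF that] that by blast
  show "(x, y) \<in> ?R\<^sup>*"
  proof (cases "int q dvd index y - index x")
    case True
    \<comment> \<open>Vertices of one part are joined through a vertex of another part;
      \<open>index x + 1\<close> is in another part because \<open>q \<ge> 2\<close>.\<close>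
    define z where "z = vertex (index x + 1)"
    have "[index z = index x + 1] (mod v)" unfolding z_def by (rule cong_index_vertex)
    then have "int q dvd index z - (index x + 1)"
      by (auto simp: cong_iff_dvd_diff dest: dvd_mult_left)
    moreover have "\<not> int q dvd 1" using q_ge_2 by auto
    moreover have "index z - index x = (index z - (index x + 1)) + 1"
      "index y - index z = (index y - index x) - (index z - (index x + 1)) - 1" by simp_all
    ultimately have "\<not> int q dvd index z - index x" "\<not> int q dvd index y - index z"
      using True by (metis dvd_add_right_iff, metis dvd_diff_right_iff dvd_diff)
    then show ?thesis
      using step x y vertex_in[of "index x + 1"] z_def by (meson rtrancl.rtrancl_into_rtrancl r_into_rtrancl)
  qed (use step x y in blast)
qed

section \<open>The complete multipartite graph and its translations\<close>

context cyclic_map begin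

lemma map_graph_of_eq: "map_graph_of = complete_multipartite q t"
proof -
  have dvd: "int q dvd index y - index x \<longleftrightarrow> fst x = fst y" if "x \<in> V" "y \<in> V" for x y
  proof -
    have "int q dvd index y - index x \<longleftrightarrow> int q dvd int (fst y) - int (fst x)"
    proof -
      have "index y - index x = (int (fst y) - int (fst x)) + int q * (int (snd y) - int (snd x))"
        by (simp add: int_of_vertex_def algebra_simps)
      then show ?thesis by (metis dvd_add_left_iff dvd_triv_left)
    qed
    also have "\<dots> \<longleftrightarrow> fst x = fst y"
    proof -
      have "fst x < q" "fst y < q" using that by (auto simp: V_def)
      then show ?thesis
        using cong_less_modulus_unique_nat[of "fst y" "fst x" q]
        by (auto simp flip: cong_iff_dvd_diff simp: cong_int_iff)
    qed
    finally show ?thesis .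
  qed
  have "{{x, nbr x j} |x j. x \<in> V} = {{x, y} |x y. x \<in> V \<and> y \<in> V \<and> fst x \<noteq> fst y}"
  proof (intro equalityI subsetI)
    fix e assume "e \<in> {{x, nbr x j} |x j. x \<in> V}"
    then obtain x j where "x \<in> V" "e = {x, nbr x j}" by blast
    moreover have "nbr x j \<in> V" unfolding nbr_def by (rule vertex_in)
    ultimately show "e \<in> {{x, y} |x y. x \<in> V \<and> y \<in> V \<and> fst x \<noteq> fst y}"
      using dvd index_nbr_diff by blast
  next
    fix e assume "e \<in> {{x, y} |x y. x \<in> V \<and> y \<in> V \<and> fst x \<noteq> fst y}"
    then obtain x y where "x \<in> V" "y \<in> V" "fst x \<noteq> fst y" "e = {x, y}" by blast
    then show "e \<in> {{x, nbr x j} |x j. x \<in> V}" using dvd nbr_ex by blast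
  qed
  then show ?thesis
    by (simp only: map_graph_of_def complete_multipartite_def Let_def V_def[symmetric])
qed

text \<open>Restricted to \<open>V\<close> because the elements of \<open>BijGroup V\<close> are
  extensional functions.\<close>

definition translation :: "int \<Rightarrow> nat \<times> nat \<Rightarrow> nat \<times> nat"
  where "translation g = (\<lambda>x\<in>V. vertex (index x + g))"

lemma translation_in: "x \<in> V \<Longrightarrow> translation g x \<in> V"
  by (simp add: translation_def vertex_in)

lemma translation_vertex: "translation g (vertex z) = vertex (z + g)"
  by (simp add: translation_def vertex_in vertex_eq_iff cong_add_rcancel cong_index_vertex del: of_nat_mult)

lemma translation_translation: "x \<in> V \<Longrightarrow> translation g (translation h x) = translation (g + h) x"
  using translation_vertex[of g "index x + h"] by (simp add: translation_def add_ac)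

lemma translation_0: "x \<in> V \<Longrightarrow> translation 0 x = x"
  by (simp add: translation_def vertex_index)

lemma translation_Bij: "translation g \<in> Bij V"
proof -
  have "bij_betw (translation g) V V"
    by (rule bij_betw_byWitness[of _ "translation (- g)"])
      (auto simp: translation_in translation_translation translation_0)
  then show ?thesis by (simp add: Bij_def translation_def)
qed

lemma compose_translation: "compose V (translation g) (translation h) = translation (g + h)"
proof
  fix x
  show "compose V (translation g) (translation h) x = translation (g + h) x"
    by (cases "x \<in> V") (simp add: compose_eq translation_translation, simp add: compose_def translation_def)
qed

lemma mult_translation: "translation g \<otimes>\<^bsub>BijGroup V\<^esub> translation h = translation (g + h)"
  using translation_Bij by (simp add: BijGroup_def compose_translation)

lemma one_translation: "\<one>\<^bsub>BijGroup V\<^esub> = translation 0"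
  using translation_0 by (auto simp: BijGroup_def translation_def fun_eq_iff)

lemma translation_carrier: "translation g \<in> carrier (BijGroup V)"
  using translation_Bij by (simp add: BijGroup_def)

lemma inv_translation: "inv\<^bsub>BijGroup V\<^esub> translation g = translation (- g)"
  by (rule group.inv_equality[OF group_BijGroup])
    (simp_all add: mult_translation one_translation translation_carrier)

lemma int_pow_translation: "translation 1 [^]\<^bsub>BijGroup V\<^esub> (i :: int) = translation i"
proof -
  have nat: "translation 1 [^]\<^bsub>BijGroup V\<^esub> (a :: nat) = translation (int a)" for a
    by (induction a) (simp_all add: one_translation mult_translation add.commute)
  show ?thesis
    by (cases i rule: int_cases2)
      (simp_all add: group.int_pow_neg[OF group_BijGroup] translation_carrier int_pow_int nat inv_translation)
qed

lemma subgroup_translations: "subgroup (range translation) (BijGroup V)"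
  by unfold_locales (use translation_carrier in
      \<open>auto simp: mult_translation one_translation inv_translation\<close>)

lemma cyclic_translations: "cyclic_group (BijGroup V \<lparr>carrier := range translation\<rparr>)"
proof -
  interpret group "BijGroup V\<lparr>carrier := range translation\<rparr>"
    by (rule group.subgroup_imp_group[OF group_BijGroup subgroup_translations])
  have "translation 1 [^]\<^bsub>BijGroup V\<lparr>carrier := range translation\<rparr>\<^esub> (i :: int) = translation i" for i
    using group.int_pow_consistent[OF group_BijGroup subgroup_translations, of "translation 1" i]
    by (simp add: int_pow_translation)
  then have "range (\<lambda>i :: int. translation 1 [^]\<^bsub>BijGroup V\<lparr>carrier := range translation\<rparr>\<^esub> i) = range translation"
    by simp
  then show ?thesis
    unfolding cyclic_group by (intro bexI[of _ "translation 1"]) auto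
qed

lemma sharply_transitive_translations: "sharply_transitive_on (range translation) V"
  unfolding sharply_transitive_on_def
proof (intro ballI ex1I[of "\<lambda>h. h \<in> range translation \<and> h x = y" for x y])
  fix x y assume x: "x \<in> V" and y: "y \<in> V"
  show "translation (index y - index x) \<in> range translation \<and> translation (index y - index x) x = y"
    using x y by (simp add: translation_def vertex_index)
  fix h assume h: "h \<in> range translation \<and> h x = y"
  then obtain g where g: "h = translation g" by blast
  have "vertex (index x + g) = vertex (index y)"
    using h g x y by (simp add: translation_def vertex_index)
  then have "[index x + g = index x + (index y - index x)] (mod v)"
    by (simp add: vertex_eq_iff del: of_nat_mult)
  then have "[g = index y - index x] (mod v)" by (simp only: cong_add_lcancel)
  then show "h = translation (index y - index x)"
    unfolding g translation_def
    by (intro restrict_ext) (simp add: vertex_eq_iff cong_add_lcancel del: of_nat_mult)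
qed

text \<open>Translating a walk moves its base point and keeps its type, hence also its
  colour.\<close>

lemma map_graph_face_cycle:
  assumes "f \<in> F"
  shows "map_graph (translation g) (face_cycle f) = face_cycle (fst f, (snd f + g) mod v)"
proof -
  let ?f = "(fst f, (snd f + g) mod v)"
  have f': "?f \<in> F" using assms by (intro index_in_F) (auto simp: F_def)
  have w: "translation g (walk f i) = walk ?f i" for i
    unfolding walk_def translation_vertex vertex_eq_iff fst_conv snd_conv
    by (rule cong_trans[of _ "(snd f + g) + (\<Sum>l<i. st (fst f) l)"])
      (simp_all add: add_ac cong_def mod_simps del: of_nat_mult)
  have edges: "edges (face_cycle h) = range (\<lambda>i. {walk h i, walk h (Suc i)})" if "h \<in> F" for h
    by (auto simp: edges_face_cycle[OF that])
  have "verts (map_graph (translation g) (face_cycle f)) = verts (face_cycle ?f)"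
    unfolding map_graph_def fst_conv verts_face_cycle[OF assms] verts_face_cycle[OF f'] image_image w ..
  moreover have "edges (map_graph (translation g) (face_cycle f)) = edges (face_cycle ?f)"
    using w by (simp add: map_graph_def edges assms f' image_image del: of_nat_mult)
  ultimately show ?thesis by (intro prod_eqI)
qed

theorem cyclic_face_cycles:
  "cyclic_cycle_decomposition k (complete_multipartite q t)
     (face_cycle ` {f \<in> F. blk (fst f) \<longleftrightarrow> b})" (is "cyclic_cycle_decomposition _ _ ?D")
proof -
  have sub: "map_graph (translation g) ` ?D \<subseteq> ?D" for g
  proof
    fix C assume "C \<in> map_graph (translation g) ` ?D"
    then obtain f where f: "f \<in> F" "blk (fst f) \<longleftrightarrow> b" "C = map_graph (translation g) (face_cycle f)"
      by blast
    then have "C = face_cycle (fst f, (snd f + g) mod v)" by (simp add: map_graph_face_cycle)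
    moreover have "(fst f, (snd f + g) mod v) \<in> F" using f by (intro index_in_F) (auto simp: F_def)
    ultimately show "C \<in> ?D" using f(2) by auto
  qed
  \<comment> \<open>Upgrades the inclusion to equality, as the inclusion holds for
    \<open>- g\<close> as well.\<close>
  have inverse: "map_graph (translation g) (map_graph (translation (- g)) C) = C" if "C \<in> ?D" for C g
  proof -
    obtain f where f: "f \<in> F" "C = face_cycle f" using \<open>C \<in> ?D\<close> by blast
    have "(fst f, (snd f - g) mod v) \<in> F" using f by (intro index_in_F) (auto simp: F_def)
    moreover have "(fst f, ((snd f - g) mod v + g) mod v) = f"
      using f by (cases f) (auto simp: F_def mod_simps simp del: of_nat_mult)
    ultimately show ?thesis using f by (simp add: map_graph_face_cycle del: of_nat_mult)
  qed
  have "map_graph (translation g) ` ?D = ?D" for g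
  proof
    show "?D \<subseteq> map_graph (translation g) ` ?D"
    proof
      fix C assume C: "C \<in> ?D"
      then have "map_graph (translation (- g)) C \<in> ?D" using sub by blast
      then show "C \<in> map_graph (translation g) ` ?D" using inverse[OF C, of g] by force
    qed
  qed (rule sub)
  moreover have "verts (complete_multipartite q t) = V"
    by (simp add: complete_multipartite_def V_def Let_def)
  moreover have "cycle_decomposition k (complete_multipartite q t) ?D"
    using cycle_decomposition_face_cycles[of b] by (simp add: map_graph_of_eq)
  ultimately show ?thesis
    unfolding cyclic_cycle_decomposition_def
    using subgroup_translations cyclic_translations sharply_transitive_translations
    by (intro conjI exI[of _ "range translation"]) auto
qed

theorem ex_cyclic_biembedding:
  "\<exists>D D'. D \<noteq> D' \<and>
    cyclic_cycle_decomposition k (complete_multipartite q t) D \<and>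
    cyclic_cycle_decomposition k (complete_multipartite q t) D' \<and>
    (\<exists>(X :: (nat \<times> complex) topology) \<psi>. surface X \<and> orientable X \<and>
       biembedding (complete_multipartite q t) D D' X \<psi> \<and>
       cellular (complete_multipartite q t) X \<psi>)"
proof -
  obtain X :: "(nat \<times> complex) topology" and \<psi> where X: "surface X" "orientable X"
    "biembedding (complete_multipartite q t) (face_cycle ` {f \<in> F. blk (fst f)})
       (face_cycle ` {f \<in> F. \<not> blk (fst f)}) X \<psi>"
    "cellular (complete_multipartite q t) X \<psi>"
    using ex_surface_biembedding[unfolded map_graph_of_eq] by (elim exE conjE) (rule that)
  show ?thesis
    by (intro exI conjI, rule black_cycles_neq_white_cycles,
        rule cyclic_face_cycles[of True, unfolded simp_thms],
        rule cyclic_face_cycles[of False, unfolded simp_thms], (rule X)+)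
qed

end

section \<open>Diagonal arrays\<close>

text \<open>\<open>col_shift j - row_shift j\<close> is 0 for \<open>j = 0\<close>, 1 for odd and -1
  for the other even \<open>j\<close>. Cyclically consecutive values then differ by 1, 2 or -2,
  which are coprime to odd \<open>n\<close>.\<close>

definition row_shift :: "nat \<Rightarrow> nat"
  where "row_shift j = of_bool (even j \<and> 0 < j)"

definition col_shift :: "nat \<Rightarrow> nat"
  where "col_shift j = of_bool (odd j)"

lemma coprime_minus_2:
  fixes N :: nat
  assumes "odd N" "2 \<le> N"
  shows "coprime (N - 2) N"
proof (rule coprimeI)
  fix d assume d: "d dvd N - 2" "d dvd N"
  then have "d dvd N - (N - 2)" by (rule dvd_diff_nat[rotated])
  then have "d dvd 2" using assms(2) by simp
  moreover have "odd d" using d(2) assms(1) dvd_trans by blast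
  ultimately show "is_unit d" using dvd_imp_le[of d 2] by (cases "d = 2"; cases "d = 0") auto
qed

text \<open>The row \<open>i\<close> consists of the entries \<open>X (i + row_shift j) j\<close> for \<open>j < k\<close>, the column \<open>i\<close>
  of the entries \<open>X (i + col_shift j) j\<close>. In contrast to Heffter arrays, a row and a column
  may have several entries in common. That the entries are distinct up to sign follows from
  \<open>X_range\<close> by counting.\<close>

locale diagonal_array =
  fixes n k q t :: nat and X :: "nat \<Rightarrow> nat \<Rightarrow> int"
  assumes odd_n: "odd n" and n_ge_3: "3 \<le> n" and odd_k: "odd k" and k_ge_3: "3 \<le> k"
    and q_ge_2: "2 \<le> q" and t_pos: "0 < t" and size: "q * t = 2 * n * k + t"
    and X_mod: "X (i mod n) j = X i j"
    and X_range: "\<not> int q dvd z \<Longrightarrow>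
      \<exists>i. \<exists>j<k. [X i j = z] (mod int (q * t)) \<or> [X i j = - z] (mod int (q * t))"
    and X_not_dvd: "j < k \<Longrightarrow> \<not> int q dvd X i j"
    and row_sum: "int (q * t) dvd (\<Sum>j<k. X (i + row_shift j) j)"
    and col_sum: "int (q * t) dvd (\<Sum>j<k. X (i + col_shift j) j)"
    and row_simple: "a < b \<Longrightarrow> b < k \<Longrightarrow> \<not> int (q * t) dvd (\<Sum>j\<in>{a..<b}. X (i + row_shift j) j)"
    and col_simple: "a < b \<Longrightarrow> b < k \<Longrightarrow> \<not> int (q * t) dvd (\<Sum>j\<in>{a..<b}. X (i + col_shift j) j)"
begin

text \<open>Columns are negated because a column face leaves a corner along an odd position of
  \<open>rot\<close>, where negatives of entries stand. Column 0 is the one whose order is reversed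
  relative to the others.\<close>

definition steps :: "bool \<times> nat \<Rightarrow> nat \<Rightarrow> int"
  where "steps \<tau> l = (if fst \<tau> then X (snd \<tau> + row_shift (l mod k)) (l mod k)
     else let h = if snd \<tau> = 0 then l mod k else k - 1 - l mod k in - X (snd \<tau> + col_shift h) h)"

text \<open>The value of \<open>col_shift - row_shift\<close> at \<open>j\<close> minus its value at
  the cyclic predecessor of \<open>j\<close>, modulo \<open>n\<close>.\<close>

definition stride :: "nat \<Rightarrow> nat"
  where "stride j = (if j \<le> 1 then 1 else if odd j then 2 else n - 2)"

definition prev :: "nat \<Rightarrow> nat"
  where "prev j = (if j = 0 then k - 1 else j - 1)"

text \<open>The \<open>u\<close>-th entry in the single cycle on the array is the entry of diagonal \<open>dg u\<close> in column
  \<open>colx u\<close>, and it lies in row \<open>rowx u\<close>. The diagonal stays fixed while the column moves by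
  \<open>stride\<close> until column 0, the one with reversed order, is reached.\<close>

definition dg :: "nat \<Rightarrow> nat"
  where "dg u = (k - 2) * (u div n) mod k"

definition colx :: "nat \<Rightarrow> nat"
  where "colx u = u mod n * stride (dg u) mod n"

definition rowx :: "nat \<Rightarrow> nat"
  where "rowx u = (colx u + col_shift (dg u) + n - row_shift (dg u)) mod n"

definition next_col :: "nat \<Rightarrow> nat"
  where "next_col u = Suc (u mod n) * stride (dg u) mod n"

definition rot :: "nat \<Rightarrow> int"
  where "rot j = (let u = j div 2 in
     if even j then X (colx u + col_shift (dg u)) (dg u)
     else - X (rowx u + row_shift (prev (dg u))) (prev (dg u)))"

definition face_type :: "nat \<Rightarrow> bool \<times> nat"
  where "face_type j = (even j, if even j then rowx (j div 2) else next_col (j div 2))"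

definition face_pos :: "nat \<Rightarrow> nat"
  where "face_pos j = (let g = dg (j div 2) in
     if even j then prev g else if next_col (j div 2) = 0 then prev (prev g) else k - 1 - g)"

section \<open>The single cycle on the array\<close>

lemma n_pos: "0 < n" and k_pos: "0 < k"
  using n_ge_3 k_ge_3 by auto

lemma X_cong: "[i = i'] (mod n) \<Longrightarrow> X i j = X i' j"
  unfolding cong_def by (metis X_mod)

lemma dg_less: "dg u < k"
  using k_pos by (simp add: dg_def)

lemma prev_less: "j < k \<Longrightarrow> prev j < k"
  using k_pos by (auto simp: prev_def)

lemma Suc_prev: "j < k \<Longrightarrow> Suc (prev j) mod k = j"
  using k_pos by (auto simp: prev_def)

lemma prev_eqI: "Suc i mod k = j \<Longrightarrow> i < k \<Longrightarrow> prev j = i"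
  using k_pos by (auto simp: prev_def mod_Suc split: if_splits)

lemma coprime_stride: "coprime (stride j) n"
proof -
  have "coprime 2 n" using odd_n by simp
  moreover have "coprime (n - 2) n" using odd_n n_ge_3 by (intro coprime_minus_2) simp_all
  ultimately show ?thesis by (simp add: stride_def)
qed

lemma coprime_k: "coprime (k - 2) k"
  using odd_k k_ge_3 by (intro coprime_minus_2) simp_all

lemma multiple_ex:
  fixes u N c :: nat
  assumes "coprime u N" "c < N"
  shows "\<exists>b<N. b * u mod N = c"
proof -
  obtain x where "[u * x = 1] (mod N)" using cong_solve_coprime_nat[OF assms(1)] by auto
  then have "[u * x * c = 1 * c] (mod N)" by (intro cong_mult cong_refl)
  then have "x * c mod N * u mod N = c" using assms(2) by (simp add: cong_def mod_simps mult_ac)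
  moreover have "x * c mod N < N" using assms(2) by simp
  ultimately show ?thesis by blast
qed

text \<open>As \<open>stride\<close> is coprime to \<open>n\<close>, a round on one diagonal moves
  into column 0 only at its end.\<close>

lemma next_col_eq_0_iff: "next_col u = 0 \<longleftrightarrow> Suc (u mod n) = n"
proof -
  have "next_col u = 0 \<longleftrightarrow> n dvd Suc (u mod n)"
    unfolding next_col_def using coprime_stride
    by (simp add: mod_eq_0_iff_dvd coprime_dvd_mult_left_iff coprime_commute del: mult_Suc)
  also have "\<dots> \<longleftrightarrow> Suc (u mod n) = n"
    using mod_less_divisor[OF n_pos, of u] dvd_imp_le[of n "Suc (u mod n)"]
    by (metis Suc_leI dvd_refl le_antisym zero_less_Suc)
  finally show ?thesis .
qed

text \<open>Adding \<open>k - 2\<close> modulo \<open>k\<close> means going back two diagonals, and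
  \<open>u div n\<close> grows exactly when a round is complete.\<close>

lemma dg_Suc: "dg (Suc u) = (if next_col u = 0 then prev (prev (dg u)) else dg u)"
proof (cases "next_col u = 0")
  case True
  then have "Suc u div n = Suc (u div n)"
    using n_pos by (auto simp: next_col_eq_0_iff div_Suc mod_Suc)
  then have "dg (Suc u) = (dg u + (k - 2)) mod k" by (simp add: dg_def mod_simps add.commute)
  also have "\<dots> = prev (prev (dg u))"
  proof (cases "dg u \<ge> 2")
    case True
    then have "dg u + (k - 2) = (dg u - 2) + k" using k_ge_3 by simp
    then have "(dg u + (k - 2)) mod k = dg u - 2"
      using True dg_less[of u] by (simp only: mod_add_self2) simp
    then show ?thesis using True by (simp add: prev_def)
  next
    case False
    then have "dg u = 0 \<or> dg u = 1" by auto
    then show ?thesis using k_ge_3 by (auto simp: prev_def)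
  qed
  finally show ?thesis using True by simp
next
  case False
  then have "Suc u div n = u div n"
    using n_pos by (auto simp: next_col_eq_0_iff div_Suc mod_Suc)
  then show ?thesis using False by (simp add: dg_def)
qed

lemma colx_Suc: "colx (Suc u) = next_col u"
proof (cases "next_col u = 0")
  case True
  then have "Suc u mod n = 0" by (simp add: next_col_eq_0_iff mod_Suc)
  then show ?thesis using True by (simp add: colx_def)
next
  case False
  then have "Suc u mod n = Suc (u mod n)" by (simp add: next_col_eq_0_iff mod_Suc)
  then show ?thesis using False by (simp add: colx_def next_col_def dg_Suc del: mult_Suc)
qed

text \<open>Row \<open>rowx u\<close> and column \<open>colx u\<close> address the same cell of
  diagonal \<open>dg u\<close>.\<close>

lemma rowx_cong: "[rowx u + row_shift (dg u) = colx u + col_shift (dg u)] (mod n)"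
proof -
  have "row_shift (dg u) \<le> n" using n_ge_3 by (simp add: row_shift_def)
  then have "colx u + col_shift (dg u) + n - row_shift (dg u) + row_shift (dg u) = colx u + col_shift (dg u) + n"
    by simp
  moreover have "(rowx u + row_shift (dg u)) mod n =
    (colx u + col_shift (dg u) + n - row_shift (dg u) + row_shift (dg u)) mod n"
    by (simp add: rowx_def mod_simps)
  ultimately show ?thesis by (simp add: cong_def)
qed

text \<open>The row predecessor of the \<open>u\<close>-th entry lies in column
  \<open>next_col u\<close>: the shifts on the two diagonals involved add up to
  \<open>stride\<close>.\<close>

lemma next_col_cong:
  "[rowx u + row_shift (prev (dg u)) = next_col u + col_shift (prev (dg u))] (mod n)"
proof -
  let ?g = "dg u"
  have "col_shift ?g + n - row_shift ?g + row_shift (prev ?g) = stride ?g + col_shift (prev ?g) \<or>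
    col_shift ?g + n - row_shift ?g + row_shift (prev ?g) = stride ?g + col_shift (prev ?g) + n"
    using odd_k k_ge_3 n_ge_3 by (cases "?g = 0"; cases "?g = 1")
      (auto simp: row_shift_def col_shift_def stride_def prev_def)
  then have *: "[col_shift ?g + n - row_shift ?g + row_shift (prev ?g) = stride ?g + col_shift (prev ?g)] (mod n)"
    by (auto simp: cong_def)
  have r: "row_shift ?g \<le> n" using n_ge_3 by (simp add: row_shift_def)
  have "[rowx u + row_shift (prev ?g) =
    u mod n * stride ?g + (col_shift ?g + n - row_shift ?g + row_shift (prev ?g))] (mod n)"
  proof -
    have "rowx u = (colx u + (col_shift ?g + n - row_shift ?g)) mod n"
      using r by (simp add: rowx_def add.assoc)
    then show ?thesis
      by (simp add: colx_def cong_def mod_add_left_eq add.assoc del: mod_mult_left_eq)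
  qed
  also have "[u mod n * stride ?g + (col_shift ?g + n - row_shift ?g + row_shift (prev ?g)) =
    u mod n * stride ?g + (stride ?g + col_shift (prev ?g))] (mod n)"
    by (intro cong_add cong_refl *)
  also have "[u mod n * stride ?g + (stride ?g + col_shift (prev ?g)) =
    next_col u + col_shift (prev ?g)] (mod n)"
    by (simp add: next_col_def cong_def mod_simps add_ac)
  finally show ?thesis .
qed

lemma steps_row: "l < k \<Longrightarrow> steps (True, r) l = X (r + row_shift l) l"
  by (simp add: steps_def)

lemma steps_mod: "steps \<tau> (l mod k) = steps \<tau> l"
  by (simp add: steps_def)

lemma rot_even_step: "rot (Suc (2 * u)) = - steps (True, rowx u) (prev (dg u))"
  by (simp add: rot_def Let_def steps_row prev_less dg_less)

lemma rot_even: "rot (2 * u) = steps (True, rowx u) (Suc (prev (dg u)))"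
proof -
  have "steps (True, rowx u) (Suc (prev (dg u))) = X (rowx u + row_shift (dg u)) (dg u)"
    by (simp add: steps_def Suc_prev dg_less)
  then show ?thesis using X_cong[OF rowx_cong] by (simp add: rot_def Let_def)
qed

lemma rot_odd_step: "rot (2 * Suc u) = - steps (False, next_col u) (face_pos (Suc (2 * u)))"
proof (cases "next_col u = 0")
  case True
  then show ?thesis
    by (simp add: rot_def Let_def steps_def face_pos_def colx_Suc dg_Suc prev_less dg_less
        del: mult_Suc_right)
next
  case False
  have "k - 1 - (k - 1 - dg u) mod k = dg u" using dg_less[of u] by simp
  with False show ?thesis
    by (simp add: rot_def Let_def steps_def face_pos_def colx_Suc dg_Suc del: mult_Suc_right)
qed

lemma rot_odd: "rot (Suc (2 * u)) = steps (False, next_col u) (Suc (face_pos (Suc (2 * u))))"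
proof -
  have "steps (False, next_col u) (Suc (face_pos (Suc (2 * u)))) =
    - X (next_col u + col_shift (prev (dg u))) (prev (dg u))"
  proof (cases "next_col u = 0")
    case True
    then show ?thesis
      by (simp add: steps_def Let_def face_pos_def Suc_prev prev_less dg_less)
  next
    case False
    have "k - 1 - Suc (k - 1 - dg u) mod k = prev (dg u)"
      using dg_less[of u] k_ge_3 by (cases "dg u = 0") (auto simp: prev_def Suc_diff_Suc)
    with False show ?thesis by (simp add: steps_def Let_def face_pos_def)
  qed
  then show ?thesis using X_cong[OF next_col_cong] by (simp add: rot_def Let_def)
qed

lemma dg_ex: "g < k \<Longrightarrow> b < n \<Longrightarrow> \<exists>u. dg u = g \<and> u mod n = b"
proof -
  assume g: "g < k" and b: "b < n"
  obtain a where "(k - 2) * a mod k = g"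
    using multiple_ex[OF coprime_k g] by (auto simp: mult.commute)
  then have "dg (a * n + b) = g" "(a * n + b) mod n = b" using b by (simp_all add: dg_def)
  then show ?thesis by blast
qed

text \<open>Type and position determine diagonal and column; the column determines the step within
  the round because \<open>stride\<close> is invertible modulo \<open>n\<close>.\<close>

lemma face_ex:
  assumes "c < n" "i < k"
  shows "\<exists>j. face_type j = (\<beta>, c) \<and> face_pos j = i"
proof (cases \<beta>)
  case True
  define g where "g = Suc i mod k"
  have g: "g < k" "prev g = i" using k_pos assms(2) by (simp_all add: g_def prev_eqI)
  let ?c = "(c + row_shift g + n - col_shift g) mod n"
  obtain b where b: "b < n" "b * stride g mod n = ?c"
    using multiple_ex[OF coprime_stride, of ?c g] n_pos by auto
  obtain u where u: "dg u = g" "u mod n = b" using dg_ex[OF g(1) b(1)] by blast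
  have "rowx u = c"
  proof -
    have cs: "col_shift g \<le> n" "row_shift g \<le> n" using n_ge_3 by (simp_all add: col_shift_def row_shift_def)
    have "rowx u = (?c + (col_shift g + n - row_shift g)) mod n"
      using cs unfolding rowx_def colx_def u b(2) by (simp add: add.assoc)
    also have "\<dots> = (c + row_shift g + n - col_shift g + (col_shift g + n - row_shift g)) mod n"
      by (simp add: mod_simps)
    also have "c + row_shift g + n - col_shift g + (col_shift g + n - row_shift g) = c + n + n"
      using cs by simp
    finally show ?thesis using assms by simp
  qed
  then have "face_type (2 * u) = (\<beta>, c)" "face_pos (2 * u) = i"
    using True u g by (simp_all add: face_type_def face_pos_def Let_def)
  then show ?thesis by blast
next
  case False
  show ?thesis
  proof (cases "c = 0")
    case True
    define g where "g = Suc (Suc i mod k) mod k"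
    have g: "g < k" "prev g = Suc i mod k" "prev (Suc i mod k) = i"
      using k_pos assms(2) by (simp_all add: g_def prev_eqI)
    \<comment> \<open>Column 0 is entered at the end of a round, where the diagonal falls by two;
      hence the double successor in \<open>g\<close>.\<close>
    obtain u where u: "dg u = g" "u mod n = n - 1" using dg_ex[OF g(1), of "n - 1"] n_pos by auto
    then have "next_col u = 0" using n_pos by (simp add: next_col_eq_0_iff)
    then have "face_type (Suc (2 * u)) = (\<beta>, c)" "face_pos (Suc (2 * u)) = i"
      using True False u g by (simp_all add: face_type_def face_pos_def Let_def)
    then show ?thesis by blast
  next
    case c: False
    define g where "g = k - 1 - i"
    have g: "g < k" "k - 1 - g = i" using assms(2) by (auto simp: g_def)
    obtain b where b: "b < n" "b * stride g mod n = c"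
      using multiple_ex[OF coprime_stride, of c g] assms by auto
    have "b \<noteq> 0" using b(2) c by (cases "b = 0") auto
    \<comment> \<open>\<open>next_col\<close> looks one step ahead, hence
      \<open>b - 1\<close>.\<close>
    obtain u where u: "dg u = g" "u mod n = b - 1" using dg_ex[OF g(1), of "b - 1"] b(1) by (metis less_imp_diff_less)
    have "next_col u = c" using u b \<open>b \<noteq> 0\<close> by (simp add: next_col_def del: mult_Suc)
    then have "face_type (Suc (2 * u)) = (\<beta>, c)" "face_pos (Suc (2 * u)) = i"
      using c False u g by (simp_all add: face_type_def face_pos_def Let_def)
    then show ?thesis by blast
  qed
qed

lemma rot_periodic:
  "rot (j mod (2 * n * k)) = rot j" "face_type (j mod (2 * n * k)) = face_type j"
  "face_pos (j mod (2 * n * k)) = face_pos j"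
proof -
  let ?a = "j div (2 * n * k)" and ?b = "j mod (2 * n * k)"
  have j: "j = ?b + 2 * (n * (k * ?a))" using mult_div_mod_eq[of "2 * n * k" j] by (simp only: mult.assoc add.commute)
  have "j div 2 = ?b div 2 + n * (k * ?a)" by (subst j) simp
  moreover have "even j \<longleftrightarrow> even ?b" by (subst j) simp
  moreover have "dg (u + n * (k * a)) = dg u" for u a
  proof -
    have "(u + n * (k * a)) div n = u div n + k * a" using n_pos by simp
    then have "(k - 2) * ((u + n * (k * a)) div n) = (k - 2) * (u div n) + k * ((k - 2) * a)"
      by (simp only: distrib_left mult.left_commute)
    then show ?thesis unfolding dg_def by simp
  qed
  moreover have "(u + n * (k * a)) mod n = u mod n" for u a by simp
  ultimately show "rot ?b = rot j" "face_type ?b = face_type j" "face_pos ?b = face_pos j"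
    by (simp_all add: rot_def face_type_def face_pos_def rowx_def colx_def next_col_def Let_def)
qed

section \<open>Counting the differences\<close>

lemma card_non_multiples: "card {z \<in> {0..<int (q * t)}. \<not> int q dvd z} = 2 * n * k"
proof -
  have "{z \<in> {0..<int (q * t)}. int q dvd z} = (\<lambda>i. int q * i) ` {0..<int t}"
    using q_ge_2 by (auto simp: image_iff zero_le_mult_iff dvd_def)
  moreover have "inj_on (\<lambda>i. int q * i) {0..<int t}" using q_ge_2 by (auto simp: inj_on_def)
  ultimately have "card {z \<in> {0..<int (q * t)}. int q dvd z} = t" by (simp add: card_image)
  moreover have "{z \<in> {0..<int (q * t)}. \<not> int q dvd z} =
    {0..<int (q * t)} - {z \<in> {0..<int (q * t)}. int q dvd z}" by blast
  moreover have "card ({0..<int (q * t)} - {z \<in> {0..<int (q * t)}. int q dvd z}) =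
    card {0..<int (q * t)} - card {z \<in> {0..<int (q * t)}. int q dvd z}"
    by (rule card_Diff_subset) (auto intro: finite_subset[OF _ finite_atLeastLessThan_int])
  ultimately show ?thesis using size by (simp del: of_nat_mult)
qed

lemma rot_not_dvd: "\<not> int q dvd rot j"
  by (simp add: rot_def Let_def X_not_dvd dg_less prev_less)

text \<open>An entry stands in \<open>rot\<close> right after a corner of its column face, its
  negative right after a corner of its row face.\<close>

lemma rot_ex_cong:
  assumes "\<not> int q dvd z"
  shows "\<exists>j. [rot j = z] (mod int (q * t))"
proof -
  obtain i h where h: "h < k" and *: "[X i h = z] (mod int (q * t)) \<or> [X i h = - z] (mod int (q * t))"
    using X_range[OF assms] by blast
  have "\<exists>j. rot j = X i h"
  proof -
    define c where "c = (i + n - col_shift h) mod n"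
    have c: "c < n" "[c + col_shift h = i] (mod n)"
      using n_ge_3 by (auto simp: c_def col_shift_def cong_def mod_simps)
    define l where "l = (if c = 0 then h else k - 1 - h)"
    have l: "l < k" using h by (simp add: l_def)
    obtain j where j: "face_type j = (False, c)" "face_pos j = l"
      using face_ex[OF c(1) l, of False] by blast
    then obtain u where u: "j = Suc (2 * u)" by (auto simp: face_type_def elim: oddE)
    have "rot (Suc j) = - steps (False, c) l"
      using rot_odd_step[of u] j u by (simp add: face_type_def)
    also have "\<dots> = X i h" using X_cong[OF c(2), of h] h
      by (cases "c = 0") (simp_all add: steps_def l_def Let_def)
    finally show ?thesis by blast
  qed
  moreover have "\<exists>j. rot j = - X i h"
  proof -
    define r where "r = (i + n - row_shift h) mod n"
    have r: "r < n" "[r + row_shift h = i] (mod n)"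
      using n_ge_3 by (auto simp: r_def row_shift_def cong_def mod_simps)
    obtain j where j: "face_type j = (True, r)" "face_pos j = h"
      using face_ex[OF r(1) h, of True] by auto
    then obtain u where u: "j = 2 * u" by (auto simp: face_type_def elim: evenE)
    have "rot (Suc j) = - steps (True, r) h"
      using rot_even_step[of u] j u by (simp add: face_type_def face_pos_def Let_def)
    then show ?thesis using X_cong[OF r(2)] h by (auto simp: steps_row)
  qed
  moreover have "[- X i h = z] (mod int (q * t))" if "[X i h = - z] (mod int (q * t))"
    using that by (metis cong_minus_minus_iff minus_minus)
  ultimately show ?thesis using * by metis
qed

lemma rot_image: "(\<lambda>j. rot j mod int (q * t)) ` {..<2 * n * k} = {z \<in> {0..<int (q * t)}. \<not> int q dvd z}"
proof (intro equalityI subsetI)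
  fix z assume "z \<in> (\<lambda>j. rot j mod int (q * t)) ` {..<2 * n * k}"
  then obtain j where z: "z = rot j mod int (q * t)" by blast
  have "int q dvd z \<longleftrightarrow> int q dvd rot j" unfolding z by (rule dvd_mod_iff) simp
  then show "z \<in> {z \<in> {0..<int (q * t)}. \<not> int q dvd z}"
    using z rot_not_dvd q_ge_2 t_pos by simp
next
  fix z assume z: "z \<in> {z \<in> {0..<int (q * t)}. \<not> int q dvd z}"
  then obtain j where "[rot j = z] (mod int (q * t))" using rot_ex_cong by blast
  then have "rot (j mod (2 * n * k)) mod int (q * t) = z"
    using z by (simp add: rot_periodic cong_def del: of_nat_mult)
  moreover have "j mod (2 * n * k) < 2 * n * k" using n_pos k_pos by simp
  ultimately show "z \<in> (\<lambda>j. rot j mod int (q * t)) ` {..<2 * n * k}" by blast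
qed

text \<open>A surjection between finite sets of the same size \<open>2 * n * k\<close> is
  injective.\<close>

lemma rot_inj:
  assumes "i < 2 * n * k" "j < 2 * n * k" "[rot i = rot j] (mod int (q * t))"
  shows "i = j"
proof -
  have "inj_on (\<lambda>j. rot j mod int (q * t)) {..<2 * n * k}"
    by (rule eq_card_imp_inj_on) (simp_all only: rot_image card_non_multiples card_lessThan finite_lessThan)
  then show ?thesis using assms by (auto simp: inj_on_def cong_def)
qed

text \<open>Reversing a column turns a block that starts at 0 into one that ends at
  \<open>k\<close>, which the simplicity assumptions do not cover. Modulo \<open>q * t\<close> its
  sum is the negative of the complementary initial block.\<close>

lemma sum_split:
  fixes f :: "nat \<Rightarrow> int"
  assumes "a < b" "b \<le> k" "b - a < k" "int (q * t) dvd (\<Sum>j<k. f j)"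
    and simple: "\<And>a b. a < b \<Longrightarrow> b < k \<Longrightarrow> \<not> int (q * t) dvd (\<Sum>j\<in>{a..<b}. f j)"
  shows "\<not> int (q * t) dvd (\<Sum>j\<in>{a..<b}. f j)"
proof (cases "b < k")
  case False
  then have b: "b = k" "0 < a" using assms by auto
  have "(\<Sum>j<k. f j) = (\<Sum>j\<in>{0..<a}. f j) + (\<Sum>j\<in>{a..<k}. f j)"
    using assms b by (simp add: lessThan_atLeast0 sum.atLeastLessThan_concat)
  then show ?thesis
    using assms(4) simple[of 0 a] b assms(1) by (metis dvd_add_left_iff)
qed (use assms in auto)

end

sublocale diagonal_array \<subseteq>
  cyclic_map q t k "2 * n * k" "UNIV \<times> {..<n}" steps rot face_type face_pos fst
proof
  show "2 \<le> q" "0 < t" "3 \<le> k" using q_ge_2 t_pos k_ge_3 .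
  have "1 * 3 \<le> (2 * n) * k" using n_ge_3 k_ge_3 by (intro mult_le_mono) auto
  then show "3 \<le> 2 * n * k" by simp
  show "finite (UNIV \<times> {..<n} :: (bool \<times> nat) set)" by simp
  show "rot (j mod (2 * n * k)) = rot j" "face_type (j mod (2 * n * k)) = face_type j"
    "face_pos (j mod (2 * n * k)) = face_pos j" for j by (rule rot_periodic)+
  show "i = j" if "i < 2 * n * k" "j < 2 * n * k" "[rot i = rot j] (mod int (q * t))" for i j
    using rot_inj that .
  show "(\<exists>j. [rot j = z] (mod int (q * t))) \<longleftrightarrow> \<not> int q dvd z" for z
  proof
    assume "\<exists>j. [rot j = z] (mod int (q * t))"
    then obtain j where "[rot j = z] (mod int (q * t))" by blast
    then have "[rot j = z] (mod int q)" by (simp add: cong_modulus_mult)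
    then show "\<not> int q dvd z" using rot_not_dvd[of j] cong_dvd_iff by blast
  qed (rule rot_ex_cong)
  show "face_type j \<in> UNIV \<times> {..<n}" for j
    using n_pos by (simp add: face_type_def rowx_def next_col_def)
  show "fst (face_type (Suc j)) \<longleftrightarrow> \<not> fst (face_type j)" for j by (simp add: face_type_def)
  show "\<exists>j. face_type j = \<tau> \<and> face_pos j = i" if "\<tau> \<in> UNIV \<times> {..<n}" "i < k" for \<tau> i
    using that face_ex[of "snd \<tau>" i "fst \<tau>"] by auto
  show "steps \<tau> (l mod k) = steps \<tau> l" for \<tau> l by (rule steps_mod)
  show "rot (Suc j) = - steps (face_type j) (face_pos j)" for j
  proof (cases "even j")
    case True
    then obtain u where "j = 2 * u" by blast
    then show ?thesis using rot_even_step[of u] by (simp add: face_type_def face_pos_def Let_def)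
  next
    case False
    then obtain u where "j = Suc (2 * u)" by (auto elim: oddE)
    then show ?thesis using rot_odd_step[of u] by (simp add: face_type_def)
  qed
  show "rot j = steps (face_type j) (Suc (face_pos j))" for j
  proof (cases "even j")
    case True
    then obtain u where "j = 2 * u" by blast
    then show ?thesis using rot_even[of u] by (simp add: face_type_def face_pos_def Let_def)
  next
    case False
    then obtain u where "j = Suc (2 * u)" by (auto elim: oddE)
    then show ?thesis using rot_odd[of u] by (simp add: face_type_def)
  qed
  have simple: "\<not> int (q * t) dvd (\<Sum>l\<in>{a..<b}. steps \<tau> l)"
    if ab: "a < b" "b \<le> k" "b - a < k" for \<tau> a b
  proof -
    consider "fst \<tau>" | "\<not> fst \<tau>" "snd \<tau> = 0" | "\<not> fst \<tau>" "snd \<tau> \<noteq> 0" by blast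
    then show ?thesis
    proof cases
      case 1
      then have "(\<Sum>l\<in>{a..<b}. steps \<tau> l) = (\<Sum>l\<in>{a..<b}. X (snd \<tau> + row_shift l) l)"
        using ab by (intro sum.cong) (auto simp: steps_def)
      then show ?thesis using sum_split[OF ab row_sum row_simple] by simp
    next
      case 2
      then have "(\<Sum>l\<in>{a..<b}. steps \<tau> l) = - (\<Sum>l\<in>{a..<b}. X (snd \<tau> + col_shift l) l)"
        using ab by (subst sum_negf[symmetric], intro sum.cong) (auto simp: steps_def)
      then show ?thesis using sum_split[OF ab col_sum col_simple] by (simp del: of_nat_mult)
    next
      case 3
      have "(\<Sum>l\<in>{a..<b}. steps \<tau> l) = (\<Sum>l\<in>{a..<b}. - X (snd \<tau> + col_shift (k - 1 - l)) (k - 1 - l))"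
        using 3 ab by (intro sum.cong) (auto simp: steps_def Let_def)
      also have "\<dots> = (\<Sum>l\<in>{k - b..<k - a}. - X (snd \<tau> + col_shift l) l)"
        using ab by (intro sum.reindex_bij_witness[of _ "\<lambda>l. k - 1 - l" "\<lambda>l. k - 1 - l"]) auto
      also have "\<dots> = - (\<Sum>l\<in>{k - b..<k - a}. X (snd \<tau> + col_shift l) l)"
        by (simp add: sum_negf)
      finally show ?thesis
        using sum_split[of "k - b" "k - a", OF _ _ _ col_sum col_simple] ab by (simp del: of_nat_mult)
    qed
  qed
  show "\<not> int (q * t) dvd (\<Sum>l\<in>{a..<b}. steps \<tau> l)" if "a < b" "b < k" for \<tau> a b
    using simple[of a b \<tau>] that by simp
  show "int (q * t) dvd (\<Sum>l<k. steps \<tau> l)" for \<tau>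
  proof -
    consider "fst \<tau>" | "\<not> fst \<tau>" "snd \<tau> = 0" | "\<not> fst \<tau>" "snd \<tau> \<noteq> 0" by blast
    then show ?thesis
    proof cases
      case 1
      then have "(\<Sum>l<k. steps \<tau> l) = (\<Sum>l<k. X (snd \<tau> + row_shift l) l)"
        by (intro sum.cong) (auto simp: steps_def)
      then show ?thesis using row_sum by simp
    next
      case 2
      then have "(\<Sum>l<k. steps \<tau> l) = - (\<Sum>l<k. X (snd \<tau> + col_shift l) l)"
        by (subst sum_negf[symmetric], intro sum.cong) (auto simp: steps_def)
      then show ?thesis using col_sum by (simp del: of_nat_mult)
    next
      case 3
      have "(\<Sum>l<k. steps \<tau> l) = (\<Sum>l<k. - X (snd \<tau> + col_shift (k - 1 - l)) (k - 1 - l))"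
        using 3 by (intro sum.cong) (auto simp: steps_def Let_def)
      also have "\<dots> = (\<Sum>l<k. - X (snd \<tau> + col_shift l) l)"
        by (intro sum.reindex_bij_witness[of _ "\<lambda>l. k - 1 - l" "\<lambda>l. k - 1 - l"]) auto
      also have "\<dots> = - (\<Sum>l<k. X (snd \<tau> + col_shift l) l)"
        by (simp add: sum_negf)
      finally show ?thesis using col_sum by (simp del: of_nat_mult)
    qed
  qed
qed

lemmas (in diagonal_array) ex_biembedding = ex_cyclic_biembedding

section \<open>Arrays with parts of size k\<close>

text \<open>\<open>R\<close> is itself a multiple of \<open>q\<close>, and 0, \<open>q\<close>,
  \<open>- q\<close> are the only ones below \<open>2 * q\<close> in absolute value.\<close>

lemma multiple_cases:
  fixes k q R C :: int
  assumes "0 < q" "\<bar>R\<bar> < 2 * q" "k * q dvd R + C * q"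
  shows "R = 0 \<and> k dvd C \<or> R = q \<and> k dvd C + 1 \<or> R = - q \<and> k dvd C - 1"
proof -
  have "q dvd R + C * q" using assms(3) by (rule dvd_mult_right)
  then have "q dvd R" by simp
  then obtain z where z: "R = z * q" by (metis dvdE mult.commute)
  have "\<bar>z\<bar> * q < 2 * q" using assms(1,2) by (simp add: z abs_mult)
  then have "z = 0 \<or> z = 1 \<or> z = - 1" using assms(1) by (simp add: abs_if split: if_splits) linarith+
  moreover have "k * q dvd (z + C) * q" using assms(3) by (simp add: z distrib_right)
  then have "k dvd z + C" using assms(1) by simp
  ultimately show ?thesis by (auto simp: z add.commute)
qed

text \<open>\<open>(x, y, z, c)\<close> stands for \<open>x w\<^sub>i + y w\<^sub>i\<^sub>+\<^sub>1 + z d\<^sub>i\<^sub>+\<^sub>1 + c q\<close> with \<open>q = 2n + 1\<close> and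
  \<open>d\<^sub>i = - (w\<^sub>i + w\<^sub>i\<^sub>+\<^sub>1)\<close>, and in the lists of \<open>admissible\<close> for
  \<open>x w\<^sub>i + y d\<^sub>i + z d\<^sub>i\<^sub>+\<^sub>1 + c q\<close>. Here \<open>w\<close>, \<open>d\<close> and
  \<open>w\<^sub>i + w\<^sub>i\<^sub>+\<^sub>1\<close> are bounded by \<open>n\<close>, so partial sums of a block reduce to coefficients.\<close>

type_synonym coeffs = "int \<times> int \<times> int \<times> int"

definition combine :: "int \<Rightarrow> int \<Rightarrow> int \<Rightarrow> int \<Rightarrow> coeffs \<Rightarrow> int"
  where "combine a b e q p = (case p of (x, y, z, c) \<Rightarrow> x * a + y * b + z * e + c * q)"

text \<open>Bounds the sum without its \<open>q\<close>-part in units of \<open>n\<close>. For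
  coefficients of equal sign, x a + y b = (x - y) a + y (a + b); since \<open>a + b\<close> is
  bounded by \<open>n\<close> too, the larger coefficient alone counts.\<close>

definition weight :: "coeffs \<Rightarrow> int"
  where "weight p = (case p of (x, y, z, c) \<Rightarrow>
    (if 0 \<le> x * y then max \<bar>x\<bar> \<bar>y\<bar> else \<bar>x\<bar> + \<bar>y\<bar>) + \<bar>z\<bar>)"

text \<open>Decidable conditions under which R + c q is no multiple of k q. Weight at most 2 gives
  |R| < q, so only R = 0 with k dividing c is possible. Weight at most 4 gives |R| < 2 q, which adds
  R = q and R = - q. The last alternative lists shapes where R cannot vanish: nonzero multiples of
  w_i + w_(i+1), w_i, w_(i+1), d_(i+1) and d_i + d_(i+1).\<close>

definition nonmultiple :: "nat \<Rightarrow> coeffs \<Rightarrow> bool"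
  where "nonmultiple k p = (case p of (x, y, z, c) \<Rightarrow>
    weight p \<le> 2 \<and> \<not> int k dvd c \<or>
    weight p \<le> 4 \<and> \<not> int k dvd c \<and> \<not> int k dvd c + 1 \<and> \<not> int k dvd c - 1 \<or>
    weight p \<le> 2 \<and> (x \<noteq> 0 \<and> y = x \<and> z = 0 \<or> x \<noteq> 0 \<and> y = 0 \<and> z = 0 \<or>
      x = 0 \<and> y \<noteq> 0 \<and> z = 0 \<or> x = 0 \<and> y = 0 \<and> z \<noteq> 0 \<or> z \<noteq> 0 \<and> x = - z \<and> y = - z))"

lemma combine_add: "combine a b e q (p + p') = combine a b e q p + combine a b e q p'"
  by (cases p; cases p') (simp add: combine_def algebra_simps)

lemma combine_sum: "combine a b e q (sum f A) = (\<Sum>j\<in>A. combine a b e q (f j))"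
  by (induction A rule: infinite_finite_induct) (simp_all add: combine_add, simp_all add: combine_def zero_prod_def)

lemma abs_combine_le:
  fixes n a b e :: int
  assumes "\<bar>a\<bar> \<le> n" "\<bar>b\<bar> \<le> n" "\<bar>a + b\<bar> \<le> n" "\<bar>e\<bar> \<le> n"
  shows "\<bar>x * a + y * b + z * e\<bar> \<le> weight (x, y, z, c) * n"
proof -
  have m: "\<bar>u * f\<bar> \<le> \<bar>u\<bar> * n" if "\<bar>f\<bar> \<le> n" for u f :: int
    using that by (simp add: abs_mult mult_left_mono)
  have same: "\<bar>u * f + u' * f'\<bar> \<le> \<bar>u\<bar> * n"
    if "\<bar>f\<bar> \<le> n" "\<bar>f + f'\<bar> \<le> n" "0 \<le> u * u'" "\<bar>u'\<bar> \<le> \<bar>u\<bar>" for u u' f f' :: int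
  proof -
    have "u * f + u' * f' = (u - u') * f + u' * (f + f')" by (simp add: algebra_simps)
    then have "\<bar>u * f + u' * f'\<bar> \<le> \<bar>u - u'\<bar> * n + \<bar>u'\<bar> * n"
      using m[OF that(1), of "u - u'"] m[OF that(2), of u'] by linarith
    also have "\<dots> = (\<bar>u - u'\<bar> + \<bar>u'\<bar>) * n" by (simp add: distrib_right)
    also have "\<bar>u - u'\<bar> + \<bar>u'\<bar> = \<bar>u\<bar>"
      using that(3,4) by (auto simp: zero_le_mult_iff)
    finally show ?thesis .
  qed
  have "\<bar>x * a + y * b\<bar> \<le> (if 0 \<le> x * y then max \<bar>x\<bar> \<bar>y\<bar> else \<bar>x\<bar> + \<bar>y\<bar>) * n"
  proof (cases "0 \<le> x * y")
    case True
    then show ?thesis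
      using same[of a b x y] same[of b a y x] assms by (auto simp: max_def mult.commute add.commute)
  next
    case False
    then show ?thesis using m[OF assms(1), of x] m[OF assms(2), of y] by (auto simp: distrib_right)
  qed
  moreover have "\<bar>x * a + y * b + z * e\<bar> \<le> \<bar>x * a + y * b\<bar> + \<bar>z * e\<bar>"
    by (rule abs_triangle_ineq)
  ultimately show ?thesis
    using m[OF assms(4), of z] unfolding weight_def prod.case distrib_right by linarith
qed

lemma nonmultiple:
  fixes n k :: nat and a b e :: int
  assumes "\<bar>a\<bar> \<le> int n" "\<bar>b\<bar> \<le> int n" "\<bar>a + b\<bar> \<le> int n" "\<bar>e\<bar> \<le> int n"
    and "a \<noteq> 0" "b \<noteq> 0" "a + b \<noteq> 0" "e \<noteq> 0" "e \<noteq> a + b" and "nonmultiple k p"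
  shows "\<not> int k * (2 * int n + 1) dvd combine a b e (2 * int n + 1) p"
proof
  assume dvd: "int k * (2 * int n + 1) dvd combine a b e (2 * int n + 1) p"
  obtain x y z c where p: "p = (x, y, z, c)" by (cases p) auto
  define R where "R = x * a + y * b + z * e"
  have le: "\<bar>R\<bar> \<le> weight p * int n"
    unfolding R_def p by (rule abs_combine_le) (use assms in auto)
  have dvd': "int k * (2 * int n + 1) dvd R + c * (2 * int n + 1)"
    using dvd by (simp add: combine_def p R_def)
  have 4: "\<bar>R\<bar> < 2 * (2 * int n + 1)" if "weight p \<le> 4"
    using le mult_right_mono[OF that, of "int n"] by simp
  have 2: "\<bar>R\<bar> < 2 * int n + 1" if "weight p \<le> 2"
    using le mult_right_mono[OF that, of "int n"] by simp
  have "\<bar>R\<bar> < 2 * (2 * int n + 1)" using assms(10) 2 4 by (auto simp: nonmultiple_def p)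
  note cases = multiple_cases[OF _ this dvd']
  consider "weight p \<le> 2" "\<not> int k dvd c"
    | "weight p \<le> 4" "\<not> int k dvd c" "\<not> int k dvd c + 1" "\<not> int k dvd c - 1"
    | "weight p \<le> 2" "x \<noteq> 0 \<and> y = x \<and> z = 0 \<or> x \<noteq> 0 \<and> y = 0 \<and> z = 0 \<or>
      x = 0 \<and> y \<noteq> 0 \<and> z = 0 \<or> x = 0 \<and> y = 0 \<and> z \<noteq> 0 \<or> z \<noteq> 0 \<and> x = - z \<and> y = - z"
    using assms(10) by (auto simp: nonmultiple_def p)
  then show False
  proof cases
    case 1
    then show False using cases 2 by auto
  next
    case 2
    then show False using cases by auto
  next
    case 3
    then have "R = 0" using cases 2 by auto
    moreover have "R \<noteq> 0"
    proof -
      have "x * a + x * b = x * (a + b)" "- (z * a) - z * b + z * e = z * (e - (a + b))"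
        by (simp_all add: algebra_simps)
      then show ?thesis using 3(2) assms by (auto simp: R_def simp flip: add_diff_eq)
    qed
    ultimately show False by simp
  qed
qed

text \<open>Eliminates d_i from an entry at index i + s. For s = 1 the coefficient \<open>z\<close>
  would belong to d_(i+2) and is dropped: \<open>admissible\<close> allows it on diagonal 0 only,
  which is never shifted.\<close>

definition shifted :: "nat \<Rightarrow> coeffs \<Rightarrow> coeffs"
  where "shifted s p = (case p of (x, y, z, c) \<Rightarrow> if s = 0 then (x - y, - y, z, c) else (0, x, y, c))"

text \<open>Speaks of \<open>k\<close> and the coefficients only, so one evaluation serves every
  \<open>n\<close>. The third condition pairs \<open>c\<close> with \<open>- c\<close> because
  \<open>w\<close> and \<open>d\<close> take each absolute value with one uncontrolled sign; for
  \<open>c = 0\<close> a diagonal can be its own partner.\<close>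

definition admissible :: "nat \<Rightarrow> coeffs list \<Rightarrow> bool"
  where "admissible k P \<longleftrightarrow> length P = k \<and>
    (\<forall>p\<in>set P. case p of (x, y, z, c) \<Rightarrow>
      (x, y, z) \<in> {(1, 0, 0), (-1, 0, 0), (0, 1, 0), (0, -1, 0), (0, 0, 1), (0, 0, -1)}) \<and>
    (\<forall>p\<in>set (tl P). fst (snd (snd p)) = 0) \<and>
    (\<forall>r\<in>{..<k}. \<exists>j\<in>{..<k}. \<exists>j'\<in>{..<k}. case (P ! j, P ! j') of ((x, y, z, c), (x', y', z', c')) \<Rightarrow>
      x' = x \<and> y' = y \<and> z' = z \<and> c' = - c \<and> c mod int k = int r) \<and>
    (\<forall>f\<in>{row_shift, col_shift}. (\<Sum>j\<leftarrow>[0..<k]. shifted (f j) (P ! j)) = 0 \<and>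
      (\<forall>b\<in>{..<k}. \<forall>a\<in>{..<b}. nonmultiple k (\<Sum>j\<leftarrow>[a..<b]. shifted (f j) (P ! j))))"

text \<open>Diagonal \<open>0\<close> makes the block sums vanish. The other diagonals come in pairs \<open>f - c q\<close>,
  \<open>f + c q\<close> with \<open>f\<close> among \<open>\<plusminus>w\<close>, \<open>d\<close>; as \<open>c\<close> ranges over all residues modulo \<open>k\<close> and
  \<open>\<bar>f\<bar>\<close> over \<open>{1..n}\<close>, all differences occur up to sign. The coefficients \<open>c\<close> were found by
  a computer search for orders without vanishing partial sums.\<close>

lemma admissible_3: "admissible 3 [(0, 1, 0, 0), (1, 0, 0, 1), (1, 0, 0, - 1)]"
  unfolding admissible_def ball_simps by code_simp

lemma admissible_5:
  "admissible 5 [(0, 0, - 1, 0), (1, 0, 0, 1), (0, 1, 0, - 2), (0, 1, 0, 2), (1, 0, 0, - 1)]"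
  unfolding admissible_def ball_simps by code_simp

lemma admissible_7:
  "admissible 7 [(0, 1, 0, 0), (- 1, 0, 0, 1), (1, 0, 0, - 3), (1, 0, 0, - 2), (1, 0, 0, 2),
     (1, 0, 0, 3), (- 1, 0, 0, - 1)]"
  unfolding admissible_def ball_simps by code_simp

lemma admissible_9:
  "admissible 9 [(0, 0, - 1, 0), (0, 1, 0, 1), (- 1, 0, 0, 4), (1, 0, 0, 2), (1, 0, 0, - 3),
     (1, 0, 0, 3), (1, 0, 0, - 2), (- 1, 0, 0, - 4), (0, 1, 0, - 1)]"
  unfolding admissible_def ball_simps by code_simp

text \<open>\<open>d_add_d\<close> rules out the vanishing of a partial sum of the last shape in
  \<open>nonmultiple\<close>; the other shapes are excluded by \<open>w\<close> and \<open>d\<close>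
  being nonzero.\<close>

locale signed_sequence =
  fixes n :: nat and w d :: "nat \<Rightarrow> int"
  assumes odd_n: "odd n" and n_ge_3: "3 \<le> n"
    and w_mod: "w (i mod n) = w i" and d_eq: "d i = - (w i + w (Suc i))"
    and w_bounds: "w i \<noteq> 0" "\<bar>w i\<bar> \<le> int n" and d_bounds: "d i \<noteq> 0" "\<bar>d i\<bar> \<le> int n"
    and d_add_d: "d i + d (Suc i) \<noteq> 0"
    and w_ex: "0 < r \<Longrightarrow> r \<le> int n \<Longrightarrow> \<exists>i. \<bar>w i\<bar> = r"
    and d_ex: "0 < r \<Longrightarrow> r \<le> int n \<Longrightarrow> \<exists>i. \<bar>d i\<bar> = r"
begin

definition entry :: "coeffs \<Rightarrow> nat \<Rightarrow> int"
  where "entry p i = (case p of (x, y, z, c) \<Rightarrow>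
    x * w i + y * d i + z * d (Suc i) + c * (2 * int n + 1))"

lemma d_mod: "d (i mod n) = d i"
  using w_mod[of "Suc i"] w_mod[of "Suc (i mod n)"] by (simp add: d_eq w_mod mod_Suc_eq)

lemma d_Suc_mod: "d (Suc (i mod n)) = d (Suc i)"
  by (metis d_mod mod_Suc_eq)

lemma entry_mod: "entry p (i mod n) = entry p i"
  by (cases p) (simp add: entry_def w_mod d_mod d_Suc_mod)

lemma entry_shifted:
  assumes "s \<le> 1" "s = 0 \<or> fst (snd (snd p)) = 0"
  shows "entry p (i + s) = combine (w i) (w (Suc i)) (d (Suc i)) (2 * int n + 1) (shifted s p)"
proof -
  obtain x y z c where p: "p = (x, y, z, c)" by (cases p) auto
  consider "s = 0" | "s = 1" "z = 0" using assms by (cases "s = 0") (auto simp: p)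
  then show ?thesis
    by cases (simp_all add: entry_def shifted_def combine_def p d_eq[of i] algebra_simps)
qed

lemma abs_entry:
  assumes "(x, y, z) \<in> {(1, 0, 0), (-1, 0, 0), (0, 1, 0), (0, -1, 0), (0, 0, 1), (0, 0, -1)}"
  shows "x * w i + y * d i + z * d (Suc i) \<noteq> 0" "\<bar>x * w i + y * d i + z * d (Suc i)\<bar> \<le> int n"
    "0 < r \<Longrightarrow> r \<le> int n \<Longrightarrow> \<exists>i. \<bar>x * w i + y * d i + z * d (Suc i)\<bar> = r"
proof -
  show "x * w i + y * d i + z * d (Suc i) \<noteq> 0" "\<bar>x * w i + y * d i + z * d (Suc i)\<bar> \<le> int n"
    using assms w_bounds d_bounds by auto
  assume r: "0 < r" "r \<le> int n"
  obtain i where i: "\<bar>d i\<bar> = r" using d_ex[OF r] by blast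
  \<comment> \<open>The indices are cyclic, so \<open>n - 1\<close> serves as -1.\<close>
  have "d (Suc (i + (n - 1))) = d i" using d_mod[of "i + n"] n_ge_3 by (simp add: d_mod)
  then have "\<exists>i. \<bar>d (Suc i)\<bar> = r" using i by metis
  then show "\<exists>i. \<bar>x * w i + y * d i + z * d (Suc i)\<bar> = r"
    using assms w_ex[OF r] d_ex[OF r] by auto
qed

theorem diagonal_array_entry:
  assumes k: "odd k" "3 \<le> k" and P: "admissible k P"
  shows "diagonal_array n k (2 * n + 1) k (\<lambda>i j. entry (P ! j) i)"
proof
  let ?q = "2 * int n + 1"
  have v: "int ((2 * n + 1) * k) = int k * ?q" "int (2 * n + 1) = ?q" by (simp_all add: algebra_simps)
  have len: "length P = k"
    and forms: "\<forall>p\<in>set P. case p of (x, y, z, c) \<Rightarrow>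
      (x, y, z) \<in> {(1, 0, 0), (-1, 0, 0), (0, 1, 0), (0, -1, 0), (0, 0, 1), (0, 0, -1)}"
    and tail: "\<forall>p\<in>set (tl P). fst (snd (snd p)) = 0"
    and residues: "\<forall>r\<in>{..<k}. \<exists>j\<in>{..<k}. \<exists>j'\<in>{..<k}.
      case (P ! j, P ! j') of ((x, y, z, c), (x', y', z', c')) \<Rightarrow>
        x' = x \<and> y' = y \<and> z' = z \<and> c' = - c \<and> c mod int k = int r"
    and sums: "\<forall>f\<in>{row_shift, col_shift}. (\<Sum>j\<leftarrow>[0..<k]. shifted (f j) (P ! j)) = 0 \<and>
      (\<forall>b\<in>{..<k}. \<forall>a\<in>{..<b}. nonmultiple k (\<Sum>j\<leftarrow>[a..<b]. shifted (f j) (P ! j)))"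
    using P unfolding admissible_def by - (elim conjE, assumption)+
  have form: "(x, y, z) \<in> {(1, 0, 0), (-1, 0, 0), (0, 1, 0), (0, -1, 0), (0, 0, 1), (0, 0, -1)}"
    if "j < k" "P ! j = (x, y, z, c)" for j x y z c
  proof -
    have "P ! j \<in> set P" using that(1) by (simp add: len)
    from bspec[OF forms this] show ?thesis unfolding that(2) prod.case .
  qed
  have shift0: "fst (snd (snd (P ! j))) = 0" if "j < k" "0 < j" for j
  proof -
    have "tl P ! (j - 1) = P ! j" "j - 1 < length (tl P)"
      using that len by (auto simp: nth_tl)
    then have "P ! j \<in> set (tl P)" by (metis nth_mem)
    then show ?thesis using tail by blast
  qed
  have shift: "f \<in> {row_shift, col_shift} \<Longrightarrow> f j \<le> 1 \<and> (f j = 0 \<or> 0 < j)" for f j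
    by (auto simp: row_shift_def col_shift_def)
  have entry: "entry (P ! j) (i + f j) =
      combine (w i) (w (Suc i)) (d (Suc i)) ?q (shifted (f j) (P ! j))"
    if "f \<in> {row_shift, col_shift}" "j < k" for f i j
    using shift[OF that(1), of j] shift0[OF that(2)] by (intro entry_shifted) auto
  have sum: "(\<Sum>j\<in>{a..<b}. entry (P ! j) (i + f j)) =
      combine (w i) (w (Suc i)) (d (Suc i)) ?q (\<Sum>j\<leftarrow>[a..<b]. shifted (f j) (P ! j))"
    if "f \<in> {row_shift, col_shift}" "b \<le> k" for f i a b
    unfolding interv_sum_list_conv_sum_set_nat combine_sum
    using that(2) by (intro sum.cong refl entry[OF that(1)]) auto
  have zero: "int ((2 * n + 1) * k) dvd (\<Sum>j<k. entry (P ! j) (i + f j))"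
    if "f \<in> {row_shift, col_shift}" for f i
  proof -
    have "(\<Sum>j\<leftarrow>[0..<k]. shifted (f j) (P ! j)) = 0"
      using bspec[OF sums that] by (rule conjunct1)
    then show ?thesis using sum[OF that, of k i 0]
      by (simp add: lessThan_atLeast0 combine_def zero_prod_def)
  qed
  have simple: "\<not> int ((2 * n + 1) * k) dvd (\<Sum>j\<in>{a..<b}. entry (P ! j) (i + f j))"
    if f: "f \<in> {row_shift, col_shift}" and ab: "a < b" "b < k" for f i a b
  proof -
    have "nonmultiple k (\<Sum>j\<leftarrow>[a..<b]. shifted (f j) (P ! j))"
      using bspec[OF sums f] ab by simp
    moreover have "\<bar>w i + w (Suc i)\<bar> \<le> int n" "w i + w (Suc i) \<noteq> 0" "d (Suc i) \<noteq> w i + w (Suc i)"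
      using d_bounds[of i] d_add_d[of i] d_eq[of i] by linarith+
    ultimately show ?thesis unfolding sum[OF f less_imp_le[OF ab(2)]] v
      by (intro nonmultiple w_bounds d_bounds)
  qed
  show "odd n" "3 \<le> n" "odd k" "3 \<le> k" by (rule odd_n n_ge_3 k)+
  show "2 \<le> 2 * n + 1" "0 < k" using n_ge_3 k by auto
  show "(2 * n + 1) * k = 2 * n * k + k" by simp
  show "entry (P ! j) (i mod n) = entry (P ! j) i" for i j by (rule entry_mod)
  show "\<not> int (2 * n + 1) dvd entry (P ! j) i" if "j < k" for i j
  proof -
    obtain x y z c where p: "P ! j = (x, y, z, c)" by (cases "P ! j") auto
    let ?R = "x * w i + y * d i + z * d (Suc i)"
    have R: "?R \<noteq> 0" "\<bar>?R\<bar> \<le> int n" by (rule abs_entry[OF form[OF that p]])+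
    then have "\<not> ?q dvd ?R" using dvd_imp_le_int[of ?R ?q] by auto
    moreover have "entry (P ! j) i = ?R + c * ?q" by (simp add: entry_def p)
    moreover have "?q dvd c * ?q" by simp
    ultimately show ?thesis unfolding v by (metis dvd_add_left_iff)
  qed
  show "\<exists>i. \<exists>j<k. [entry (P ! j) i = u] (mod int ((2 * n + 1) * k)) \<or>
      [entry (P ! j) i = - u] (mod int ((2 * n + 1) * k))" if "\<not> int (2 * n + 1) dvd u" for u
  proof -
    \<comment> \<open>The least absolute residue of \<open>u\<close> modulo
      \<open>2 * n + 1\<close>: its absolute value is met by \<open>w\<close> or \<open>d\<close>,
      the remaining multiple \<open>C\<close> by a coefficient \<open>c\<close>.\<close>
    define R where "R = (if u mod ?q \<le> int n then u mod ?q else u mod ?q - ?q)"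
    define C where "C = (u - R) div ?q"
    have "0 < u mod ?q" using that pos_mod_sign[of ?q u] unfolding v
      by (auto simp: dvd_eq_mod_eq_0 order.order_iff_strict)
    then have R: "0 < \<bar>R\<bar>" "\<bar>R\<bar> \<le> int n"
      using pos_mod_bound[of ?q u] by (auto simp: R_def)
    have "?q dvd u - R" by (simp add: R_def mod_eq_dvd_iff[symmetric])
    then have u: "u = R + C * ?q" by (simp add: C_def)
    have "nat (C mod int k) \<in> {..<k}" using k by (simp add: nat_less_iff)
    from bspec[OF residues this] obtain j j' where j: "j \<in> {..<k}" "j' \<in> {..<k}"
      "case (P ! j, P ! j') of ((x, y, z, c), (x', y', z', c')) \<Rightarrow>
        x' = x \<and> y' = y \<and> z' = z \<and> c' = - c \<and> c mod int k = int (nat (C mod int k))"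
      by (elim bexE) (rule that)
    obtain x y z c where p: "P ! j = (x, y, z, c)" by (rule prod_cases4)
    obtain x' y' z' c' where p': "P ! j' = (x', y', z', c')" by (rule prod_cases4)
    note j(3)[unfolded p p' prod.case]
    then have p': "P ! j' = (x, y, z, - c)" and c: "c mod int k = C mod int k"
      using k by (simp_all add: p')
    obtain i where i: "\<bar>x * w i + y * d i + z * d (Suc i)\<bar> = \<bar>R\<bar>"
      using abs_entry(3)[OF form[OF _ p] R] j by auto
    have "int k dvd c - C" using c by (simp add: mod_eq_dvd_iff)
    then have *: "int k * ?q dvd (c - C) * ?q" by (rule mult_dvd_mono) simp
    from i consider "x * w i + y * d i + z * d (Suc i) = R" | "x * w i + y * d i + z * d (Suc i) = - R"
      by linarith
    then show ?thesis
    proof cases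
      case 1
      then have "entry (P ! j) i - u = (c - C) * ?q" by (simp add: entry_def p u algebra_simps)
      then have "[entry (P ! j) i = u] (mod int ((2 * n + 1) * k))"
        using * unfolding v cong_iff_dvd_diff by simp
      then show ?thesis using j by blast
    next
      \<comment> \<open>The form has the value \<open>- R\<close>, so the partner diagonal with
        \<open>- c\<close> supplies \<open>- u\<close>.\<close>
      case 2
      then have "entry (P ! j') i - (- u) = - ((c - C) * ?q)" by (simp add: entry_def p' u algebra_simps)
      then have "[entry (P ! j') i = - u] (mod int ((2 * n + 1) * k))"
        using * unfolding v cong_iff_dvd_diff by (metis dvd_minus_iff)
      then show ?thesis using j by blast
    qed
  qed
  show "int ((2 * n + 1) * k) dvd (\<Sum>j<k. entry (P ! j) (i + row_shift j))"
    "int ((2 * n + 1) * k) dvd (\<Sum>j<k. entry (P ! j) (i + col_shift j))" for i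
    using zero by simp_all
  show "\<not> int ((2 * n + 1) * k) dvd (\<Sum>j\<in>{a..<b}. entry (P ! j) (i + row_shift j))"
    "\<not> int ((2 * n + 1) * k) dvd (\<Sum>j\<in>{a..<b}. entry (P ! j) (i + col_shift j))"
    if "a < b" "b < k" for a b i
    using simple[of row_shift] simple[of col_shift] that by simp_all
qed

end

text \<open>Up to sign, both the sequence and the sums of its cyclically adjacent terms run through
  \<open>1, \<dots>, 4m + 3\<close>.\<close>

definition zigzag :: "nat \<Rightarrow> nat \<Rightarrow> int"
  where "zigzag m i = (let r = i mod (4 * m + 3); h = int (r div 2); m' = int m in
    if even r then (if r \<le> 2 * m then m' + 1 - h else m' + 1 + h)
    else (if r \<le> 2 * m + 1 then - (3 * m' + 3 + h) else - (3 * m' + 2 - h)))"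

definition zigzag_diff :: "nat \<Rightarrow> nat \<Rightarrow> int"
  where "zigzag_diff m i = - (zigzag m i + zigzag m (Suc i))"

text \<open>Signs alternate, so adjacent sums are differences of absolute values and change by one
  per step. They give 2 m + 2, ..., 4 m + 2 in the first half and -1, ..., - 2 m in the second; the
  missing 2 m + 1 appears at the turning point and - (4 m + 3) at the wrap-around, where two terms
  of equal sign meet.\<close>

lemma zigzag_diff_eq:
  "zigzag_diff m i = (let r = i mod (4 * m + 3) in
    if r \<le> 2 * m then 2 * int m + 2 + int r else if r = 2 * m + 1 then 2 * int m + 1
    else if r \<le> 4 * m + 1 then - (int r - 2 * int m - 1) else - (4 * int m + 3))"
proof -
  define r where "r = i mod (4 * m + 3)"
  have r: "r < 4 * m + 3" by (simp add: r_def)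
  have S: "Suc i mod (4 * m + 3) = (if r = 4 * m + 2 then 0 else Suc r)"
    by (auto simp: r_def mod_Suc)
  obtain h where h: "r = 2 * h \<or> r = Suc (2 * h)" by (metis evenE oddE Suc_eq_plus1)
  moreover have "Suc (2 * h) \<noteq> Suc (Suc (4 * m))" by presburger
  ultimately show ?thesis
    unfolding zigzag_diff_def zigzag_def S r_def[symmetric] Let_def
    using r by (elim disjE) auto
qed

lemma signed_sequence_zigzag:
  assumes "n = 4 * m + 3"
  shows "signed_sequence n (zigzag m) (zigzag_diff m)"
proof
  show "odd n" "3 \<le> n" by (simp_all add: assms)
  show "zigzag m (i mod n) = zigzag m i" for i by (simp add: zigzag_def assms)
  show "zigzag_diff m i = - (zigzag m i + zigzag m (Suc i))" for i by (simp add: zigzag_diff_def)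
  fix i
  define r where "r = i mod (4 * m + 3)"
  have r: "r < 4 * m + 3" by (simp add: r_def)
  have S: "Suc i mod (4 * m + 3) = (if r = 4 * m + 2 then 0 else Suc r)"
    by (auto simp: r_def mod_Suc)
  obtain h where h: "r = 2 * h \<or> r = Suc (2 * h)" by (metis evenE oddE Suc_eq_plus1)
  show "zigzag m i \<noteq> 0" "\<bar>zigzag m i\<bar> \<le> int n"
    using h r unfolding zigzag_def r_def[symmetric] Let_def assms by auto
  show "zigzag_diff m i \<noteq> 0" "\<bar>zigzag_diff m i\<bar> \<le> int n"
    using r unfolding zigzag_diff_eq r_def[symmetric] Let_def assms by auto
  show "zigzag_diff m i + zigzag_diff m (Suc i) \<noteq> 0"
    using r unfolding zigzag_diff_eq S r_def[symmetric] Let_def by auto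
next
  fix r :: int assume r: "0 < r" "r \<le> int n"
  define s where "s = nat r"
  have s: "r = int s" "0 < s" "s \<le> 4 * m + 3" using r assms by (auto simp: s_def)
  have "\<exists>i<4 * m + 3. \<bar>zigzag m i\<bar> = r"
  proof -
    \<comment> \<open>The ranges are the absolute values on the four branches of
      \<open>zigzag\<close>: even early, odd late, even late, odd early. Each witness inverts its
      branch.\<close>
    consider "s \<le> m + 1" | "m + 2 \<le> s" "s \<le> 2 * m + 1" | "2 * m + 2 \<le> s" "s \<le> 3 * m + 2"
      | "3 * m + 3 \<le> s" by linarith
    then show ?thesis
    proof cases
      case 1
      then show ?thesis using s by (intro exI[of _ "2 * (m + 1 - s)"]) (auto simp: zigzag_def Let_def)
    next
      case 2
      then show ?thesis using s
        by (intro exI[of _ "Suc (2 * (3 * m + 2 - s))"]) (auto simp: zigzag_def Let_def)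
    next
      case 3
      then show ?thesis using s by (intro exI[of _ "2 * (s - m - 1)"]) (auto simp: zigzag_def Let_def)
    next
      case 4
      then show ?thesis using s
        by (intro exI[of _ "Suc (2 * (s - 3 * m - 3))"]) (auto simp: zigzag_def Let_def)
    qed
  qed
  then show "\<exists>i. \<bar>zigzag m i\<bar> = r" by blast
  have "\<exists>i<4 * m + 3. \<bar>zigzag_diff m i\<bar> = r"
  proof -
    consider "s \<le> 2 * m" | "s = 2 * m + 1" | "2 * m + 2 \<le> s" "s \<le> 4 * m + 2" | "s = 4 * m + 3"
      using s by linarith
    then show ?thesis
    proof cases
      case 1
      then show ?thesis using s
        by (intro exI[of _ "s + 2 * m + 1"]) (auto simp: zigzag_diff_eq Let_def)
    next
      case 2
      then show ?thesis using s
        by (intro exI[of _ "2 * m + 1"]) (auto simp: zigzag_diff_eq Let_def)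
    next
      case 3
      then show ?thesis using s
        by (intro exI[of _ "s - 2 * m - 2"]) (auto simp: zigzag_diff_eq Let_def)
    next
      case 4
      then show ?thesis using s
        by (intro exI[of _ "4 * m + 2"]) (auto simp: zigzag_diff_eq Let_def)
    qed
  qed
  then show "\<exists>i. \<bar>zigzag_diff m i\<bar> = r" by blast
qed

section \<open>Arrays with n or 2n vertices in each part\<close>

text \<open>Rows shift diagonal 2 and columns shift diagonal 1, so a block at \<open>i\<close>
  contains \<open>M\<close> with the total factor - 2 i + (i - 1) + i = - 1. Hence its sum vanishes
  modulo \<open>M * n\<close> if 1 + a + b = M; this explains the slope \<open>- 2 * M\<close> and
  the offset in \<open>r - 1\<close>.\<close>

definition linear_array :: "nat \<Rightarrow> int \<Rightarrow> int \<Rightarrow> int \<Rightarrow> nat \<Rightarrow> nat \<Rightarrow> int"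
  where "linear_array n M a b i j = (let r = int (i mod n) in
    if j = 0 then 1 - 2 * M * r else (if j = 1 then a else b) + M * (r - 1))"

lemma cong_linear_array:
  "[linear_array n M a b i j =
    (if j = 0 then 1 - 2 * M * int i else (if j = 1 then a else b) + M * (int i - 1))] (mod M * int n)"
proof -
  have "[int (i mod n) = int i] (mod int n)" by (simp add: cong_def zmod_int)
  then have "M * int n dvd M * (int (i mod n) - int i)"
    by (intro mult_dvd_mono) (simp_all add: cong_iff_dvd_diff)
  then obtain h where "M * (int (i mod n) - int i) = M * int n * h" by (rule dvdE)
  then have h: "M * int (i mod n) = M * int i + M * int n * h" by (simp add: right_diff_distrib)
  show ?thesis
    unfolding cong_iff_dvd_diff
  proof (rule dvdI)
    show "linear_array n M a b i j -
      (if j = 0 then 1 - 2 * M * int i else (if j = 1 then a else b) + M * (int i - 1)) =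
      M * int n * (if j = 0 then - 2 * h else h)"
      using h by (simp add: linear_array_def Let_def algebra_simps)
  qed
qed

text \<open>Each diagonal runs through a residue class modulo \<open>M\<close> in steps of
  \<open>M\<close> or \<open>- 2 * M\<close>; as \<open>n\<close> is odd, both reach all
  \<open>n\<close> members modulo \<open>M * n\<close>.\<close>

lemma linear_array_hits:
  assumes n: "odd n" and c: "c = 1 \<or> c = a \<or> c = b" and u: "M dvd u - c"
  shows "\<exists>i. \<exists>j<3. [linear_array n M a b i j = u] (mod M * int n)"
proof -
  obtain e where "u - c = M * e" using u by (rule dvdE)
  then have e: "u = c + M * e" by simp
  have n0: "0 < int n" using n by (auto elim: oddE)
  have hit: "[linear_array n M a b i j = u] (mod M * int n)"
    if "(if j = 0 then 1 - 2 * M * int i else (if j = 1 then a else b) + M * (int i - 1)) = c + M * g"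
      "[g = e] (mod int n)" for i j g
  proof -
    have "M * int n dvd M * (g - e)" using that(2) by (intro mult_dvd_mono) (simp_all add: cong_iff_dvd_diff)
    then have "[c + M * g = u] (mod M * int n)" by (simp add: cong_iff_dvd_diff e algebra_simps)
    moreover have "[linear_array n M a b i j = c + M * g] (mod M * int n)"
      using cong_linear_array[of n M a b i j] unfolding that(1) .
    ultimately show ?thesis by (rule cong_trans[rotated])
  qed
  show ?thesis
  proof (cases "c = 1")
    case True
    have "coprime 2 (int n)" using n by simp
    then obtain x where x: "[2 * x = 1] (mod int n)" using cong_solve_coprime_int by blast
    \<comment> \<open>\<open>x\<close> is the inverse of 2 modulo \<open>n\<close>, so this solves -
      2 r = e.\<close>
    define r where "r = - e * x mod int n"
    have r: "0 \<le> r" using n0 by (simp add: r_def)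
    have "[- 2 * r = - 2 * (- e * x)] (mod int n)" by (intro cong_mult cong_refl) (simp add: r_def)
    also have "- 2 * (- e * x) = e * (2 * x)" by simp
    also have "[e * (2 * x) = e * 1] (mod int n)" by (intro cong_mult cong_refl x)
    finally have "[- 2 * r = e] (mod int n)" by simp
    then have "[linear_array n M a b (nat r) 0 = u] (mod M * int n)"
      by (intro hit[of 0 "nat r" "- 2 * r"]) (simp_all add: r True)
    moreover have "0 < (3 :: nat)" by simp
    ultimately show ?thesis by blast
  next
    case False
    define r where "r = (e + 1) mod int n"
    define j :: nat where "j = (if c = a then 1 else 2)"
    have r: "0 \<le> r" using n0 by (simp add: r_def)
    have "[r - 1 = e + 1 - 1] (mod int n)" by (intro cong_diff cong_refl) (simp add: r_def)
    then have "[r - 1 = e] (mod int n)" by simp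
    then have "[linear_array n M a b (nat r) j = u] (mod M * int n)"
      using False c by (intro hit[of j "nat r" "r - 1"]) (auto simp: r j_def)
    moreover have "j < 3" by (simp add: j_def)
    ultimately show ?thesis by blast
  qed
qed

text \<open>Of three terms with sum 0, two add up to the negative of the third.\<close>

lemma consecutive_sum_not_dvd:
  fixes f :: "nat \<Rightarrow> int"
  assumes "v dvd (\<Sum>j<3. f j)" "\<And>j. j < 3 \<Longrightarrow> \<not> v dvd f j" "a < b" "b < 3"
  shows "\<not> v dvd (\<Sum>j\<in>{a..<b}. f j)"
proof -
  have "v dvd f 0 + f 1 + f 2" using assms(1) by (simp add: eval_nat_numeral)
  then have "\<not> v dvd f 0 + f 1" using assms(2)[of 2] dvd_add_right_iff by auto
  moreover have "a = 0 \<and> b = 1 \<or> a = 1 \<and> b = 2 \<or> a = 0 \<and> b = 2" using assms(3,4) by auto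
  ultimately show ?thesis using assms(2)[of 0] assms(2)[of 1] by (auto simp: numeral_2_eq_2)
qed

text \<open>Here v = 7 n or v = 8 n, which is \<open>M * n\<close>. Up to sign, 1, 4, 2 represent
  the nonzero classes modulo 7, and 1, 5, 2 the classes modulo 8 that are no multiples of 4. Using 5
  in place of its negative 3 makes the sum equal to 8.\<close>

lemma diagonal_array_linear:
  assumes n: "odd n" "3 \<le> n"
    and cases: "q = 7 \<and> t = n \<and> M = 7 \<and> a = 4 \<and> b = 2 \<or> q = 4 \<and> t = 2 * n \<and> M = 8 \<and> a = 5 \<and> b = 2"
  shows "diagonal_array n 3 q t (linear_array n M a b)"
proof
  have v: "int (q * t) = M * int n" using cases by auto
  have ab: "1 + a + b = M" using cases by auto
  have qM: "int q dvd M" using cases by auto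
  show "odd n" "3 \<le> n" "odd (3::nat)" "3 \<le> (3::nat)" using n by simp_all
  show "2 \<le> q" "0 < t" "q * t = 2 * n * 3 + t" using cases n by auto
  show "linear_array n M a b (i mod n) j = linear_array n M a b i j" for i j
    by (simp add: linear_array_def)
  show not_dvd: "\<not> int q dvd linear_array n M a b i j" for i j
  proof -
    let ?c = "if j = 0 then 1 else if j = 1 then a else b"
    have "linear_array n M a b i j = ?c + M * (if j = 0 then - 2 * int (i mod n) else int (i mod n) - 1)"
      by (simp add: linear_array_def Let_def)
    moreover have "int q dvd M * x" for x using qM by simp
    moreover have "\<not> int q dvd 1" "\<not> int q dvd a" "\<not> int q dvd b" using cases by (elim disjE conjE; simp)+
    then have "\<not> int q dvd ?c" by simp
    ultimately show ?thesis by (simp only: dvd_add_left_iff not_False_eq_True)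
  qed
  show "\<exists>i. \<exists>j<3. [linear_array n M a b i j = z] (mod int (q * t)) \<or>
      [linear_array n M a b i j = - z] (mod int (q * t))" if "\<not> int q dvd z" for z
  proof -
    have "\<exists>c\<in>{1, a, b}. M dvd z - c \<or> M dvd - z - c" using cases
    proof (elim disjE conjE)
      assume *: "q = 7" "M = 7" "a = 4" "b = 2"
      then have "\<not> 7 dvd z" using that by simp
      then have "7 dvd z - 1 \<or> 7 dvd z - 4 \<or> 7 dvd z - 2 \<or> 7 dvd - z - 1 \<or> 7 dvd - z - 4 \<or> 7 dvd - z - 2"
        by presburger
      then show ?thesis unfolding * by blast
    next
      assume *: "q = 4" "M = 8" "a = 5" "b = 2"
      then have "\<not> 4 dvd z" using that by simp
      then have "8 dvd z - 1 \<or> 8 dvd z - 5 \<or> 8 dvd z - 2 \<or> 8 dvd - z - 1 \<or> 8 dvd - z - 5 \<or> 8 dvd - z - 2"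
        by presburger
      then show ?thesis unfolding * by blast
    qed
    then obtain c where c: "c = 1 \<or> c = a \<or> c = b" "M dvd z - c \<or> M dvd - z - c" by blast
    then show ?thesis
      unfolding v using linear_array_hits[OF n(1) c(1), of M z] linear_array_hits[OF n(1) c(1), of M "- z"]
      by blast
  qed
  show row: "int (q * t) dvd (\<Sum>j<3. linear_array n M a b (i + row_shift j) j)" for i
  proof -
    have "[linear_array n M a b i 0 + linear_array n M a b i 1 + linear_array n M a b (Suc i) 2 =
      (1 - 2 * M * int i) + (a + M * (int i - 1)) + (b + M * (int (Suc i) - 1))] (mod M * int n)"
      using cong_linear_array[of n M a b i 0] cong_linear_array[of n M a b i 1]
        cong_linear_array[of n M a b "Suc i" 2] by (intro cong_add) simp_all
    also have "(1 - 2 * M * int i) + (a + M * (int i - 1)) + (b + M * (int (Suc i) - 1)) = 0"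
      using ab by (simp add: algebra_simps)
    finally show ?thesis
      unfolding v by (simp add: cong_0_iff row_shift_def eval_nat_numeral)
  qed
  show col: "int (q * t) dvd (\<Sum>j<3. linear_array n M a b (i + col_shift j) j)" for i
  proof -
    have "[linear_array n M a b i 0 + linear_array n M a b (Suc i) 1 + linear_array n M a b i 2 =
      (1 - 2 * M * int i) + (a + M * (int (Suc i) - 1)) + (b + M * (int i - 1))] (mod M * int n)"
      using cong_linear_array[of n M a b i 0] cong_linear_array[of n M a b "Suc i" 1]
        cong_linear_array[of n M a b i 2] by (intro cong_add) simp_all
    also have "(1 - 2 * M * int i) + (a + M * (int (Suc i) - 1)) + (b + M * (int i - 1)) = 0"
      using ab by (simp add: algebra_simps)
    finally show ?thesis
      unfolding v by (simp add: cong_0_iff col_shift_def eval_nat_numeral)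
  qed
  have v_not_dvd: "\<not> int (q * t) dvd linear_array n M a b i j" for i j
    using not_dvd by (auto dest: dvd_mult_left)
  show "\<not> int (q * t) dvd (\<Sum>j\<in>{x..<y}. linear_array n M a b (i + row_shift j) j)"
    if "x < y" "y < 3" for x y i
    by (rule consecutive_sum_not_dvd[OF row v_not_dvd that])
  show "\<not> int (q * t) dvd (\<Sum>j\<in>{x..<y}. linear_array n M a b (i + col_shift j) j)"
    if "x < y" "y < 3" for x y i
    by (rule consecutive_sum_not_dvd[OF col v_not_dvd that])
qed

theorem theorem1p3:
  fixes n k t :: nat
  assumes "n > 0" and "k > 0" and "t > 0" and "n \<ge> k"
    and "(k = 3 \<and> t \<in> {n, 2 * n} \<and> odd n) \<or>
         (k \<in> {3, 5, 7, 9} \<and> t = k \<and> n mod 4 = 3)"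
  shows "\<exists>D D'. D \<noteq> D' \<and>
    cyclic_cycle_decomposition k (complete_multipartite ((2 * n * k + t) div t) t) D \<and>
    cyclic_cycle_decomposition k (complete_multipartite ((2 * n * k + t) div t) t) D' \<and>
    (\<exists>(X :: (nat \<times> complex) topology) \<psi>.
       surface X \<and> orientable X \<and>
       biembedding (complete_multipartite ((2 * n * k + t) div t) t) D D' X \<psi> \<and>
       cellular (complete_multipartite ((2 * n * k + t) div t) t) X \<psi>)"
proof -
  define q where "q = (2 * n * k + t) div t"
  have "\<exists>X. diagonal_array n k q t X"
    using assms(5)
  proof (elim disjE conjE)
    assume k: "k = 3" and t: "t \<in> {n, 2 * n}" and n: "odd n"
    have n3: "3 \<le> n" using assms(4) k by simp
    from t consider "t = n" | "t = 2 * n" by blast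
    then show "\<exists>X. diagonal_array n k q t X"
    proof cases
      case 1
      then have "q = 7" using assms(1) by (simp add: q_def k)
      then show ?thesis unfolding k
        using diagonal_array_linear[OF n n3, of q t 7 4 2] 1 by (intro exI) simp
    next
      case 2
      then have "2 * n * k + t = 4 * t" by (simp add: k)
      then have "q = 4" using assms(3) by (simp add: q_def)
      then show ?thesis unfolding k
        using diagonal_array_linear[OF n n3, of q t 8 5 2] 2 by (intro exI) simp
    qed
  next
    assume k: "k \<in> {3, 5, 7, 9}" and t: "t = k" and n: "n mod 4 = 3"
    have "2 * n * k + t = (2 * n + 1) * k" by (simp add: t)
    then have q: "q = 2 * n + 1" using assms(2) by (simp add: q_def t)
    have "n = 4 * (n div 4) + 3" using n mult_div_mod_eq[of 4 n] by simp
    then interpret signed_sequence n "zigzag (n div 4)" "zigzag_diff (n div 4)"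
      by (rule signed_sequence_zigzag)
    have "\<exists>P. admissible k P"
      using k
    proof (elim insertE emptyE)
    qed (auto intro: admissible_3 admissible_5 admissible_7 admissible_9)
    then obtain P where "admissible k P" by blast
    moreover have "odd k" "3 \<le> k" using k by auto
    ultimately show "\<exists>X. diagonal_array n k q t X"
      unfolding q t by (intro exI) (rule diagonal_array_entry)
  qed
  then obtain X where "diagonal_array n k q t X" ..
  from diagonal_array.ex_biembedding[OF this] show ?thesis unfolding q_def .
qed

end
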